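(* Let $n\geqslant 1$ and let $q$ be a nonzero complex number which is not a root of unity. Let $\mu$ be a Young diagram with $m$ boxes and $\mathcal U$ a standard $\mu$-tableau. The image of the $q$-immanant $\mathbb S_\mu$ under the homomorphism $\mathrm U^\circ_q(\mathfrak{gl}_n)\to\mathcal W_n$ defined by $K\mapsto M\mathcal D$ is given by $$\mathbb S_\mu\mapsto a_\mu\,\mathrm{tr}_{q\,(1,\dots,m)}\,M_{\overline 1}\cdots M_{\overline m}\,\mathcal D_{\overline m}\cdots\mathcal D_{\overline 1}\,\mathcal E_{\mathcal U},\qquad a_\mu=\prod_{\alpha\in\mu}q^{-2c(\alpha)}.$$
   Context: $R$-matrices. Let $e_{ij}\in\mathrm{End}\,\mathbb C^n$ be the matrix units, $P=\sum_{i,j}e_{ij}\otimes e_{ji}$, $R=q\sum_i e_{ii}\otimes e_{ii}+\sum_{i\ne j}e_{ii}\otimes e_{jj}+(q-q^{-1})\sum_{i<j}e_{ij}\otimes e_{ji}$, $\check R=PR$, and let $\check R_k$ denote $\check R$ acting in the tensor factors $k,k+1$ of $(\mathbb C^n)^{\otimes m}$. The algebra $\mathrm U^\circ_q(\mathfrak{gl}_n)$. $\mathrm U_q(\mathfrak{gl}_n)$ is the associative algebra generated by the entries of an upper triangular matrix $L^+=[l^+_{ij}]$ and a lower triangular matrix $L^-=[l^-_{ij}]$ subject to $l^+_{ii}l^-_{ii}=l^-_{ii}l^+_{ii}=1$, $RL^\pm_1L^\pm_2=L^\pm_2L^\pm_1R$, $RL^+_1L^-_2=L^-_2L^+_1R$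 (the subscript of a matrix indicates the copy of $\mathrm{End}\,\mathbb C^n$ in which it is placed). $\mathrm U^\circ_q(\mathfrak{gl}_n)$ is the subalgebra generated by the entries of $L=L^+(L^-)^{-1}$; the matrix $L$ satisfies the reflection equation $\check RL_1\check RL_1=L_1\check RL_1\check R$. Set $K=L+\frac{1}{q-q^{-1}}$ (a scalar added to a matrix means that multiple of the identity matrix). Braided Weyl algebra. $\mathcal W_n$ is the associative algebra generated by $m_{ij},\partial_{ij}$, $1\leqslant i,j\leqslant n$, with relations, for $M=[m_{ij}]$ and $\mathcal D=[\partial_{ij}]$: $\check RM_1\check RM_1=M_1\check RM_1\check R$; $\check R^{-1}\mathcal D_1\check R^{-1}\mathcal D_1=\mathcal D_1\check R^{-1}\mathcal D_1\check R^{-1}$; $\mathcal D_1\check RM_1\check R=\check RM_1\check R^{-1}\mathcal D_1+\check R$. It is a known result of Gurevich, Pyatov and Saponov that the mapping $K\mapsto M\mathcal D$ defines a homomorphism $\mathrm U^\circ_q(\mathfrak{gl}_n)\to\mathcal W_n$. Overlined subscripts and $q$-trace. For an $n\times n$ matrix $X$ with entries in an algebra $\mathcal A$, elements of $(\mathrm{End}\,\mathbb C^n)^{\otimes m}\otimes\mathcal A$ are defined by $X_{\overline 1}=X_1$ and $X_{\overline k}=\check R_{k-1}\cdots\check R_1X_1\check R_1^{-1}\cdots\check R_{k-1}^{-1}$ for $k\geqslant 2$. With the scalar diagonal matrix $D=\mathrm{diag}[1,q^{-2},\dots,q^{-2n+2}]$ (not to be confused with $\mathcal D$), $\mathrm{tr}_{q\,(1,\dots,m)}Y=\mathrm{tr}_{1,\dots,m}\,D_1\cdots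 D_mY$, the trace being over all $m$ copies of $\mathrm{End}\,\mathbb C^n$. Idempotents. $\mathcal H_m$ is the Hecke algebra over $\mathbb C$ with generators $T_1,\dots,T_{m-1}$ and relations $(T_i-q)(T_i+q^{-1})=0$, $T_iT_{i+1}T_i=T_{i+1}T_iT_{i+1}$, $T_iT_j=T_jT_i$ for $|i-j|>1$; its Jucys–Murphy elements are $y_1=1$, $y_{k+1}=T_k\cdots T_2T_1^2T_2\cdots T_k$. A standard tableau $\mathcal U$ of shape $\mu\vdash m$ is a bijective filling of the boxes of $\mu$ by $1,\dots,m$ strictly increasing along rows and down columns; the content of a box $\alpha=(i,j)$ is $c(\alpha)=j-i$, and $c_k(\mathcal U)$ is the content of the box occupied by $k$. $\mathcal H_m\cong\bigoplus_{\mu\vdash m}\mathrm{Mat}_{f_\mu}(\mathbb C)$, where $f_\mu$ is the number of standard $\mu$-tableaux; $e_{\mathcal U}$ is the diagonal matrix unit (primitive idempotent) corresponding to $\mathcal U$, characterized as the nonzero idempotent with $y_ke_{\mathcal U}=e_{\mathcal U}y_k=q^{2c_k(\mathcal U)}e_{\mathcal U}$ for $k=1,\dots,m$. $\mathcal E_{\mathcal U}$ is the image of $e_{\mathcal U}$ under the action $T_k\mapsto\check R_k$ on $(\mathbb C^n)^{\otimes m}$. $q$-immanants. The $q$-immanant polynomial is $\mathbb S_\mu(z)=\mathrm{tr}_{q\,(1,\dots,m)}\,(L_{\overline 1}+zq^{-2c_1(\mathcal U)})\cdots(L_{\overline m}+zq^{-2c_m(\mathcal U)})\,\mathcal E_{\mathcal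 U}$ for any standard tableau $\mathcal U$ of shape $\mu$ (it does not depend on the choice of $\mathcal U$), and the $q$-immanant is $\mathbb S_\mu=\mathbb S_\mu\big((q-q^{-1})^{-1}\big)\in\mathrm U^\circ_q(\mathfrak{gl}_n)$. *)

theory Defs
  imports Complex_Main "HOL-Library.FuncSet" "HOL-Algebra.QuotRing" "HOL-Algebra.Generated_Rings"
    "HOL-Algebra.Module"
begin

section \<open>Complex algebras given by generators and relations\<close>

text \<open>
  A unital associative complex algebra is a record of type \<open>(complex, 'a) module\<close>: the ring
  structure of HOL-Algebra together with a scalar multiplication.
\<close>

type_synonym 'a calg = "(complex, 'a) module"

definition complex_alg :: "complex calg" where
  "complex_alg = \<lparr>carrier = UNIV, mult = (*), one = 1, zero = 0, add = (+), smult = (*)\<rparr>"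

definition calg_hom :: "'a calg \<Rightarrow> 'b calg \<Rightarrow> ('a \<Rightarrow> 'b) set" where
  "calg_hom A B = {h \<in> ring_hom A B. \<forall>c. \<forall>x\<in>carrier A. h (c \<odot>\<^bsub>A\<^esub> x) = c \<odot>\<^bsub>B\<^esub> h x}"

definition subalg_gen :: "'a calg \<Rightarrow> 'a set \<Rightarrow> 'a calg" where
  "subalg_gen A H = A\<lparr>carrier := generate_ring A (range (\<lambda>c. c \<odot>\<^bsub>A\<^esub> \<one>\<^bsub>A\<^esub>) \<union> H)\<rparr>"

text \<open>The ordered product \<open>x\<^sub>1 x\<^sub>2 \<dots>\<close> of a list of elements.\<close>

definition lprod :: "'a calg \<Rightarrow> 'a list \<Rightarrow> 'a" where
  "lprod A xs = foldr (\<otimes>\<^bsub>A\<^esub>) xs \<one>\<^bsub>A\<^esub>"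

text \<open>
  The free algebra on \<open>X\<close>: finitely supported functions on words over \<open>X\<close>, with
  the product induced by concatenation of words.
\<close>

definition free_alg :: "'x set \<Rightarrow> ('x list \<Rightarrow> complex) calg" where
  "free_alg X =
     \<lparr>carrier = {f. finite {w. f w \<noteq> 0} \<and> (\<forall>w. f w \<noteq> 0 \<longrightarrow> set w \<subseteq> X)},
      mult = (\<lambda>f g w. \<Sum>k\<le>length w. f (take k w) * g (drop k w)),
      one = (\<lambda>w. if w = [] then 1 else 0),
      zero = (\<lambda>w. 0),
      add = (\<lambda>f g w. f w + g w),
      smult = (\<lambda>c f w. c * f w)\<rparr>"

definition free_gen :: "'x \<Rightarrow> 'x list \<Rightarrow> complex" where
  "free_gen x = (\<lambda>w. if w = [x] then 1 else 0)"

definition free_eval :: "'b calg \<Rightarrow> ('x \<Rightarrow> 'b) \<Rightarrow> ('x list \<Rightarrow> complex) \<Rightarrow> 'b" where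
  "free_eval B g f = (\<Oplus>\<^bsub>B\<^esub> w \<in> {w. f w \<noteq> 0}. f w \<odot>\<^bsub>B\<^esub> lprod B (map g w))"

definition quot_alg :: "'a calg \<Rightarrow> 'a set \<Rightarrow> ('a set) calg" where
  "quot_alg A I = ring.extend (A Quot I) (module.fields (\<lambda>c X. \<Union>x\<in>X. I +>\<^bsub>A\<^esub> (c \<odot>\<^bsub>A\<^esub> x)))"

text \<open>
  \<open>presented X Rel\<close> is the algebra generated by \<open>X\<close> in which all elements of
  \<open>Rel\<close> vanish (an equation \<open>a = b\<close> enters \<open>Rel\<close> as \<open>a - b\<close>);
  \<open>pres_gen X Rel x\<close> is its generator labelled by \<open>x\<close>.
\<close>

definition presented :: "'x set \<Rightarrow> ('x list \<Rightarrow> complex) set \<Rightarrow> (('x list \<Rightarrow> complex) set) calg" where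
  "presented X Rel = quot_alg (free_alg X) (Idl\<^bsub>free_alg X\<^esub> Rel)"

definition pres_gen :: "'x set \<Rightarrow> ('x list \<Rightarrow> complex) set \<Rightarrow> 'x \<Rightarrow> ('x list \<Rightarrow> complex) set" where
  "pres_gen X Rel x = (Idl\<^bsub>free_alg X\<^esub> Rel) +>\<^bsub>free_alg X\<^esub> free_gen x"


section \<open>Matrices over an algebra\<close>

text \<open>
  \<open>mat_alg A S\<close> is the algebra of matrices with entries in \<open>A\<close> whose rows and columns are
  indexed by the finite set \<open>S\<close>. With \<open>S = {1..n}\<close> these are the \<open>n \<times> n\<close> matrices over
  \<open>A\<close>; with \<open>S = tidx n m\<close> (indices of the basis vectors
  \<open>e\<^bsub>i1\<^esub> \<otimes> \<dots> \<otimes> e\<^bsub>im\<^esub>\<close>) this is the tensor product of \<open>A\<close> with the \<open>m\<close>-fold tensor power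
  of the endomorphism algebra of the \<open>n\<close>-dimensional complex space.
\<close>

definition mat_alg :: "'a calg \<Rightarrow> 's set \<Rightarrow> ('s \<times> 's \<Rightarrow> 'a) calg" where
  "mat_alg A S =
     \<lparr>carrier = S \<times> S \<rightarrow>\<^sub>E carrier A,
      mult = (\<lambda>X Y. \<lambda>(i, j)\<in>S \<times> S. \<Oplus>\<^bsub>A\<^esub> k \<in> S. X (i, k) \<otimes>\<^bsub>A\<^esub> Y (k, j)),
      one = (\<lambda>(i, j)\<in>S \<times> S. if i = j then \<one>\<^bsub>A\<^esub> else \<zero>\<^bsub>A\<^esub>),
      zero = (\<lambda>p\<in>S \<times> S. \<zero>\<^bsub>A\<^esub>),
      add = (\<lambda>X Y. \<lambda>p\<in>S \<times> S. X p \<oplus>\<^bsub>A\<^esub> Y p),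
      smult = (\<lambda>c X. \<lambda>p\<in>S \<times> S. c \<odot>\<^bsub>A\<^esub> X p)\<rparr>"

definition tidx :: "nat \<Rightarrow> nat \<Rightarrow> nat list set" where
  "tidx n m = {I. length I = m \<and> set I \<subseteq> {1..n}}"

abbreviation tens_alg :: "'a calg \<Rightarrow> nat \<Rightarrow> nat \<Rightarrow> (nat list \<times> nat list \<Rightarrow> 'a) calg" where
  "tens_alg A n m \<equiv> mat_alg A (tidx n m)"

text \<open>A complex matrix regarded as a matrix over \<open>A\<close>.\<close>

definition scal_mat :: "'a calg \<Rightarrow> 's set \<Rightarrow> ('s \<times> 's \<Rightarrow> complex) \<Rightarrow> 's \<times> 's \<Rightarrow> 'a" where
  "scal_mat A S C = (\<lambda>p\<in>S \<times> S. C p \<odot>\<^bsub>A\<^esub> \<one>\<^bsub>A\<^esub>)"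

text \<open>\<open>X\<^sub>k\<close>: the \<open>n \<times> n\<close> matrix \<open>X\<close> placed in the \<open>k\<close>-th of \<open>m\<close> tensor factors (\<open>1 \<le> k \<le> m\<close>).\<close>

definition place1 :: "'a calg \<Rightarrow> nat \<Rightarrow> nat \<Rightarrow> nat \<Rightarrow> (nat \<times> nat \<Rightarrow> 'a) \<Rightarrow> nat list \<times> nat list \<Rightarrow> 'a" where
  "place1 A n m k X = (\<lambda>(I, J)\<in>tidx n m \<times> tidx n m.
     if \<forall>l<m. l \<noteq> k - 1 \<longrightarrow> I ! l = J ! l then X (I ! (k - 1), J ! (k - 1)) else \<zero>\<^bsub>A\<^esub>)"

text \<open>A matrix on two tensor factors, placed in the factors \<open>k, k + 1\<close> of \<open>m\<close>.\<close>

definition place2 :: "nat \<Rightarrow> nat \<Rightarrow> nat \<Rightarrow> (nat list \<times> nat list \<Rightarrow> complex) \<Rightarrow> nat list \<times> nat list \<Rightarrow> complex" where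
  "place2 n m k C = (\<lambda>(I, J)\<in>tidx n m \<times> tidx n m.
     if \<forall>l<m. l \<noteq> k - 1 \<and> l \<noteq> k \<longrightarrow> I ! l = J ! l
     then C ([I ! (k - 1), I ! k], [J ! (k - 1), J ! k]) else 0)"

definition mat_rels :: "'a calg \<Rightarrow> 's set \<Rightarrow> ('s \<times> 's \<Rightarrow> 'a) \<Rightarrow> ('s \<times> 's \<Rightarrow> 'a) \<Rightarrow> 'a set" where
  "mat_rels A S Y Z = {Y p \<ominus>\<^bsub>A\<^esub> Z p | p. p \<in> S \<times> S}"

definition mtrace :: "'a calg \<Rightarrow> 's set \<Rightarrow> ('s \<times> 's \<Rightarrow> 'a) \<Rightarrow> 'a" where
  "mtrace A S Y = (\<Oplus>\<^bsub>A\<^esub> i \<in> S. Y (i, i))"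


section \<open>R-matrices, overlined subscripts, q-trace\<close>

definition munit :: "nat \<Rightarrow> nat \<Rightarrow> nat \<times> nat \<Rightarrow> complex" where
  "munit i j = (\<lambda>(a, b). if a = i \<and> b = j then 1 else 0)"

definition tens2 :: "(nat \<times> nat \<Rightarrow> complex) \<Rightarrow> (nat \<times> nat \<Rightarrow> complex) \<Rightarrow> nat list \<times> nat list \<Rightarrow> complex" where
  "tens2 X Y = (\<lambda>(I, J). X (I ! 0, J ! 0) * Y (I ! 1, J ! 1))"

definition Pmat :: "nat \<Rightarrow> nat list \<times> nat list \<Rightarrow> complex" where
  "Pmat n = (\<lambda>p\<in>tidx n 2 \<times> tidx n 2. \<Sum>i\<in>{1..n}. \<Sum>j\<in>{1..n}. tens2 (munit i j) (munit j i) p)"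

definition Rmat :: "nat \<Rightarrow> complex \<Rightarrow> nat list \<times> nat list \<Rightarrow> complex" where
  "Rmat n q = (\<lambda>p\<in>tidx n 2 \<times> tidx n 2.
     q * (\<Sum>i\<in>{1..n}. tens2 (munit i i) (munit i i) p)
     + (\<Sum>i\<in>{1..n}. \<Sum>j\<in>{1..n} - {i}. tens2 (munit i i) (munit j j) p)
     + (q - inverse q) * (\<Sum>i\<in>{1..n}. \<Sum>j\<in>{i<..n}. tens2 (munit i j) (munit j i) p))"

definition Rcheck :: "nat \<Rightarrow> complex \<Rightarrow> nat list \<times> nat list \<Rightarrow> complex" where
  "Rcheck n q = Pmat n \<otimes>\<^bsub>tens_alg complex_alg n 2\<^esub> Rmat n q"

definition Rcheck_at :: "'a calg \<Rightarrow> nat \<Rightarrow> complex \<Rightarrow> nat \<Rightarrow> nat \<Rightarrow> nat list \<times> nat list \<Rightarrow> 'a" where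
  "Rcheck_at A n q m k = scal_mat A (tidx n m) (place2 n m k (Rcheck n q))"

definition Rcheck_inv_at :: "'a calg \<Rightarrow> nat \<Rightarrow> complex \<Rightarrow> nat \<Rightarrow> nat \<Rightarrow> nat list \<times> nat list \<Rightarrow> 'a" where
  "Rcheck_inv_at A n q m k = inv\<^bsub>tens_alg A n m\<^esub> (Rcheck_at A n q m k)"

definition overline ::
  "'a calg \<Rightarrow> nat \<Rightarrow> complex \<Rightarrow> nat \<Rightarrow> (nat \<times> nat \<Rightarrow> 'a) \<Rightarrow> nat \<Rightarrow> nat list \<times> nat list \<Rightarrow> 'a" where
  "overline A n q m X k = lprod (tens_alg A n m)
     (map (Rcheck_at A n q m) (rev [1..<k]) @ [place1 A n m 1 X] @ map (Rcheck_inv_at A n q m) [1..<k])"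

definition Dmat :: "nat \<Rightarrow> complex \<Rightarrow> nat \<times> nat \<Rightarrow> complex" where
  "Dmat n q = (\<lambda>(i, j)\<in>{1..n} \<times> {1..n}. if i = j then q powi (- 2 * (int i - 1)) else 0)"

definition qtrace :: "'a calg \<Rightarrow> nat \<Rightarrow> complex \<Rightarrow> nat \<Rightarrow> (nat list \<times> nat list \<Rightarrow> 'a) \<Rightarrow> 'a" where
  "qtrace A n q m Y = mtrace A (tidx n m)
     (lprod (tens_alg A n m) (map (\<lambda>k. place1 A n m k (scal_mat A {1..n} (Dmat n q))) [1..<m + 1])
      \<otimes>\<^bsub>tens_alg A n m\<^esub> Y)"


section \<open>The algebras \<open>U\<^sub>q(gl\<^sub>n)\<close> and \<open>U\<degree>\<^sub>q(gl\<^sub>n)\<close>\<close>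

datatype uq_gen = LP nat nat | LM nat nat

definition uq_gens :: "nat \<Rightarrow> uq_gen set" where
  "uq_gens n = {LP i j | i j. 1 \<le> i \<and> i \<le> j \<and> j \<le> n} \<union> {LM i j | i j. 1 \<le> j \<and> j \<le> i \<and> i \<le> n}"

definition uq_LP0 :: "nat \<Rightarrow> nat \<times> nat \<Rightarrow> uq_gen list \<Rightarrow> complex" where
  "uq_LP0 n = (\<lambda>(i, j)\<in>{1..n} \<times> {1..n}.
     if i \<le> j then free_gen (LP i j) else \<zero>\<^bsub>free_alg (uq_gens n)\<^esub>)"

definition uq_LM0 :: "nat \<Rightarrow> nat \<times> nat \<Rightarrow> uq_gen list \<Rightarrow> complex" where
  "uq_LM0 n = (\<lambda>(i, j)\<in>{1..n} \<times> {1..n}.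
     if j \<le> i then free_gen (LM i j) else \<zero>\<^bsub>free_alg (uq_gens n)\<^esub>)"

text \<open>The entries of \<open>R X\<^sub>1 Y\<^sub>2 - Y\<^sub>2 X\<^sub>1 R\<close>.\<close>

definition RLL_rels :: "'a calg \<Rightarrow> nat \<Rightarrow> complex \<Rightarrow> (nat \<times> nat \<Rightarrow> 'a) \<Rightarrow> (nat \<times> nat \<Rightarrow> 'a) \<Rightarrow> 'a set" where
  "RLL_rels A n q X Y = (let B = tens_alg A n 2; R = scal_mat A (tidx n 2) (Rmat n q);
       X1 = place1 A n 2 1 X; Y2 = place1 A n 2 2 Y
     in mat_rels A (tidx n 2) (lprod B [R, X1, Y2]) (lprod B [Y2, X1, R]))"

definition uq_rels :: "nat \<Rightarrow> complex \<Rightarrow> (uq_gen list \<Rightarrow> complex) set" where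
  "uq_rels n q = (let F = free_alg (uq_gens n); P = uq_LP0 n; M = uq_LM0 n in
     {P (i, i) \<otimes>\<^bsub>F\<^esub> M (i, i) \<ominus>\<^bsub>F\<^esub> \<one>\<^bsub>F\<^esub> | i. i \<in> {1..n}} \<union>
     {M (i, i) \<otimes>\<^bsub>F\<^esub> P (i, i) \<ominus>\<^bsub>F\<^esub> \<one>\<^bsub>F\<^esub> | i. i \<in> {1..n}} \<union>
     RLL_rels F n q P P \<union> RLL_rels F n q M M \<union> RLL_rels F n q P M)"

definition Uq :: "nat \<Rightarrow> complex \<Rightarrow> ((uq_gen list \<Rightarrow> complex) set) calg" where
  "Uq n q = presented (uq_gens n) (uq_rels n q)"

definition Lplus :: "nat \<Rightarrow> complex \<Rightarrow> nat \<times> nat \<Rightarrow> (uq_gen list \<Rightarrow> complex) set" where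
  "Lplus n q = (\<lambda>(i, j)\<in>{1..n} \<times> {1..n}.
     if i \<le> j then pres_gen (uq_gens n) (uq_rels n q) (LP i j) else \<zero>\<^bsub>Uq n q\<^esub>)"

definition Lminus :: "nat \<Rightarrow> complex \<Rightarrow> nat \<times> nat \<Rightarrow> (uq_gen list \<Rightarrow> complex) set" where
  "Lminus n q = (\<lambda>(i, j)\<in>{1..n} \<times> {1..n}.
     if j \<le> i then pres_gen (uq_gens n) (uq_rels n q) (LM i j) else \<zero>\<^bsub>Uq n q\<^esub>)"

definition Lmat :: "nat \<Rightarrow> complex \<Rightarrow> nat \<times> nat \<Rightarrow> (uq_gen list \<Rightarrow> complex) set" where
  "Lmat n q = Lplus n q \<otimes>\<^bsub>mat_alg (Uq n q) {1..n}\<^esub> inv\<^bsub>mat_alg (Uq n q) {1..n}\<^esub> (Lminus n q)"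

definition Uo :: "nat \<Rightarrow> complex \<Rightarrow> ((uq_gen list \<Rightarrow> complex) set) calg" where
  "Uo n q = subalg_gen (Uq n q) (Lmat n q ` ({1..n} \<times> {1..n}))"

definition Kmat :: "nat \<Rightarrow> complex \<Rightarrow> nat \<times> nat \<Rightarrow> (uq_gen list \<Rightarrow> complex) set" where
  "Kmat n q = (let B = mat_alg (Uq n q) {1..n} in
     Lmat n q \<oplus>\<^bsub>B\<^esub> (1 / (q - inverse q)) \<odot>\<^bsub>B\<^esub> \<one>\<^bsub>B\<^esub>)"


section \<open>The braided Weyl algebra\<close>

datatype weyl_gen = WM nat nat | WD nat nat

definition weyl_gens :: "nat \<Rightarrow> weyl_gen set" where
  "weyl_gens n = {WM i j | i j. i \<in> {1..n} \<and> j \<in> {1..n}} \<union> {WD i j | i j. i \<in> {1..n} \<and> j \<in> {1..n}}"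

definition weyl_rels :: "nat \<Rightarrow> complex \<Rightarrow> (weyl_gen list \<Rightarrow> complex) set" where
  "weyl_rels n q = (let F = free_alg (weyl_gens n); B = tens_alg F n 2;
       R = Rcheck_at F n q 2 1; R' = Rcheck_inv_at F n q 2 1;
       M1 = place1 F n 2 1 (\<lambda>(i, j)\<in>{1..n} \<times> {1..n}. free_gen (WM i j));
       D1 = place1 F n 2 1 (\<lambda>(i, j)\<in>{1..n} \<times> {1..n}. free_gen (WD i j))
     in mat_rels F (tidx n 2) (lprod B [R, M1, R, M1]) (lprod B [M1, R, M1, R]) \<union>
        mat_rels F (tidx n 2) (lprod B [R', D1, R', D1]) (lprod B [D1, R', D1, R']) \<union>
        mat_rels F (tidx n 2) (lprod B [D1, R, M1, R]) (lprod B [R, M1, R', D1] \<oplus>\<^bsub>B\<^esub> R))"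

definition Weyl :: "nat \<Rightarrow> complex \<Rightarrow> ((weyl_gen list \<Rightarrow> complex) set) calg" where
  "Weyl n q = presented (weyl_gens n) (weyl_rels n q)"

definition Mmat :: "nat \<Rightarrow> complex \<Rightarrow> nat \<times> nat \<Rightarrow> (weyl_gen list \<Rightarrow> complex) set" where
  "Mmat n q = (\<lambda>(i, j)\<in>{1..n} \<times> {1..n}. pres_gen (weyl_gens n) (weyl_rels n q) (WM i j))"

definition Dermat :: "nat \<Rightarrow> complex \<Rightarrow> nat \<times> nat \<Rightarrow> (weyl_gen list \<Rightarrow> complex) set" where
  "Dermat n q = (\<lambda>(i, j)\<in>{1..n} \<times> {1..n}. pres_gen (weyl_gens n) (weyl_rels n q) (WD i j))"


section \<open>The Hecke algebra and its action\<close>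

definition hecke_rels :: "complex \<Rightarrow> nat \<Rightarrow> (nat list \<Rightarrow> complex) set" where
  "hecke_rels q m = (let F = free_alg {1..<m}; T = free_gen in
     {(T i \<ominus>\<^bsub>F\<^esub> q \<odot>\<^bsub>F\<^esub> \<one>\<^bsub>F\<^esub>) \<otimes>\<^bsub>F\<^esub> (T i \<oplus>\<^bsub>F\<^esub> inverse q \<odot>\<^bsub>F\<^esub> \<one>\<^bsub>F\<^esub>) | i. i \<in> {1..<m}} \<union>
     {lprod F [T i, T (i + 1), T i] \<ominus>\<^bsub>F\<^esub> lprod F [T (i + 1), T i, T (i + 1)] | i.
        i \<in> {1..<m} \<and> i + 1 \<in> {1..<m}} \<union>
     {T i \<otimes>\<^bsub>F\<^esub> T j \<ominus>\<^bsub>F\<^esub> T j \<otimes>\<^bsub>F\<^esub> T i | i j.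
        i \<in> {1..<m} \<and> j \<in> {1..<m} \<and> \<bar>int i - int j\<bar> > 1})"

definition Hecke :: "complex \<Rightarrow> nat \<Rightarrow> ((nat list \<Rightarrow> complex) set) calg" where
  "Hecke q m = presented {1..<m} (hecke_rels q m)"

definition hecke_T :: "complex \<Rightarrow> nat \<Rightarrow> nat \<Rightarrow> (nat list \<Rightarrow> complex) set" where
  "hecke_T q m i = pres_gen {1..<m} (hecke_rels q m) i"

text \<open>\<open>y\<^sub>k = T\<^bsub>k-1\<^esub> \<dots> T\<^sub>1 T\<^sub>1 \<dots> T\<^bsub>k-1\<^esub>\<close>; in particular \<open>y\<^sub>1 = 1\<close>.\<close>

definition jucys_murphy :: "complex \<Rightarrow> nat \<Rightarrow> nat \<Rightarrow> (nat list \<Rightarrow> complex) set" where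
  "jucys_murphy q m k = lprod (Hecke q m) (map (hecke_T q m) (rev [1..<k] @ [1..<k]))"

text \<open>
  The action of the Hecke algebra: an element of \<open>Hecke q m\<close> is a coset of noncommutative
  polynomials in the generators, all of which have the same value when \<open>T\<^sub>k\<close> is replaced by \<open>Rcheck_at\<close> \<open>k\<close>.
\<close>

definition hecke_action ::
  "nat \<Rightarrow> complex \<Rightarrow> nat \<Rightarrow> (nat list \<Rightarrow> complex) set \<Rightarrow> nat list \<times> nat list \<Rightarrow> complex" where
  "hecke_action n q m x =
     the_elem (free_eval (tens_alg complex_alg n m) (Rcheck_at complex_alg n q m) ` x)"


section \<open>Young diagrams, tableaux, idempotents\<close>

text \<open>A Young diagram is given by its set of boxes (row, column), numbered from 1.\<close>

definition young_diagram :: "(nat \<times> nat) set \<Rightarrow> bool" where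
  "young_diagram \<mu> \<longleftrightarrow> finite \<mu> \<and> (\<forall>(i, j)\<in>\<mu>. 1 \<le> i \<and> 1 \<le> j \<and>
     (\<forall>i' j'. 1 \<le> i' \<and> i' \<le> i \<and> 1 \<le> j' \<and> j' \<le> j \<longrightarrow> (i', j') \<in> \<mu>))"

definition standard_tableau :: "(nat \<times> nat) set \<Rightarrow> (nat \<times> nat \<Rightarrow> nat) \<Rightarrow> bool" where
  "standard_tableau \<mu> U \<longleftrightarrow> bij_betw U \<mu> {1..card \<mu>} \<and>
     (\<forall>i j j'. (i, j) \<in> \<mu> \<and> (i, j') \<in> \<mu> \<and> j < j' \<longrightarrow> U (i, j) < U (i, j')) \<and>
     (\<forall>i i' j. (i, j) \<in> \<mu> \<and> (i', j) \<in> \<mu> \<and> i < i' \<longrightarrow> U (i, j) < U (i', j))"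

definition content :: "nat \<times> nat \<Rightarrow> int" where
  "content \<alpha> = int (snd \<alpha>) - int (fst \<alpha>)"

definition tab_content :: "(nat \<times> nat) set \<Rightarrow> (nat \<times> nat \<Rightarrow> nat) \<Rightarrow> nat \<Rightarrow> int" where
  "tab_content \<mu> U k = content (inv_into \<mu> U k)"

text \<open>\<open>e\<close> is the primitive idempotent of the Hecke algebra associated with the tableau \<open>U\<close>.\<close>

definition tableau_idempotent ::
  "complex \<Rightarrow> (nat \<times> nat) set \<Rightarrow> (nat \<times> nat \<Rightarrow> nat) \<Rightarrow> (nat list \<Rightarrow> complex) set \<Rightarrow> bool" where
  "tableau_idempotent q \<mu> U e \<longleftrightarrow> (let m = card \<mu>; H = Hecke q m in
     e \<in> carrier H \<and> e \<noteq> \<zero>\<^bsub>H\<^esub> \<and> e \<otimes>\<^bsub>H\<^esub> e = e \<and>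
     (\<forall>k\<in>{1..m}.
        jucys_murphy q m k \<otimes>\<^bsub>H\<^esub> e = q powi (2 * tab_content \<mu> U k) \<odot>\<^bsub>H\<^esub> e \<and>
        e \<otimes>\<^bsub>H\<^esub> jucys_murphy q m k = q powi (2 * tab_content \<mu> U k) \<odot>\<^bsub>H\<^esub> e))"


section \<open>q-immanants\<close>

text \<open>
  The q-immanants depend only on the shape \<open>\<mu>\<close>; the tableau \<open>U\<close> and its idempotent
  \<open>e\<close> through which they are computed are kept as parameters.
\<close>

definition q_immanant_poly ::
  "nat \<Rightarrow> complex \<Rightarrow> (nat \<times> nat) set \<Rightarrow> (nat \<times> nat \<Rightarrow> nat) \<Rightarrow> (nat list \<Rightarrow> complex) set
     \<Rightarrow> complex \<Rightarrow> (uq_gen list \<Rightarrow> complex) set" where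
  "q_immanant_poly n q \<mu> U e z = (let m = card \<mu>; A = Uq n q; B = tens_alg A n m in
     qtrace A n q m
       (lprod B (map (\<lambda>k. overline A n q m (Lmat n q) k
                          \<oplus>\<^bsub>B\<^esub> (z * q powi (- 2 * tab_content \<mu> U k)) \<odot>\<^bsub>B\<^esub> \<one>\<^bsub>B\<^esub>) [1..<m + 1])
        \<otimes>\<^bsub>B\<^esub> scal_mat A (tidx n m) (hecke_action n q m e)))"

definition q_immanant ::
  "nat \<Rightarrow> complex \<Rightarrow> (nat \<times> nat) set \<Rightarrow> (nat \<times> nat \<Rightarrow> nat) \<Rightarrow> (nat list \<Rightarrow> complex) set
     \<Rightarrow> (uq_gen list \<Rightarrow> complex) set" where
  "q_immanant n q \<mu> U e = q_immanant_poly n q \<mu> U e (inverse (q - inverse q))"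

end

theory Submission
  imports Defs
begin

text \<open>
  Put \<open>z = 1/(q - 1/q)\<close>, so that \<open>L\<close> is mapped to \<open>M D - z\<close>. This shift removes the inhomogeneous
  term of the Weyl relations: for \<open>L = M D - z\<close> they give
  \<open>D\<^sub>k L\<^bsub>k+1\<^esub> = L\<^bsub>k+1\<^esub> D\<^sub>k R\<^sub>k\<^sup>-\<^sup>2\<close> (overlined indices throughout), whence
  \<open>D\<^bsub>k-1\<^esub> \<dots> D\<^sub>1 L\<^sub>k = L\<^sub>k D\<^bsub>k-1\<^esub> \<dots> D\<^sub>1 y\<^sub>k\<^sup>-\<^sup>1\<close> with the Jucys-Murphy element \<open>y\<^sub>k\<close>.
  On a vector of weight \<open>q\<^bsup>2c\<^esup>\<close> for \<open>y\<^sub>k\<close> the factor \<open>L\<^sub>k + z q\<^bsup>-2c\<^esup>\<close> therefore becomes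
  \<open>q\<^bsup>-2c\<^esup> (L\<^sub>k + z) = q\<^bsup>-2c\<^esup> M\<^sub>k D\<^sub>k\<close> once it has passed \<open>D\<^bsub>k-1\<^esub> \<dots> D\<^sub>1\<close>; the weights of
  \<open>y\<^sub>j\<close> with \<open>j < k\<close> are unaffected because \<open>y\<^sub>j\<close> commutes with \<open>L\<^sub>k\<close>. Hence the formula holds
  before taking the trace, and only the eigenvalue equations of the idempotent matter.
\<close>

section \<open>Complex algebras\<close>

text \<open>The shift works because of the Hecke quadratic relation. In \<open>D R L R\<close> with
  \<open>L = M D - z\<close> the scalar part contributes
  \<open>- z D R^2 = - z (q - 1/q) D R - z D\<close>. Since \<open>z (q - 1/q) = 1\<close>, the
  first summand is the exact opposite of the term \<open>D R\<close> that the inhomogeneous relation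
  between \<open>D\<close> and \<open>M\<close> leaves behind. The obstacle is one of transport. The
  relations are given for entries of matrices on two tensor factors over a free algebra, but are
  used on \<open>m\<close> factors over a quotient, where sums and inverses refer to other carriers.
  The calculation is therefore done in an abstract algebra with elements \<open>R k\<close> obeying
  the Hecke relations and elements \<open>M\<close>, \<open>D\<close> that commute with
  \<open>R k\<close> for \<open>k \<ge> 2\<close>. The inverse of \<open>R k\<close> is written as
  \<open>R k - (q - 1/q)\<close>, an expression that every algebra homomorphism preserves. What
  remains is to recognise each passage as a homomorphism: the quotient map, its entrywise
  application, the embedding of complex matrices, and tensoring with an identity.\<close>

locale complex_algebra = ring A for A :: "'a calg" (structure) +
  assumes smult_closed [simp, intro]: "x \<in> carrier A \<Longrightarrow> c \<odot> x \<in> carrier A"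
    and smult_l_distr: "x \<in> carrier A \<Longrightarrow> (a + b) \<odot> x = a \<odot> x \<oplus> b \<odot> x"
    and smult_r_distr: "x \<in> carrier A \<Longrightarrow> y \<in> carrier A \<Longrightarrow> c \<odot> (x \<oplus> y) = c \<odot> x \<oplus> c \<odot> y"
    and smult_smult: "x \<in> carrier A \<Longrightarrow> a \<odot> (b \<odot> x) = (a * b) \<odot> x"
    and smult_1 [simp]: "x \<in> carrier A \<Longrightarrow> 1 \<odot> x = x"
    and smult_mult_left: "x \<in> carrier A \<Longrightarrow> y \<in> carrier A \<Longrightarrow> (c \<odot> x) \<otimes> y = c \<odot> (x \<otimes> y)"
    and smult_mult_right: "x \<in> carrier A \<Longrightarrow> y \<in> carrier A \<Longrightarrow> x \<otimes> (c \<odot> y) = c \<odot> (x \<otimes> y)"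

text \<open>No hypothesis provides additive inverses, because \<open>(-1) \<odot> x\<close> is one:
  \<open>(-1) \<odot> x \<oplus> x = (-1 + 1) \<odot> x = 0 \<odot> x\<close>.\<close>

lemma complex_algebraI:
  fixes A :: "'a calg" (structure)
  assumes add_closed: "\<And>x y. x \<in> carrier A \<Longrightarrow> y \<in> carrier A \<Longrightarrow> x \<oplus> y \<in> carrier A"
    and zero_closed: "\<zero> \<in> carrier A"
    and mult_closed: "\<And>x y. x \<in> carrier A \<Longrightarrow> y \<in> carrier A \<Longrightarrow> x \<otimes> y \<in> carrier A"
    and one_closed: "\<one> \<in> carrier A"
    and smult_closed: "\<And>c x. x \<in> carrier A \<Longrightarrow> c \<odot> x \<in> carrier A"
    and add_assoc: "\<And>x y z. x \<in> carrier A \<Longrightarrow> y \<in> carrier A \<Longrightarrow> z \<in> carrier A \<Longrightarrow> (x \<oplus> y) \<oplus> z = x \<oplus> (y \<oplus> z)"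
    and add_comm: "\<And>x y. x \<in> carrier A \<Longrightarrow> y \<in> carrier A \<Longrightarrow> x \<oplus> y = y \<oplus> x"
    and zero_left: "\<And>x. x \<in> carrier A \<Longrightarrow> \<zero> \<oplus> x = x"
    and smult_0: "\<And>x. x \<in> carrier A \<Longrightarrow> 0 \<odot> x = \<zero>"
    and mult_assoc: "\<And>x y z. x \<in> carrier A \<Longrightarrow> y \<in> carrier A \<Longrightarrow> z \<in> carrier A \<Longrightarrow> (x \<otimes> y) \<otimes> z = x \<otimes> (y \<otimes> z)"
    and one_left: "\<And>x. x \<in> carrier A \<Longrightarrow> \<one> \<otimes> x = x"
    and one_right: "\<And>x. x \<in> carrier A \<Longrightarrow> x \<otimes> \<one> = x"
    and distrib_right: "\<And>x y z. x \<in> carrier A \<Longrightarrow> y \<in> carrier A \<Longrightarrow> z \<in> carrier A \<Longrightarrow> (x \<oplus> y) \<otimes> z = x \<otimes> z \<oplus> y \<otimes> z"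
    and distrib_left: "\<And>x y z. x \<in> carrier A \<Longrightarrow> y \<in> carrier A \<Longrightarrow> z \<in> carrier A \<Longrightarrow> z \<otimes> (x \<oplus> y) = z \<otimes> x \<oplus> z \<otimes> y"
    and smult_l_distr: "\<And>a b x. x \<in> carrier A \<Longrightarrow> (a + b) \<odot> x = a \<odot> x \<oplus> b \<odot> x"
    and smult_r_distr: "\<And>c x y. x \<in> carrier A \<Longrightarrow> y \<in> carrier A \<Longrightarrow> c \<odot> (x \<oplus> y) = c \<odot> x \<oplus> c \<odot> y"
    and smult_smult: "\<And>a b x. x \<in> carrier A \<Longrightarrow> a \<odot> (b \<odot> x) = (a * b) \<odot> x"
    and smult_1: "\<And>x. x \<in> carrier A \<Longrightarrow> 1 \<odot> x = x"
    and smult_mult_left: "\<And>c x y. x \<in> carrier A \<Longrightarrow> y \<in> carrier A \<Longrightarrow> (c \<odot> x) \<otimes> y = c \<odot> (x \<otimes> y)"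
    and smult_mult_right: "\<And>c x y. x \<in> carrier A \<Longrightarrow> y \<in> carrier A \<Longrightarrow> x \<otimes> (c \<odot> y) = c \<odot> (x \<otimes> y)"
  shows "complex_algebra A"
proof -
  have "(-1) \<odot> x \<oplus> x = \<zero>" if "x \<in> carrier A" for x
    using smult_l_distr[OF that, of "-1" 1] smult_0[OF that] smult_1[OF that] by simp
  then have inv: "\<exists>y \<in> carrier A. y \<oplus> x = \<zero>" if "x \<in> carrier A" for x
    using that smult_closed by blast
  have ring: "ring A"
    by (intro ringI abelian_groupI monoidI; (rule assms inv; assumption)?)
  show ?thesis
    by (intro complex_algebra.intro complex_algebra_axioms.intro; (rule ring assms; assumption)?)
qed

context complex_algebra
begin

lemma smult_0 [simp]: "x \<in> carrier A \<Longrightarrow> 0 \<odot> x = \<zero>"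
  using smult_l_distr[of x 0 0] by (metis add_cancel_left_left add.l_cancel_one' smult_closed)

lemma smult_zero [simp]: "c \<odot> \<zero> = \<zero>"
  using smult_r_distr[of \<zero> \<zero> c] by (metis r_zero zero_closed add.l_cancel_one' smult_closed)

lemma smult_minus_1: "x \<in> carrier A \<Longrightarrow> (-1) \<odot> x = \<ominus> x"
  using smult_l_distr[of x "-1" 1] by (simp add: add.inv_equality)

lemma minus_eq_smult: "x \<in> carrier A \<Longrightarrow> y \<in> carrier A \<Longrightarrow> x \<ominus> y = x \<oplus> (-1) \<odot> y"
  by (simp add: smult_minus_1 a_minus_def)

lemma finsum_smult:
  "finite S \<Longrightarrow> f \<in> S \<rightarrow> carrier A \<Longrightarrow> c \<odot> (\<Oplus>i\<in>S. f i) = (\<Oplus>i\<in>S. c \<odot> f i)"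
  by (induction S rule: finite_induct) (auto simp: Pi_def smult_r_distr)

lemma smult_one_mult: "x \<in> carrier A \<Longrightarrow> (c \<odot> \<one>) \<otimes> x = c \<odot> x"
  by (simp add: smult_mult_left)

lemma lprod_closed [simp, intro]: "set xs \<subseteq> carrier A \<Longrightarrow> lprod A xs \<in> carrier A"
  by (induction xs) (auto simp: lprod_def)

lemma lprod_Nil [simp]: "lprod A [] = \<one>"
  and lprod_Cons [simp]: "lprod A (x # xs) = x \<otimes> lprod A xs"
  by (simp_all add: lprod_def)

lemma lprod_append:
  "set xs \<subseteq> carrier A \<Longrightarrow> set ys \<subseteq> carrier A \<Longrightarrow> lprod A (xs @ ys) = lprod A xs \<otimes> lprod A ys"
  by (induction xs) (auto simp: m_assoc)

lemma lprod_surround: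
  "set xs \<subseteq> carrier A \<Longrightarrow> a \<in> carrier A \<Longrightarrow> b \<in> carrier A \<Longrightarrow> lprod A ([a] @ xs @ [b]) = a \<otimes> (lprod A xs \<otimes> b)"
  by (simp add: lprod_append)

lemma lprod_append_snoc:
  "set xs \<subseteq> carrier A \<Longrightarrow> set ys \<subseteq> carrier A \<Longrightarrow> a \<in> carrier A \<Longrightarrow>
    lprod A (xs @ ys @ [a]) = lprod A xs \<otimes> (lprod A ys \<otimes> a)"
  by (simp add: lprod_append)

end

lemma (in abelian_monoid) finsum_swap:
  assumes "finite S" "finite T" "\<And>i j. i \<in> S \<Longrightarrow> j \<in> T \<Longrightarrow> f i j \<in> carrier G"
  shows "(\<Oplus>i\<in>S. \<Oplus>j\<in>T. f i j) = (\<Oplus>j\<in>T. \<Oplus>i\<in>S. f i j)"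
  using assms(1,3)
proof (induction S rule: finite_induct)
  case (insert x S)
  have "(\<Oplus>i\<in>insert x S. \<Oplus>j\<in>T. f i j) = (\<Oplus>j\<in>T. f x j) \<oplus> (\<Oplus>j\<in>T. \<Oplus>i\<in>S. f i j)"
    using insert by (subst finsum_insert) (auto intro!: finsum_closed)
  also have "\<dots> = (\<Oplus>j\<in>T. f x j \<oplus> (\<Oplus>i\<in>S. f i j))"
    using insert by (subst finsum_addf) (auto intro!: finsum_closed)
  also have "\<dots> = (\<Oplus>j\<in>T. \<Oplus>i\<in>insert x S. f i j)"
    using insert by (intro finsum_cong') (auto intro!: finsum_closed)
  finally show ?case .
qed simp

lemma (in abelian_monoid) finsum_delta:
  assumes "finite S" "j \<in> S" "f \<in> S \<rightarrow> carrier G" "\<And>i. i \<in> S \<Longrightarrow> i \<noteq> j \<Longrightarrow> f i = \<zero>"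
  shows "finsum G f S = f j"
proof -
  have "finsum G f S = (\<Oplus>i\<in>S. if j = i then f i else \<zero>)"
    using assms by (intro finsum_cong') auto
  then show ?thesis
    using finsum_singleton[OF assms(2,1,3)] by simp
qed

lemma complex_algebra_complex_alg: "complex_algebra complex_alg"
  by (rule complex_algebraI) (auto simp: complex_alg_def algebra_simps)

lemma finsum_complex_alg: "finite S \<Longrightarrow> (\<Oplus>\<^bsub>complex_alg\<^esub> i\<in>S. f i) = (\<Sum>i\<in>S. f i)"
proof (induction S rule: finite_induct)
  case (insert x F)
  interpret complex_algebra complex_alg by (rule complex_algebra_complex_alg)
  show ?case
    using insert by (subst finsum_insert) (auto simp: complex_alg_def)
next
  case empty
  interpret complex_algebra complex_alg by (rule complex_algebra_complex_alg)
  show ?case by (simp only: finsum_empty) (simp add: complex_alg_def)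
qed

section \<open>Homomorphisms\<close>

lemma calg_homI:
  fixes A :: "'a calg" (structure) and B :: "'b calg"
  assumes "\<And>x. x \<in> carrier A \<Longrightarrow> h x \<in> carrier B"
    and "\<And>x y. x \<in> carrier A \<Longrightarrow> y \<in> carrier A \<Longrightarrow> h (x \<oplus> y) = h x \<oplus>\<^bsub>B\<^esub> h y"
    and "\<And>x y. x \<in> carrier A \<Longrightarrow> y \<in> carrier A \<Longrightarrow> h (x \<otimes> y) = h x \<otimes>\<^bsub>B\<^esub> h y"
    and "h \<one> = \<one>\<^bsub>B\<^esub>"
    and "\<And>c x. x \<in> carrier A \<Longrightarrow> h (c \<odot> x) = c \<odot>\<^bsub>B\<^esub> h x"
  shows "h \<in> calg_hom A B"
  using assms by (auto simp: calg_hom_def intro!: ring_hom_memI)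

lemma calg_homD:
  assumes "h \<in> calg_hom A B"
  shows calg_hom_closed: "x \<in> carrier A \<Longrightarrow> h x \<in> carrier B"
    and calg_hom_add: "x \<in> carrier A \<Longrightarrow> y \<in> carrier A \<Longrightarrow> h (x \<oplus>\<^bsub>A\<^esub> y) = h x \<oplus>\<^bsub>B\<^esub> h y"
    and calg_hom_mult: "x \<in> carrier A \<Longrightarrow> y \<in> carrier A \<Longrightarrow> h (x \<otimes>\<^bsub>A\<^esub> y) = h x \<otimes>\<^bsub>B\<^esub> h y"
    and calg_hom_one: "h \<one>\<^bsub>A\<^esub> = \<one>\<^bsub>B\<^esub>"
    and calg_hom_smult: "x \<in> carrier A \<Longrightarrow> h (c \<odot>\<^bsub>A\<^esub> x) = c \<odot>\<^bsub>B\<^esub> h x"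
  using assms unfolding calg_hom_def by (blast intro: ring_hom_closed ring_hom_add ring_hom_mult ring_hom_one)+

locale complex_algebra_hom = A: complex_algebra A + B: complex_algebra B
  for A :: "'a calg" and B :: "'b calg" and h +
  assumes hom: "h \<in> calg_hom A B"
begin

lemma hom_closed [simp, intro]: "x \<in> carrier A \<Longrightarrow> h x \<in> carrier B"
  and hom_add: "x \<in> carrier A \<Longrightarrow> y \<in> carrier A \<Longrightarrow> h (x \<oplus>\<^bsub>A\<^esub> y) = h x \<oplus>\<^bsub>B\<^esub> h y"
  and hom_mult: "x \<in> carrier A \<Longrightarrow> y \<in> carrier A \<Longrightarrow> h (x \<otimes>\<^bsub>A\<^esub> y) = h x \<otimes>\<^bsub>B\<^esub> h y"
  and hom_one [simp]: "h \<one>\<^bsub>A\<^esub> = \<one>\<^bsub>B\<^esub>"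
  and hom_smult: "x \<in> carrier A \<Longrightarrow> h (c \<odot>\<^bsub>A\<^esub> x) = c \<odot>\<^bsub>B\<^esub> h x"
  by (rule calg_homD[OF hom]; assumption)+

lemma hom_zero [simp]: "h \<zero>\<^bsub>A\<^esub> = \<zero>\<^bsub>B\<^esub>"
  using hom_smult[of "\<zero>\<^bsub>A\<^esub>" 0] by (simp add: A.smult_0[symmetric] del: A.smult_zero)

lemma hom_minus: "x \<in> carrier A \<Longrightarrow> y \<in> carrier A \<Longrightarrow> h (x \<ominus>\<^bsub>A\<^esub> y) = h x \<ominus>\<^bsub>B\<^esub> h y"
  by (simp add: A.minus_eq_smult B.minus_eq_smult hom_add hom_smult)

lemma hom_finsum:
  "finite S \<Longrightarrow> f \<in> S \<rightarrow> carrier A \<Longrightarrow> h (\<Oplus>\<^bsub>A\<^esub> i\<in>S. f i) = (\<Oplus>\<^bsub>B\<^esub> i\<in>S. h (f i))"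
  by (induction S rule: finite_induct) (auto simp: Pi_def hom_add)

lemma hom_lprod: "set xs \<subseteq> carrier A \<Longrightarrow> h (lprod A xs) = lprod B (map h xs)"
  by (induction xs) (auto simp: hom_mult)

text \<open>The kernel is an ideal, so with \<open>Rel\<close> it contains the smallest ideal above
  \<open>Rel\<close>. This makes evaluation constant on cosets.\<close>

lemma hom_genideal_eq_zero:
  assumes "Rel \<subseteq> carrier A" "\<And>r. r \<in> Rel \<Longrightarrow> h r = \<zero>\<^bsub>B\<^esub>" "x \<in> Idl\<^bsub>A\<^esub> Rel"
  shows "h x = \<zero>\<^bsub>B\<^esub>"
proof -
  have h: "h \<in> ring_hom A B"
    using hom by (simp add: calg_hom_def)
  have "ideal (a_kernel A B h) A"
    by (rule ring_hom_ring.kernel_is_ideal[OF ring_hom_ringI2[OF A.ring_axioms B.ring_axioms h]])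
  then have "Idl\<^bsub>A\<^esub> Rel \<subseteq> a_kernel A B h"
    using assms(1,2) by (intro A.genideal_minimal) (auto simp: a_kernel_def')
  then show ?thesis
    using assms(3) by (auto simp: a_kernel_def')
qed

end

text \<open>The axioms are identities, so they pass to any surjective image. Preservation of zero is
  a separate hypothesis: \<open>calg_hom\<close> does not include it, and it cannot be derived
  before the target is known to be a ring.\<close>

lemma complex_algebra_surj:
  fixes A :: "'a calg" and B :: "'b calg"
  assumes "complex_algebra A" and surj: "h ` carrier A = carrier B" and zero: "h \<zero>\<^bsub>A\<^esub> = \<zero>\<^bsub>B\<^esub>"
    and hom: "h \<in> calg_hom A B"
  shows "complex_algebra B"
proof -
  interpret A: complex_algebra A by fact
  note h = calg_homD(2-5)[OF hom, symmetric]
  show ?thesis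
  proof (rule complex_algebraI, unfold surj[symmetric], goal_cases)
    case (7 x y)
    then show ?case by (elim imageE) (simp add: h(1) A.a_comm)
  qed ((elim imageE)?; simp only: h zero[symmetric] A.a_assoc A.m_assoc A.l_distr A.r_distr
      A.smult_l_distr A.smult_r_distr A.smult_smult A.smult_mult_left A.smult_mult_right A.l_zero A.l_one A.r_one A.smult_0
      A.smult_1 image_eqI[OF refl] imageI A.add.m_closed A.m_closed A.smult_closed A.zero_closed A.one_closed)+
qed

section \<open>Matrices\<close>

lemma mat_carrier: "X \<in> carrier (mat_alg A S) \<longleftrightarrow> X \<in> S \<times> S \<rightarrow>\<^sub>E carrier A"
  by (simp add: mat_alg_def)

lemma mat_entry_closed [simp, intro]:
  "X \<in> carrier (mat_alg A S) \<Longrightarrow> i \<in> S \<Longrightarrow> j \<in> S \<Longrightarrow> X (i, j) \<in> carrier A"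
  by (auto simp: mat_alg_def)

lemma mat_eqI:
  assumes "X \<in> carrier (mat_alg A S)" "Y \<in> carrier (mat_alg A S)"
    and "\<And>i j. i \<in> S \<Longrightarrow> j \<in> S \<Longrightarrow> X (i, j) = Y (i, j)"
  shows "X = Y"
proof (rule PiE_ext)
  show "X \<in> S \<times> S \<rightarrow>\<^sub>E carrier A" "Y \<in> S \<times> S \<rightarrow>\<^sub>E carrier A"
    using assms(1,2) by (simp_all add: mat_carrier)
qed (use assms(3) in auto)

lemma mat_entry [simp]:
  assumes "i \<in> S" "j \<in> S"
  shows "(X \<otimes>\<^bsub>mat_alg A S\<^esub> Y) (i, j) = (\<Oplus>\<^bsub>A\<^esub> k \<in> S. X (i, k) \<otimes>\<^bsub>A\<^esub> Y (k, j))"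
    and "(X \<oplus>\<^bsub>mat_alg A S\<^esub> Y) (i, j) = X (i, j) \<oplus>\<^bsub>A\<^esub> Y (i, j)"
    and "\<one>\<^bsub>mat_alg A S\<^esub> (i, j) = (if i = j then \<one>\<^bsub>A\<^esub> else \<zero>\<^bsub>A\<^esub>)"
    and "\<zero>\<^bsub>mat_alg A S\<^esub> (i, j) = \<zero>\<^bsub>A\<^esub>"
    and "(c \<odot>\<^bsub>mat_alg A S\<^esub> X) (i, j) = c \<odot>\<^bsub>A\<^esub> X (i, j)"
  using assms by (simp_all add: mat_alg_def)

context complex_algebra
begin

lemma mat_closed [simp, intro]:
  shows "X \<in> carrier (mat_alg A S) \<Longrightarrow> Y \<in> carrier (mat_alg A S) \<Longrightarrow> X \<otimes>\<^bsub>mat_alg A S\<^esub> Y \<in> carrier (mat_alg A S)"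
    and "X \<in> carrier (mat_alg A S) \<Longrightarrow> Y \<in> carrier (mat_alg A S) \<Longrightarrow> X \<oplus>\<^bsub>mat_alg A S\<^esub> Y \<in> carrier (mat_alg A S)"
    and "X \<in> carrier (mat_alg A S) \<Longrightarrow> c \<odot>\<^bsub>mat_alg A S\<^esub> X \<in> carrier (mat_alg A S)"
    and "\<one>\<^bsub>mat_alg A S\<^esub> \<in> carrier (mat_alg A S)" and "\<zero>\<^bsub>mat_alg A S\<^esub> \<in> carrier (mat_alg A S)"
  by (auto simp: mat_alg_def intro!: finsum_closed)

lemma complex_algebra_mat_alg:
  assumes fin: "finite S"
  shows "complex_algebra (mat_alg A S)"
proof (rule complex_algebraI, goal_cases)
  case (10 X Y Z)
  show ?case
  proof (rule mat_eqI)
    fix i j assume ij: "i \<in> S" "j \<in> S"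
    have "((X \<otimes>\<^bsub>mat_alg A S\<^esub> Y) \<otimes>\<^bsub>mat_alg A S\<^esub> Z) (i, j) = (\<Oplus>k\<in>S. \<Oplus>l\<in>S. X (i, l) \<otimes> Y (l, k) \<otimes> Z (k, j))"
      using fin ij 10 by (auto intro!: finsum_cong' finsum_ldistr finsum_closed)
    also have "\<dots> = (\<Oplus>l\<in>S. \<Oplus>k\<in>S. X (i, l) \<otimes> Y (l, k) \<otimes> Z (k, j))"
      using fin ij 10 by (intro finsum_swap) auto
    also have "\<dots> = (X \<otimes>\<^bsub>mat_alg A S\<^esub> (Y \<otimes>\<^bsub>mat_alg A S\<^esub> Z)) (i, j)"
      using fin ij 10 by (auto intro!: finsum_cong' finsum_closed simp: finsum_rdistr m_assoc Pi_def)
    finally show "((X \<otimes>\<^bsub>mat_alg A S\<^esub> Y) \<otimes>\<^bsub>mat_alg A S\<^esub> Z) (i, j) = \<dots>" .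
  qed (use 10 in auto)
next
  case (11 X)
  show ?case
  proof (rule mat_eqI)
    fix i j assume "i \<in> S" "j \<in> S"
    then show "(\<one>\<^bsub>mat_alg A S\<^esub> \<otimes>\<^bsub>mat_alg A S\<^esub> X) (i, j) = X (i, j)"
      using 11 fin by (auto intro!: finsum_delta[where j = i, THEN trans])
  qed (use 11 in auto)
next
  case (12 X)
  show ?case
  proof (rule mat_eqI)
    fix i j assume "i \<in> S" "j \<in> S"
    then show "(X \<otimes>\<^bsub>mat_alg A S\<^esub> \<one>\<^bsub>mat_alg A S\<^esub>) (i, j) = X (i, j)"
      using 12 fin by (auto intro!: finsum_delta[where j = j, THEN trans])
  qed (use 12 in auto)
next
  case (13 X Y Z)
  then show ?case
    by (intro mat_eqI[of _ A S])
      (auto simp: l_distr finsum_addf[symmetric] Pi_def simp del: finsum_addf intro!: finsum_closed finsum_cong')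
next
  case (14 X Y Z)
  then show ?case
    by (intro mat_eqI[of _ A S])
      (auto simp: r_distr finsum_addf[symmetric] Pi_def simp del: finsum_addf intro!: finsum_closed finsum_cong')
next
  case (19 c X Y)
  then show ?case
    using fin by (intro mat_eqI[of _ A S])
      (auto simp: smult_mult_left finsum_smult Pi_def intro!: finsum_closed finsum_cong')
next
  case (20 c X Y)
  then show ?case
    using fin by (intro mat_eqI[of _ A S])
      (auto simp: smult_mult_right finsum_smult Pi_def intro!: finsum_closed finsum_cong')
qed (auto intro!: mat_eqI[of _ A S] simp: add.m_ac smult_r_distr smult_l_distr smult_smult)

end

section \<open>Entrywise application of homomorphisms\<close>

definition mat_map :: "('a \<Rightarrow> 'b) \<Rightarrow> 's set \<Rightarrow> ('s \<times> 's \<Rightarrow> 'a) \<Rightarrow> 's \<times> 's \<Rightarrow> 'b" where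
  "mat_map h S X = (\<lambda>p\<in>S \<times> S. h (X p))"

lemma mat_map_entry [simp]: "i \<in> S \<Longrightarrow> j \<in> S \<Longrightarrow> mat_map h S X (i, j) = h (X (i, j))"
  by (simp add: mat_map_def)

lemma (in complex_algebra_hom) mat_map_hom:
  assumes fin: "finite S"
  shows "complex_algebra_hom (mat_alg A S) (mat_alg B S) (mat_map h S)"
proof (intro complex_algebra_hom.intro complex_algebra_hom_axioms.intro calg_homI)
  have closed [simp]: "mat_map h S X \<in> carrier (mat_alg B S)" if "X \<in> carrier (mat_alg A S)" for X
    using that by (auto simp: mat_carrier mat_map_def)
  then show "mat_map h S X \<in> carrier (mat_alg B S)" if "X \<in> carrier (mat_alg A S)" for X
    using that .
  show "mat_map h S (X \<oplus>\<^bsub>mat_alg A S\<^esub> Y) = mat_map h S X \<oplus>\<^bsub>mat_alg B S\<^esub> mat_map h S Y"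
    if "X \<in> carrier (mat_alg A S)" "Y \<in> carrier (mat_alg A S)" for X Y
    using that by (intro mat_eqI[of _ B S]) (auto simp: hom_add)
  show "mat_map h S (X \<otimes>\<^bsub>mat_alg A S\<^esub> Y) = mat_map h S X \<otimes>\<^bsub>mat_alg B S\<^esub> mat_map h S Y"
    if "X \<in> carrier (mat_alg A S)" "Y \<in> carrier (mat_alg A S)" for X Y
    using that fin
    by (intro mat_eqI[of _ B S])
      (auto simp: hom_mult hom_finsum Pi_def intro!: B.finsum_cong' B.finsum_closed)
  show "mat_map h S (c \<odot>\<^bsub>mat_alg A S\<^esub> X) = c \<odot>\<^bsub>mat_alg B S\<^esub> mat_map h S X"
    if "X \<in> carrier (mat_alg A S)" for c X
    using that by (intro mat_eqI[of _ B S]) (auto simp: hom_smult)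
  show "mat_map h S \<one>\<^bsub>mat_alg A S\<^esub> = \<one>\<^bsub>mat_alg B S\<^esub>"
    by (intro mat_eqI[of _ B S]) auto
qed (use fin A.complex_algebra_mat_alg B.complex_algebra_mat_alg in auto)

lemma (in complex_algebra) scalar_hom: "complex_algebra_hom complex_alg A (\<lambda>c. c \<odot> \<one>)"
  by (intro complex_algebra_hom.intro complex_algebra_hom_axioms.intro calg_homI
      complex_algebra_complex_alg complex_algebra_axioms)
    (auto simp: complex_alg_def smult_l_distr smult_mult_left smult_smult)

lemma scal_mat_eq_mat_map: "scal_mat A S C = mat_map (\<lambda>c. c \<odot>\<^bsub>A\<^esub> \<one>\<^bsub>A\<^esub>) S C"
  by (simp add: scal_mat_def mat_map_def)

text \<open>Identities between complex matrices, in particular those of the R-matrix, hold over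
  every algebra \<open>A\<close> once they hold over the complex numbers.\<close>

lemma (in complex_algebra) scal_mat_hom:
  "finite S \<Longrightarrow> complex_algebra_hom (mat_alg complex_alg S) (mat_alg A S) (scal_mat A S)"
  using complex_algebra_hom.mat_map_hom[OF scalar_hom] by (simp add: scal_mat_eq_mat_map[abs_def])

lemma (in complex_algebra) scal_mat_closed [simp, intro]: "scal_mat A S C \<in> carrier (mat_alg A S)"
  by (auto simp: scal_mat_def mat_carrier)

lemma scal_mat_entry [simp]: "i \<in> S \<Longrightarrow> j \<in> S \<Longrightarrow> scal_mat A S C (i, j) = C (i, j) \<odot>\<^bsub>A\<^esub> \<one>\<^bsub>A\<^esub>"
  by (simp add: scal_mat_def)

lemma (in complex_algebra_hom) mat_map_scal_mat: "mat_map h S (scal_mat A S C) = scal_mat B S C"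
  by (auto simp: scal_mat_def mat_map_def fun_eq_iff hom_smult)

section \<open>Quotients\<close>

text \<open>The algebra axioms are not checked on cosets; they are inherited from \<open>A\<close>
  through the surjection. The only genuine issue is that scalar multiplication is well
  defined.\<close>

lemma (in complex_algebra) quot_alg_hom:
  assumes "ideal I A"
  shows "complex_algebra_hom A (quot_alg A I) (\<lambda>x. I +> x)"
proof -
  interpret ideal I A by fact
  have coset_eq: "I +> x = I +> y" if "x \<in> carrier A" "y \<in> I +> x" for x y
    by (rule a_repr_independence[OF that(2,1) a_subgroup])
  have smult: "c \<odot>\<^bsub>quot_alg A I\<^esub> (I +> x) = I +> (c \<odot> x)" if x: "x \<in> carrier A" for c x
  proof -
    \<comment> \<open>Scalar multiplication in \<open>quot_alg\<close> is a union over all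
      representatives \<open>y\<close> of the coset; it is a coset only because every representative
      contributes the same one.\<close>
    have "I +> (c \<odot> y) = I +> (c \<odot> x)" if y: "y \<in> I +> x" for y
    proof -
      obtain i where i: "i \<in> I" "y = i \<oplus> x"
        using y by (auto simp: a_r_coset_def')
      have ic: "i \<in> carrier A" using i by auto
      \<comment> \<open>A ring ideal is closed under scalars because scaling is multiplication by
        the ring element \<open>c \<odot> \<one>\<close>.\<close>
      have "(c \<odot> \<one>) \<otimes> i \<in> I"
        using i by (intro I_l_closed) auto
      then have "c \<odot> i \<in> I"
        using ic by (simp add: smult_mult_left)
      then have "c \<odot> y \<in> I +> (c \<odot> x)"
        using i ic x by (auto simp: a_r_coset_def' smult_r_distr)
      then show ?thesis
        using coset_eq x by (metis smult_closed)
    qed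
    moreover have "x \<in> I +> x"
      using x by (rule a_rcos_self)
    ultimately have "(\<Union>y\<in>I +> x. I +> (c \<odot> y)) = I +> (c \<odot> x)"
      by blast
    then show ?thesis
      by (simp add: quot_alg_def ring.defs module.defs)
  qed
  have hom: "(\<lambda>x. I +> x) \<in> calg_hom A (quot_alg A I)"
    using smult by (intro calg_homI)
      (auto simp: quot_alg_def FactRing_def ring.defs module.defs rcoset_mult_add a_rcos_sum
        intro: a_rcosetsI[OF a_subset])
  have "complex_algebra (quot_alg A I)"
  proof (rule complex_algebra_surj[OF complex_algebra_axioms _ _ hom])
    show "(+>) I ` carrier A = carrier (quot_alg A I)"
      by (auto simp: quot_alg_def FactRing_def ring.defs A_RCOSETS_def')
    show "I +> \<zero> = \<zero>\<^bsub>quot_alg A I\<^esub>"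
      using a_rcos_const[OF zero_closed] by (simp add: quot_alg_def FactRing_def ring.defs)
  qed
  then show ?thesis
    using hom complex_algebra_axioms
    by (intro complex_algebra_hom.intro complex_algebra_hom_axioms.intro)
qed

lemma (in complex_algebra) quot_alg_carrierE:
  assumes "x \<in> carrier (quot_alg A I)"
  obtains a where "a \<in> carrier A" "x = I +> a"
  using assms by (auto simp: quot_alg_def FactRing_def ring.defs A_RCOSETS_def')

section \<open>Free algebras\<close>

definition free_word :: "'x list \<Rightarrow> 'x list \<Rightarrow> complex" where
  "free_word u = (\<lambda>w. if w = u then 1 else 0)"

lemma free_gen_eq_free_word: "free_gen x = free_word [x]"
  by (simp add: free_gen_def free_word_def)

lemma free_carrier: "f \<in> carrier (free_alg X) \<longleftrightarrow> finite {w. f w \<noteq> 0} \<and> (\<forall>w. f w \<noteq> 0 \<longrightarrow> set w \<subseteq> X)"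
  by (simp add: free_alg_def)

lemma free_mult_apply: "(f \<otimes>\<^bsub>free_alg X\<^esub> g) w = (\<Sum>k\<le>length w. f (take k w) * g (drop k w))"
  and free_one_apply: "\<one>\<^bsub>free_alg X\<^esub> w = (if w = [] then 1 else 0)"
  and free_add_apply: "(f \<oplus>\<^bsub>free_alg X\<^esub> g) w = f w + g w"
  and free_zero_apply: "\<zero>\<^bsub>free_alg X\<^esub> w = 0"
  and free_smult_apply: "(c \<odot>\<^bsub>free_alg X\<^esub> f) w = c * f w"
  by (simp_all add: free_alg_def)

lemma free_mult_closed:
  assumes f: "f \<in> carrier (free_alg X)" and g: "g \<in> carrier (free_alg X)"
  shows "f \<otimes>\<^bsub>free_alg X\<^esub> g \<in> carrier (free_alg X)"
proof -
  have split: "\<exists>u v. w = u @ v \<and> f u \<noteq> 0 \<and> g v \<noteq> 0" if "(f \<otimes>\<^bsub>free_alg X\<^esub> g) w \<noteq> 0" for w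
  proof -
    have "(\<Sum>k\<le>length w. f (take k w) * g (drop k w)) \<noteq> 0"
      using that by (simp add: free_alg_def)
    then obtain k where "f (take k w) * g (drop k w) \<noteq> 0"
      by (auto elim: sum.not_neutral_contains_not_neutral)
    then show ?thesis
      by (intro exI[of _ "take k w"] exI[of _ "drop k w"]) auto
  qed
  have "{w. (f \<otimes>\<^bsub>free_alg X\<^esub> g) w \<noteq> 0} \<subseteq> (\<lambda>(u, v). u @ v) ` ({u. f u \<noteq> 0} \<times> {v. g v \<noteq> 0})"
    using split by fast
  then have "finite {w. (f \<otimes>\<^bsub>free_alg X\<^esub> g) w \<noteq> 0}"
    using f g by (elim finite_subset) (auto simp: free_carrier)
  moreover have "set w \<subseteq> X" if w: "(f \<otimes>\<^bsub>free_alg X\<^esub> g) w \<noteq> 0" for w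
  proof -
    obtain u v where "w = u @ v" "f u \<noteq> 0" "g v \<noteq> 0"
      using split[OF w] by blast
    then show ?thesis
      using f g by (auto simp: free_carrier)
  qed
  ultimately show ?thesis
    by (simp add: free_carrier)
qed

lemma sum_triangle_swap:
  fixes a :: "nat \<Rightarrow> nat \<Rightarrow> 'b::comm_monoid_add"
  shows "(\<Sum>k=0..n. \<Sum>i=0..k. a k i) = (\<Sum>i=0..n. \<Sum>k=i..n. a k i)"
  by (induction n) (auto simp: sum.distrib)

text \<open>Both bracketings sum over all ways of cutting \<open>w\<close> at two places
  \<open>i \<le> k\<close>; they differ in which cut is the outer summation index.
  \<open>G k i\<close> is the common summand.\<close>

lemma free_mult_assoc:
  "(f \<otimes>\<^bsub>free_alg X\<^esub> g) \<otimes>\<^bsub>free_alg X\<^esub> h = f \<otimes>\<^bsub>free_alg X\<^esub> (g \<otimes>\<^bsub>free_alg X\<^esub> h)"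
proof
  fix w
  define G where "G k i = f (take i w) * g (drop i (take k w)) * h (drop k w)" for k i :: nat
  have "((f \<otimes>\<^bsub>free_alg X\<^esub> g) \<otimes>\<^bsub>free_alg X\<^esub> h) w = (\<Sum>k=0..length w. \<Sum>i=0..k. G k i)"
    by (auto simp: G_def free_alg_def sum_distrib_right min_absorb1 atMost_atLeast0 intro!: sum.cong)
  also have "\<dots> = (\<Sum>i=0..length w. \<Sum>k=i..length w. G k i)"
    by (rule sum_triangle_swap)
  also have "\<dots> = (\<Sum>i\<le>length w. \<Sum>j\<le>length w - i. G (i + j) i)"
    unfolding atMost_atLeast0
    by (rule sum.cong[OF refl], subst sum.atLeastAtMost_shift_0) (auto simp: comp_def)
  also have "\<dots> = (f \<otimes>\<^bsub>free_alg X\<^esub> (g \<otimes>\<^bsub>free_alg X\<^esub> h)) w"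
    by (auto simp: G_def free_alg_def sum_distrib_left drop_take add.commute mult.assoc intro!: sum.cong)
  finally show "((f \<otimes>\<^bsub>free_alg X\<^esub> g) \<otimes>\<^bsub>free_alg X\<^esub> h) w = \<dots>" .
qed

lemma free_mult_one:
  "\<one>\<^bsub>free_alg X\<^esub> \<otimes>\<^bsub>free_alg X\<^esub> f = f" "f \<otimes>\<^bsub>free_alg X\<^esub> \<one>\<^bsub>free_alg X\<^esub> = f"
proof -
  have "(\<one>\<^bsub>free_alg X\<^esub> \<otimes>\<^bsub>free_alg X\<^esub> f) w = (\<Sum>k\<le>length w. if k = 0 then f w else 0)" for w
    unfolding free_mult_apply free_one_apply by (intro sum.cong) auto
  then show "\<one>\<^bsub>free_alg X\<^esub> \<otimes>\<^bsub>free_alg X\<^esub> f = f"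
    by (auto simp: fun_eq_iff)
  have "(f \<otimes>\<^bsub>free_alg X\<^esub> \<one>\<^bsub>free_alg X\<^esub>) w = (\<Sum>k\<le>length w. if k = length w then f w else 0)" for w
    unfolding free_mult_apply free_one_apply by (intro sum.cong) auto
  then show "f \<otimes>\<^bsub>free_alg X\<^esub> \<one>\<^bsub>free_alg X\<^esub> = f"
    by (auto simp: fun_eq_iff)
qed

lemma complex_algebra_free_alg: "complex_algebra (free_alg X)"
proof (rule complex_algebraI, goal_cases)
  case (1 f g)
  have "{w. f w + g w \<noteq> 0} \<subseteq> {w. f w \<noteq> 0} \<union> {w. g w \<noteq> 0}"
    by auto
  then have "finite {w. f w + g w \<noteq> 0}"
    using 1 by (elim finite_subset) (auto simp: free_carrier)
  then show ?case
    using 1 by (auto simp: free_carrier free_add_apply) (metis add_0 subsetD)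
next
  case (5 c f)
  have "{w. c * f w \<noteq> 0} \<subseteq> {w. f w \<noteq> 0}"
    by auto
  then have "finite {w. c * f w \<noteq> 0}"
    using 5 by (elim finite_subset) (auto simp: free_carrier)
  then show ?case
    using 5 by (auto simp: free_carrier free_smult_apply)
qed (simp_all only: free_mult_closed free_mult_assoc free_mult_one,
    simp_all add: free_carrier fun_eq_iff free_mult_apply free_one_apply free_add_apply free_zero_apply
      free_smult_apply algebra_simps sum.distrib sum_distrib_left)

lemma free_word_closed [simp, intro]: "set u \<subseteq> X \<Longrightarrow> free_word u \<in> carrier (free_alg X)"
  by (auto simp: free_word_def free_carrier)

lemma free_gen_closed [simp, intro]: "x \<in> X \<Longrightarrow> free_gen x \<in> carrier (free_alg X)"
  by (simp add: free_gen_eq_free_word)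

lemma free_word_mult: "free_word u \<otimes>\<^bsub>free_alg X\<^esub> free_word v = free_word (u @ v)"
proof
  fix w
  have "(free_word u \<otimes>\<^bsub>free_alg X\<^esub> free_word v) w = (\<Sum>k\<le>length w. if k = length u \<and> w = u @ v then 1 else 0)"
    unfolding free_mult_apply free_word_def by (intro sum.cong) auto
  then show "(free_word u \<otimes>\<^bsub>free_alg X\<^esub> free_word v) w = free_word (u @ v) w"
    by (auto simp: free_word_def)
qed

lemma free_word_Nil: "free_word [] = \<one>\<^bsub>free_alg X\<^esub>"
  by (simp add: free_word_def free_alg_def)

text \<open>Induction on the finite support: setting the coefficient of one word to zero removes
  exactly that word. Linear statements thereby reduce to single words.\<close>

lemma free_alg_induct [consumes 1, case_names zero add]:
  assumes "f \<in> carrier (free_alg X)" and "P \<zero>\<^bsub>free_alg X\<^esub>"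
    and add: "\<And>c u f. f \<in> carrier (free_alg X) \<Longrightarrow> set u \<subseteq> X \<Longrightarrow> P f \<Longrightarrow>
      P (c \<odot>\<^bsub>free_alg X\<^esub> free_word u \<oplus>\<^bsub>free_alg X\<^esub> f)"
  shows "P f"
proof -
  have "finite W \<Longrightarrow> f \<in> carrier (free_alg X) \<Longrightarrow> {w. f w \<noteq> 0} = W \<Longrightarrow> P f" for W
  proof (induction W arbitrary: f rule: finite_induct)
    case empty
    then have "f = \<zero>\<^bsub>free_alg X\<^esub>" by (auto simp: free_alg_def)
    then show ?case using assms(2) by simp
  next
    case (insert u W)
    define f' where "f' = f(u := 0)"
    have supp: "{w. f' w \<noteq> 0} = W"
      using insert by (auto simp: f'_def)
    have carr: "f' \<in> carrier (free_alg X)"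
      using insert supp by (auto simp: free_carrier f'_def)
    have "set u \<subseteq> X"
      using insert by (auto simp: free_carrier)
    moreover have "f = f u \<odot>\<^bsub>free_alg X\<^esub> free_word u \<oplus>\<^bsub>free_alg X\<^esub> f'"
      by (auto simp: free_alg_def free_word_def f'_def)
    ultimately show ?case
      using add[OF carr] insert.IH[OF carr supp] by metis
  qed
  then show ?thesis
    using assms(1) by (auto simp: free_carrier)
qed

context complex_algebra
begin

lemma lprod_map_closed: "g ` X \<subseteq> carrier A \<Longrightarrow> set w \<subseteq> X \<Longrightarrow> lprod A (map g w) \<in> carrier A"
  by (intro lprod_closed) auto

text \<open>The support of \<open>f\<close> changes under addition and scaling. Summing over a
  common larger set \<open>W\<close> of words makes the values of different elements
  comparable.\<close>

lemma free_eval_eq_finsum: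
  assumes "g ` X \<subseteq> carrier A" "finite W" "{w. f w \<noteq> 0} \<subseteq> W" "\<And>w. w \<in> W \<Longrightarrow> set w \<subseteq> X"
  shows "free_eval A g f = (\<Oplus>w\<in>W. f w \<odot> lprod A (map g w))"
  unfolding free_eval_def
  using assms lprod_map_closed[OF assms(1)]
  by (intro add.finprod_mono_neutral_cong_left) auto

lemma free_eval_word:
  assumes "g ` X \<subseteq> carrier A" "set u \<subseteq> X"
  shows "free_eval A g (free_word u) = lprod A (map g u)"
  using assms lprod_map_closed[OF assms] 
  by (subst free_eval_eq_finsum[where W = "{u}" and X = X]) (auto simp: free_word_def)

lemma free_eval_closed:
  assumes "g ` X \<subseteq> carrier A" "f \<in> carrier (free_alg X)"
  shows "free_eval A g f \<in> carrier A"
  unfolding free_eval_def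
  using assms lprod_map_closed[OF assms(1)] by (intro finsum_closed) (auto simp: free_carrier)

lemma free_eval_add:
  assumes "g ` X \<subseteq> carrier A" "f \<in> carrier (free_alg X)" "f' \<in> carrier (free_alg X)"
  shows "free_eval A g (f \<oplus>\<^bsub>free_alg X\<^esub> f') = free_eval A g f \<oplus> free_eval A g f'"
proof -
  define W where "W = {w. f w \<noteq> 0} \<union> {w. f' w \<noteq> 0}"
  have W: "finite W" "\<And>w. w \<in> W \<Longrightarrow> set w \<subseteq> X" "{w. f w \<noteq> 0} \<subseteq> W" "{w. f' w \<noteq> 0} \<subseteq> W"
    "{w. (f \<oplus>\<^bsub>free_alg X\<^esub> f') w \<noteq> 0} \<subseteq> W"
    using assms(2,3) by (auto simp: W_def free_alg_def)
  have "free_eval A g f \<oplus> free_eval A g f' = (\<Oplus>w\<in>W. f w \<odot> lprod A (map g w) \<oplus> f' w \<odot> lprod A (map g w))"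
    using W lprod_map_closed[OF assms(1)]
    by (subst finsum_addf) (auto simp: free_eval_eq_finsum[OF assms(1), where W = W])
  also have "\<dots> = free_eval A g (f \<oplus>\<^bsub>free_alg X\<^esub> f')"
    using W lprod_map_closed[OF assms(1)]
    by (subst free_eval_eq_finsum[OF assms(1), where W = W])
      (auto intro!: finsum_cong' simp: free_alg_def smult_l_distr simp del: finsum_addf)
  finally show ?thesis by simp
qed

lemma free_eval_smult:
  assumes "g ` X \<subseteq> carrier A" "f \<in> carrier (free_alg X)"
  shows "free_eval A g (c \<odot>\<^bsub>free_alg X\<^esub> f) = c \<odot> free_eval A g f"
proof -
  have "free_eval A g (c \<odot>\<^bsub>free_alg X\<^esub> f) = (\<Oplus>w\<in>{w. f w \<noteq> 0}. c \<odot> (f w \<odot> lprod A (map g w)))"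
    using assms lprod_map_closed[OF assms(1)]
    by (subst free_eval_eq_finsum[OF assms(1), where W = "{w. f w \<noteq> 0}"])
      (auto simp: free_carrier free_alg_def smult_smult intro!: finsum_cong')
  also have "\<dots> = c \<odot> free_eval A g f"
    unfolding free_eval_def using assms lprod_map_closed[OF assms(1)]
    by (subst finsum_smult) (auto simp: free_carrier)
  finally show ?thesis .
qed

text \<open>Multiplicativity takes two linear inductions: on the right factor while the left one is
  a single word, where it is concatenation of lists, and then on the left factor.\<close>

lemma free_eval_hom:
  assumes g: "g ` X \<subseteq> carrier A"
  shows "complex_algebra_hom (free_alg X) A (free_eval A g)"
proof -
  interpret F: complex_algebra "free_alg X" by (rule complex_algebra_free_alg)
  note ev = free_eval_closed[OF g] free_eval_add[OF g] free_eval_smult[OF g] free_eval_word[OF g]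
  have zero: "free_eval A g \<zero>\<^bsub>free_alg X\<^esub> = \<zero>"
    by (simp add: free_eval_def free_alg_def)
  have word: "free_eval A g (free_word u \<otimes>\<^bsub>free_alg X\<^esub> f) = lprod A (map g u) \<otimes> free_eval A g f"
    if "f \<in> carrier (free_alg X)" and u: "set u \<subseteq> X" for u f
    using that(1)
  proof (induction rule: free_alg_induct)
    case zero
    then show ?case using u lprod_map_closed[OF g] by (simp add: zero \<open>free_eval A g \<zero>\<^bsub>free_alg X\<^esub> = \<zero>\<close>)
  next
    case (add c v f)
    have "lprod A (map g (u @ v)) = lprod A (map g u) \<otimes> lprod A (map g v)"
      using u add(2) g by (subst map_append, subst lprod_append) auto
    with add u show ?case
      by (simp add: ev F.r_distr F.smult_mult_right free_word_mult r_distr smult_mult_right lprod_map_closed[OF g])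
  qed
  have mult: "free_eval A g (f \<otimes>\<^bsub>free_alg X\<^esub> f') = free_eval A g f \<otimes> free_eval A g f'"
    if "f \<in> carrier (free_alg X)" and f': "f' \<in> carrier (free_alg X)" for f f'
    using that(1)
  proof (induction rule: free_alg_induct)
    case zero
    then show ?case using f' by (simp add: ev \<open>free_eval A g \<zero>\<^bsub>free_alg X\<^esub> = \<zero>\<close>)
  next
    case (add c v f)
    with f' show ?case
      by (simp add: ev F.l_distr F.smult_mult_left word l_distr smult_mult_left lprod_map_closed[OF g])
  qed
  have one: "free_eval A g \<one>\<^bsub>free_alg X\<^esub> = \<one>"
    using ev(4)[of "[]"] by (simp add: free_word_Nil[of X])
  show ?thesis
    using ev mult one complex_algebra_axioms F.complex_algebra_axioms
    by (intro complex_algebra_hom.intro complex_algebra_hom_axioms.intro calg_homI) auto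
qed

end

section \<open>Algebras given by generators and relations\<close>

lemma presented_hom:
  assumes "Rel \<subseteq> carrier (free_alg X)"
  shows "complex_algebra_hom (free_alg X) (presented X Rel) (\<lambda>f. Idl\<^bsub>free_alg X\<^esub> Rel +>\<^bsub>free_alg X\<^esub> f)"
proof -
  interpret F: complex_algebra "free_alg X" by (rule complex_algebra_free_alg)
  show ?thesis
    unfolding presented_def by (rule F.quot_alg_hom[OF F.genideal_ideal[OF assms]])
qed

lemma presented_rel:
  assumes "Rel \<subseteq> carrier (free_alg X)" "r \<in> Rel"
  shows "Idl\<^bsub>free_alg X\<^esub> Rel +>\<^bsub>free_alg X\<^esub> r = \<zero>\<^bsub>presented X Rel\<^esub>"
proof -
  interpret F: complex_algebra "free_alg X" by (rule complex_algebra_free_alg)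
  interpret I: ideal "Idl\<^bsub>free_alg X\<^esub> Rel" "free_alg X" by (rule F.genideal_ideal[OF assms(1)])
  have "r \<in> Idl\<^bsub>free_alg X\<^esub> Rel"
    using F.genideal_self[OF assms(1)] assms(2) by auto
  then show ?thesis
    by (simp add: presented_def quot_alg_def ring.defs FactRing_def I.a_rcos_const)
qed

section \<open>Multi-indices of tensor powers\<close>

lemma finite_tidx [simp, intro]: "finite (tidx n m)"
  using finite_lists_length_eq[of "{1..n}" m] by (simp add: tidx_def conj_commute)

lemma length_tidx: "I \<in> tidx n m \<Longrightarrow> length I = m"
  by (simp add: tidx_def)

lemma nth_tidx: "I \<in> tidx n m \<Longrightarrow> k < m \<Longrightarrow> I ! k \<in> {1..n}"
  unfolding tidx_def using nth_mem by blast

lemma tidx_2E: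
  assumes "I \<in> tidx n 2"
  obtains a b where "I = [a, b]" "a \<in> {1..n}" "b \<in> {1..n}"
  using assms by (auto simp: tidx_def numeral_2_eq_2 length_Suc_conv)

lemma tidx_2_iff [simp]: "[a, b] \<in> tidx n 2 \<longleftrightarrow> a \<in> {1..n} \<and> b \<in> {1..n}"
  by (auto simp: tidx_def)

section \<open>The R-matrix as an operator\<close>

lemma Pmat_entry:
  assumes "a \<in> {1..n}" "b \<in> {1..n}" "c \<in> {1..n}" "d \<in> {1..n}"
  shows "Pmat n ([a, b], [c, d]) = (if a = d \<and> b = c then 1 else 0)"
proof -
  have "Pmat n ([a, b], [c, d]) = (\<Sum>i\<in>{1..n}. \<Sum>j\<in>{1..n}. if j = c then if i = a then if a = d \<and> b = c then 1 else 0 else 0 else 0)"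
    unfolding Pmat_def using assms
    by (simp only: restrict_apply mem_Sigma_iff tidx_2_iff simp_thms if_True)
      (rule sum.cong[OF refl], rule sum.cong[OF refl], auto simp: tens2_def munit_def)
  also have "\<dots> = (\<Sum>i\<in>{1..n}. if i = a then if a = d \<and> b = c then 1 else 0 else 0)"
    using assms by (subst sum.delta) auto
  also have "\<dots> = (if a = d \<and> b = c then 1 else 0)"
    using assms by (subst sum.delta) auto
  finally show ?thesis .
qed

lemma Rmat_entry:
  assumes "a \<in> {1..n}" "b \<in> {1..n}" "c \<in> {1..n}" "d \<in> {1..n}"
  shows "Rmat n q ([a, b], [c, d]) =
    (if a = c \<and> b = d then if a = b then q else 1 else 0)
    + (if a = d \<and> b = c \<and> a < b then q - inverse q else 0)"
proof -
  have 1: "(\<Sum>i\<in>{1..n}. tens2 (munit i i) (munit i i) ([a, b], [c, d]))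
      = (\<Sum>i\<in>{1..n}. if i = a then if a = b \<and> a = c \<and> a = d then 1 else 0 else 0)"
    by (rule sum.cong[OF refl]) (auto simp: tens2_def munit_def)
  have 2: "(\<Sum>j\<in>{1..n} - {i}. tens2 (munit i i) (munit j j) ([a, b], [c, d]))
      = (if i = a then \<Sum>j\<in>{1..n} - {a}. if j = b then if a = c \<and> b = d then 1 else 0 else 0 else 0)" for i
  proof (cases "i = a")
    case True
    have "(\<Sum>j\<in>{1..n} - {i}. tens2 (munit i i) (munit j j) ([a, b], [c, d]))
      = (\<Sum>j\<in>{1..n} - {a}. if j = b then if a = c \<and> b = d then 1 else 0 else 0)"
      unfolding True by (rule sum.cong[OF refl]) (auto simp: tens2_def munit_def)
    with True show ?thesis by simp
  qed (simp add: tens2_def munit_def)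
  have 3: "(\<Sum>j\<in>{i<..n}. tens2 (munit i j) (munit j i) ([a, b], [c, d]))
      = (if i = a then \<Sum>j\<in>{a<..n}. if j = b then if a = d \<and> b = c then 1 else 0 else 0 else 0)" for i
  proof (cases "i = a")
    case True
    have "(\<Sum>j\<in>{i<..n}. tens2 (munit i j) (munit j i) ([a, b], [c, d]))
      = (\<Sum>j\<in>{a<..n}. if j = b then if a = d \<and> b = c then 1 else 0 else 0)"
      unfolding True by (rule sum.cong[OF refl]) (auto simp: tens2_def munit_def)
    with True show ?thesis by simp
  qed (simp add: tens2_def munit_def)
  show ?thesis
    using assms unfolding Rmat_def 
    by (simp only: restrict_apply mem_Sigma_iff tidx_2_iff simp_thms if_True 1 2 3)
      (auto simp: sum.delta)
qed

text \<open>Left multiplication by \<open>P\<close> exchanges the two row indices, so the row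
  \<open>[a, b]\<close> is the row \<open>[b, a]\<close> of \<open>Rmat\<close>; this reverses the
  inequality in the last term.\<close>

lemma Rcheck_entry:
  assumes "a \<in> {1..n}" "b \<in> {1..n}" "c \<in> {1..n}" "d \<in> {1..n}"
  shows "Rcheck n q ([a, b], [c, d]) =
    (if c = b \<and> d = a then if a = b then q else 1 else 0)
    + (if c = a \<and> d = b \<and> b < a then q - inverse q else 0)"
proof -
  have "Rcheck n q ([a, b], [c, d]) = (\<Sum>K\<in>tidx n 2. Pmat n ([a, b], K) * Rmat n q (K, [c, d]))"
    unfolding Rcheck_def using assms by (simp add: finsum_complex_alg) (simp add: complex_alg_def)
  also have "\<dots> = (\<Sum>K\<in>tidx n 2. if K = [b, a] then Rmat n q ([b, a], [c, d]) else 0)"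
    using assms by (intro sum.cong refl) (auto elim!: tidx_2E simp: Pmat_entry split: if_splits)
  also have "\<dots> = Rmat n q ([b, a], [c, d])"
    using assms by (subst sum.delta) auto
  finally show ?thesis
    using assms by (auto simp: Rmat_entry)
qed

text \<open>Tensor factors are numbered from 1 and list positions from 0: the factors
  \<open>k\<close> and \<open>k + 1\<close> sit at positions \<open>k - 1\<close> and
  \<open>k\<close>.\<close>

definition swap_adj :: "nat \<Rightarrow> nat list \<Rightarrow> nat list" where
  "swap_adj k I = I[k - 1 := I ! k, k := I ! (k - 1)]"

text \<open>
  \<open>Rcheck\<close> sends the basis index \<open>I\<close> to \<open>swap_adj k I\<close> with coefficient \<open>R_swap\<close>
  and to \<open>I\<close> with coefficient \<open>R_stay\<close>.
\<close>

definition R_swap :: "complex \<Rightarrow> nat \<Rightarrow> nat list \<Rightarrow> complex" where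
  "R_swap q k I = (if I ! (k - 1) = I ! k then q else 1)"

definition R_stay :: "complex \<Rightarrow> nat \<Rightarrow> nat list \<Rightarrow> complex" where
  "R_stay q k I = (if I ! k < I ! (k - 1) then q - inverse q else 0)"

lemma length_swap_adj [simp]: "length (swap_adj k I) = length I"
  by (simp add: swap_adj_def)

lemma nth_swap_adj:
  "k < length I \<Longrightarrow> l < length I \<Longrightarrow>
    swap_adj k I ! l = (if l = k then I ! (k - 1) else if l = k - 1 then I ! k else I ! l)"
  by (auto simp: swap_adj_def nth_list_update)

lemma swap_adj_swap_adj [simp]: "k < length I \<Longrightarrow> swap_adj k (swap_adj k I) = I"
  by (rule nth_equalityI) (auto simp: nth_swap_adj)

lemma swap_adj_eq_iff: "k < length I \<Longrightarrow> k < length J \<Longrightarrow> J = swap_adj k I \<longleftrightarrow> I = swap_adj k J"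
  by (metis swap_adj_swap_adj)

lemma swap_adj_tidx [simp, intro]: "I \<in> tidx n m \<Longrightarrow> k < m \<Longrightarrow> swap_adj k I \<in> tidx n m"
  unfolding tidx_def by (auto simp: in_set_conv_nth nth_swap_adj subset_iff) (metis less_imp_diff_less nth_mem atLeastAtMost_iff)+

text \<open>If the two indices at \<open>k\<close> coincide, then \<open>swap_adj k I = I\<close>
  and both conditions hold for \<open>J = I\<close>. The sum is still right, since then
  \<open>R_swap\<close> is \<open>q\<close> and \<open>R_stay\<close> is 0.\<close>

lemma place2_Rcheck_entry:
  assumes "I \<in> tidx n m" "J \<in> tidx n m" "1 \<le> k" "k < m"
  shows "place2 n m k (Rcheck n q) (I, J) =
    (if J = swap_adj k I then R_swap q k I else 0) + (if J = I then R_stay q k I else 0)"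
proof -
  have len: "length I = m" "length J = m"
    using assms by (auto simp: length_tidx)
  define agree where "agree \<longleftrightarrow> (\<forall>l<m. l \<noteq> k - 1 \<and> l \<noteq> k \<longrightarrow> I ! l = J ! l)"
  \<comment> \<open>Stated for arbitrary values \<open>x\<close> and \<open>y\<close>, so that one
    equivalence describes both \<open>J = swap_adj k I\<close> and \<open>J = I\<close>.\<close>
  have ptwise: "(\<forall>l<m. J ! l = (if l = k then x else if l = k - 1 then y else I ! l))
      \<longleftrightarrow> agree \<and> J ! (k - 1) = y \<and> J ! k = x" (is "?L \<longleftrightarrow> ?R") for x y
  proof
    assume L: ?L
    have "k - 1 < m" "k - 1 \<noteq> k"
      using assms(3,4) by auto
    then show ?R
      using L assms(4) by (simp add: agree_def)
  next
    assume ?R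
    then show ?L
      by (auto simp: agree_def)
  qed
  have swap: "J = swap_adj k I \<longleftrightarrow> agree \<and> J ! (k - 1) = I ! k \<and> J ! k = I ! (k - 1)"
    unfolding ptwise[symmetric] using len assms(4) by (simp add: list_eq_iff_nth_eq nth_swap_adj)
  have "(if l = k then I ! k else if l = k - 1 then I ! (k - 1) else I ! l) = I ! l" for l
    by simp
  then have "J = I \<longleftrightarrow> (\<forall>l<m. J ! l = (if l = k then I ! k else if l = k - 1 then I ! (k - 1) else I ! l))"
    using len by (simp only: list_eq_iff_nth_eq) simp
  then have stay: "J = I \<longleftrightarrow> agree \<and> J ! (k - 1) = I ! (k - 1) \<and> J ! k = I ! k"
    unfolding ptwise .
  have nth: "I ! (k - 1) \<in> {1..n}" "I ! k \<in> {1..n}" "J ! (k - 1) \<in> {1..n}" "J ! k \<in> {1..n}"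
    using assms nth_tidx[of _ n m "k - 1"] nth_tidx[of _ n m k] by auto
  have "place2 n m k (Rcheck n q) (I, J)
      = (if agree then Rcheck n q ([I ! (k - 1), I ! k], [J ! (k - 1), J ! k]) else 0)"
    using assms by (simp add: place2_def agree_def)
  then show ?thesis
    unfolding Rcheck_entry[OF nth] swap stay R_swap_def R_stay_def
    by (cases agree; cases "J ! (k - 1) = I ! k"; cases "J ! k = I ! (k - 1)";
        cases "J ! (k - 1) = I ! (k - 1)"; cases "J ! k = I ! k") simp_all
qed

context complex_algebra
begin

lemma Rcheck_at_closed [simp, intro]: "Rcheck_at A n q m k \<in> carrier (tens_alg A n m)"
  by (simp add: Rcheck_at_def)

lemma Rcheck_at_mult_entry:
  assumes X: "X \<in> carrier (tens_alg A n m)" and IJ: "I \<in> tidx n m" "J \<in> tidx n m" and k: "1 \<le> k" "k < m"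
  shows "(Rcheck_at A n q m k \<otimes>\<^bsub>tens_alg A n m\<^esub> X) (I, J)
    = R_swap q k I \<odot> X (swap_adj k I, J) \<oplus> R_stay q k I \<odot> X (I, J)"
proof -
  have "(Rcheck_at A n q m k \<otimes>\<^bsub>tens_alg A n m\<^esub> X) (I, J)
      = (\<Oplus>K\<in>tidx n m. (if K = swap_adj k I then R_swap q k I else 0) \<odot> X (K, J)
            \<oplus> (if K = I then R_stay q k I else 0) \<odot> X (K, J))"
    unfolding mat_entry(1)[OF IJ] using X IJ k
    by (intro finsum_cong') (auto simp: Rcheck_at_def place2_Rcheck_entry smult_mult_left smult_l_distr l_distr)
  also have "\<dots> = (\<Oplus>K\<in>tidx n m. (if K = swap_adj k I then R_swap q k I else 0) \<odot> X (K, J))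
      \<oplus> (\<Oplus>K\<in>tidx n m. (if K = I then R_stay q k I else 0) \<odot> X (K, J))"
    using X IJ by (intro finsum_addf) auto
  also have "(\<Oplus>K\<in>tidx n m. (if K = swap_adj k I then R_swap q k I else 0) \<odot> X (K, J))
      = (if swap_adj k I = swap_adj k I then R_swap q k I else 0) \<odot> X (swap_adj k I, J)"
    using X IJ k by (intro finsum_delta) auto
  also have "(\<Oplus>K\<in>tidx n m. (if K = I then R_stay q k I else 0) \<odot> X (K, J))
      = (if I = I then R_stay q k I else 0) \<odot> X (I, J)"
    using X IJ k by (intro finsum_delta) auto
  finally show ?thesis by simp
qed

text \<open>The coefficients for columns are those for rows because \<open>Rcheck\<close> is
  symmetric: \<open>R_swap\<close> does not change under the swap, and the \<open>R_stay\<close>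
  part is diagonal.\<close>

lemma mult_Rcheck_at_entry:
  assumes X: "X \<in> carrier (tens_alg A n m)" and IJ: "I \<in> tidx n m" "J \<in> tidx n m" and k: "1 \<le> k" "k < m"
  shows "(X \<otimes>\<^bsub>tens_alg A n m\<^esub> Rcheck_at A n q m k) (I, J)
    = R_swap q k J \<odot> X (I, swap_adj k J) \<oplus> R_stay q k J \<odot> X (I, J)"
proof -
  have sw: "J = swap_adj k K \<longleftrightarrow> K = swap_adj k J" if "K \<in> tidx n m" for K
    using that IJ k by (intro swap_adj_eq_iff) (auto simp: length_tidx)
  have coeff: "R_swap q k (swap_adj k J) = R_swap q k J"
    using IJ k by (auto simp: R_swap_def nth_swap_adj length_tidx)
  have entry: "place2 n m k (Rcheck n q) (K, J)
      = (if K = swap_adj k J then R_swap q k J else 0) + (if K = J then R_stay q k J else 0)" if "K \<in> tidx n m" for K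
    unfolding place2_Rcheck_entry[OF that IJ(2) k] sw[OF that]
    by (cases "K = J"; cases "K = swap_adj k J") (simp_all add: coeff)
  have "(X \<otimes>\<^bsub>tens_alg A n m\<^esub> Rcheck_at A n q m k) (I, J)
      = (\<Oplus>K\<in>tidx n m. (if K = swap_adj k J then R_swap q k J else 0) \<odot> X (I, K)
            \<oplus> (if K = J then R_stay q k J else 0) \<odot> X (I, K))"
    unfolding mat_entry(1)[OF IJ] using X IJ k
    by (intro finsum_cong') (auto simp: Rcheck_at_def entry smult_mult_right smult_l_distr r_distr)
  also have "\<dots> = (\<Oplus>K\<in>tidx n m. (if K = swap_adj k J then R_swap q k J else 0) \<odot> X (I, K))
      \<oplus> (\<Oplus>K\<in>tidx n m. (if K = J then R_stay q k J else 0) \<odot> X (I, K))"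
    using X IJ by (intro finsum_addf) auto
  also have "(\<Oplus>K\<in>tidx n m. (if K = swap_adj k J then R_swap q k J else 0) \<odot> X (I, K))
      = (if swap_adj k J = swap_adj k J then R_swap q k J else 0) \<odot> X (I, swap_adj k J)"
    using X IJ k by (intro finsum_delta) auto
  also have "(\<Oplus>K\<in>tidx n m. (if K = J then R_stay q k J else 0) \<odot> X (I, K))
      = (if J = J then R_stay q k J else 0) \<odot> X (I, J)"
    using X IJ k by (intro finsum_delta) auto
  finally show ?thesis by simp
qed

end

section \<open>The Hecke relations for the R-matrix\<close>

definition R_op :: "complex \<Rightarrow> nat \<Rightarrow> (nat list \<Rightarrow> complex) \<Rightarrow> nat list \<Rightarrow> complex" where
  "R_op q k f I = R_swap q k I * f (swap_adj k I) + R_stay q k I * f I"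

text \<open>Left multiplication acts on each column separately, as an operator on functions of the
  row index. In this form the Hecke relations become identities about lists.\<close>

lemma Rcheck_at_mult_complex:
  assumes "X \<in> carrier (tens_alg complex_alg n m)" "I \<in> tidx n m" "J \<in> tidx n m" "1 \<le> k" "k < m"
  shows "(Rcheck_at complex_alg n q m k \<otimes>\<^bsub>tens_alg complex_alg n m\<^esub> X) (I, J) = R_op q k (\<lambda>I. X (I, J)) I"
  using complex_algebra.Rcheck_at_mult_entry[OF complex_algebra_complex_alg assms]
  by (simp add: R_op_def complex_alg_def)

text \<open>For distinct indices exactly one of \<open>I\<close> and \<open>swap_adj k I\<close> has
  a nonzero \<open>R_stay\<close>. For equal indices the swap fixes \<open>I\<close> and the
  relation reads \<open>q^2 = (q - 1/q) q + 1\<close>.\<close>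

lemma R_op_quadratic:
  assumes "q \<noteq> 0" "1 \<le> k" "k < length I"
  shows "R_op q k (R_op q k f) I = (q - inverse q) * R_op q k f I + f I"
proof -
  have "swap_adj k I = I" if "I ! k = I ! (k - 1)"
    using that assms by (auto simp: swap_adj_def list_eq_iff_nth_eq nth_list_update)
  with assms show ?thesis
    by (auto simp: R_op_def R_swap_def R_stay_def nth_swap_adj field_simps)
qed

lemma R_op_cong:
  assumes "f I = g I" "f (swap_adj k I) = g (swap_adj k I)"
  shows "R_op q k f I = R_op q k g I"
  using assms by (simp add: R_op_def)

text \<open>Splitting the index as \<open>p @ a # b # s\<close> exposes the two affected letters to
  rewriting; \<open>p\<close> has length \<open>k - 1\<close>, hence the operator number
  \<open>Suc (length p)\<close>.\<close>

lemma R_op_append: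
  "R_op q (Suc (length p)) f (p @ a # b # s)
    = (if a = b then q else 1) * f (p @ b # a # s) + (if b < a then q - inverse q else 0) * f (p @ a # b # s)"
  by (simp add: R_op_def R_swap_def R_stay_def swap_adj_def nth_append list_update_append)

lemma R_op_append':
  "R_op q (Suc (Suc (length p))) f (p @ a # b # c # s)
    = (if b = c then q else 1) * f (p @ a # c # b # s) + (if c < b then q - inverse q else 0) * f (p @ a # b # c # s)"
  using R_op_append[of q "p @ [a]" f b c s] by simp

text \<open>Only the three letters \<open>a\<close>, \<open>b\<close>, \<open>c\<close> at the
  affected positions matter, and the coefficients depend only on their relative order, so a finite
  case distinction suffices.\<close>

lemma R_op_braid:
  assumes "q \<noteq> 0" "1 \<le> k" "k + 1 < length I"
  shows "R_op q k (R_op q (k + 1) (R_op q k f)) I = R_op q (k + 1) (R_op q k (R_op q (k + 1) f)) I"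
proof -
  obtain p l where p: "I = p @ l" "length p = k - 1"
    using assms by (metis append_take_drop_id length_take min_absorb2 less_or_eq_imp_le add_leE diff_le_self le_trans)
  then obtain a b c s where "l = a # b # c # s"
    using assms by (cases l; cases "tl l"; cases "tl (tl l)") auto
  with p have I: "I = p @ a # b # c # s" by simp
  have k: "k = Suc (length p)" 
    using p assms by auto
  show ?thesis
    unfolding I k add_Suc_right add_0_right One_nat_def R_op_append R_op_append'
    using assms(1) by (cases a b rule: linorder_cases; cases b c rule: linorder_cases; cases a c rule: linorder_cases)
      (simp_all add: field_simps)
qed

lemma R_op_commute:
  assumes "1 \<le> i" "i + 1 < j" "j < length I"
  shows "R_op q i (R_op q j f) I = R_op q j (R_op q i f) I"
proof -
  have "swap_adj i (swap_adj j I) = swap_adj j (swap_adj i I)"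
    using assms by (intro nth_equalityI) (auto simp: nth_swap_adj)
  moreover have "R_swap q i (swap_adj j I) = R_swap q i I" "R_stay q i (swap_adj j I) = R_stay q i I"
    "R_swap q j (swap_adj i I) = R_swap q j I" "R_stay q j (swap_adj i I) = R_stay q j I"
    using assms by (auto simp: R_swap_def R_stay_def nth_swap_adj)
  ultimately show ?thesis
    by (simp add: R_op_def algebra_simps)
qed

declare mat_entry(1) [simp del]

lemma complex_alg_simps:
  "x \<oplus>\<^bsub>complex_alg\<^esub> y = x + y" "x \<otimes>\<^bsub>complex_alg\<^esub> y = x * y" "x \<odot>\<^bsub>complex_alg\<^esub> y = x * y"
  "\<one>\<^bsub>complex_alg\<^esub> = 1" "\<zero>\<^bsub>complex_alg\<^esub> = 0" "x \<in> carrier complex_alg"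
  by (simp_all add: complex_alg_def)

lemma Rcheck_at_complex_entry:
  "I \<in> tidx n m \<Longrightarrow> J \<in> tidx n m \<Longrightarrow> Rcheck_at complex_alg n q m k (I, J) = place2 n m k (Rcheck n q) (I, J)"
  by (simp add: Rcheck_at_def) (simp add: complex_alg_def)

lemma Rcheck_at_complex_closed [simp, intro]: "Rcheck_at complex_alg n q m k \<in> carrier (tens_alg complex_alg n m)"
  by (rule complex_algebra.Rcheck_at_closed[OF complex_algebra_complex_alg])

lemma Rcheck_at_eq_scal_mat: "Rcheck_at A n q m k = scal_mat A (tidx n m) (Rcheck_at complex_alg n q m k)"
  by (auto simp: Rcheck_at_def[of A] scal_mat_def[of A] fun_eq_iff Rcheck_at_complex_entry)

lemma (in complex_algebra_hom) hom_Rcheck_at: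
  "mat_map h (tidx n m) (Rcheck_at A n q m k) = Rcheck_at B n q m k"
  by (simp add: Rcheck_at_def mat_map_scal_mat)

context
  fixes n m :: nat and q :: complex
  assumes q: "q \<noteq> 0"
begin

private abbreviation "C \<equiv> tens_alg complex_alg n m"
private abbreviation "T \<equiv> Rcheck_at complex_alg n q m"

interpretation C: complex_algebra C
  by (intro complex_algebra.complex_algebra_mat_alg complex_algebra_complex_alg) simp

private lemma T_T_entry:
  assumes "X \<in> carrier C" "I \<in> tidx n m" "J \<in> tidx n m" "1 \<le> k" "k < m" "1 \<le> l" "l < m"
  shows "(T k \<otimes>\<^bsub>C\<^esub> (T l \<otimes>\<^bsub>C\<^esub> X)) (I, J) = R_op q k (R_op q l (\<lambda>I. X (I, J))) I"
  using assms by (subst Rcheck_at_mult_complex) (auto intro!: R_op_cong simp: Rcheck_at_mult_complex)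

private lemma T_T_T_entry:
  assumes "X \<in> carrier C" "I \<in> tidx n m" "J \<in> tidx n m" "1 \<le> k" "k < m" "1 \<le> l" "l < m" "1 \<le> r" "r < m"
  shows "(T k \<otimes>\<^bsub>C\<^esub> (T l \<otimes>\<^bsub>C\<^esub> (T r \<otimes>\<^bsub>C\<^esub> X))) (I, J) = R_op q k (R_op q l (R_op q r (\<lambda>I. X (I, J)))) I"
  using assms by (subst Rcheck_at_mult_complex) (auto intro!: R_op_cong simp: T_T_entry)

lemma Rcheck_at_complex_quadratic:
  assumes "1 \<le> k" "k < m"
  shows "T k \<otimes>\<^bsub>C\<^esub> T k = (q - inverse q) \<odot>\<^bsub>C\<^esub> T k \<oplus>\<^bsub>C\<^esub> \<one>\<^bsub>C\<^esub>"
proof -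
  \<comment> \<open>The factor \<one> on the right supplies columns for \<open>R_op\<close> to act
    on; it is removed at the end.\<close>
  have "T k \<otimes>\<^bsub>C\<^esub> (T k \<otimes>\<^bsub>C\<^esub> \<one>\<^bsub>C\<^esub>) = (q - inverse q) \<odot>\<^bsub>C\<^esub> (T k \<otimes>\<^bsub>C\<^esub> \<one>\<^bsub>C\<^esub>) \<oplus>\<^bsub>C\<^esub> \<one>\<^bsub>C\<^esub>"
  proof (rule mat_eqI)
    fix I J assume IJ: "I \<in> tidx n m" "J \<in> tidx n m"
    then show "(T k \<otimes>\<^bsub>C\<^esub> (T k \<otimes>\<^bsub>C\<^esub> \<one>\<^bsub>C\<^esub>)) (I, J) = ((q - inverse q) \<odot>\<^bsub>C\<^esub> (T k \<otimes>\<^bsub>C\<^esub> \<one>\<^bsub>C\<^esub>) \<oplus>\<^bsub>C\<^esub> \<one>\<^bsub>C\<^esub>) (I, J)"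
      using assms q unfolding T_T_entry[OF C.one_closed IJ assms assms] mat_entry(2,5)[OF IJ]
        Rcheck_at_mult_complex[OF C.one_closed IJ assms]
      by (subst R_op_quadratic) (auto simp: length_tidx complex_alg_simps)
  qed auto
  then show ?thesis by simp
qed

lemma Rcheck_at_complex_braid:
  assumes "1 \<le> k" "k + 1 < m"
  shows "T k \<otimes>\<^bsub>C\<^esub> (T (k + 1) \<otimes>\<^bsub>C\<^esub> T k) = T (k + 1) \<otimes>\<^bsub>C\<^esub> (T k \<otimes>\<^bsub>C\<^esub> T (k + 1))"
proof -
  have "T k \<otimes>\<^bsub>C\<^esub> (T (k + 1) \<otimes>\<^bsub>C\<^esub> (T k \<otimes>\<^bsub>C\<^esub> \<one>\<^bsub>C\<^esub>)) = T (k + 1) \<otimes>\<^bsub>C\<^esub> (T k \<otimes>\<^bsub>C\<^esub> (T (k + 1) \<otimes>\<^bsub>C\<^esub> \<one>\<^bsub>C\<^esub>))"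
  proof (rule mat_eqI)
    fix I J assume IJ: "I \<in> tidx n m" "J \<in> tidx n m"
    then show "(T k \<otimes>\<^bsub>C\<^esub> (T (k + 1) \<otimes>\<^bsub>C\<^esub> (T k \<otimes>\<^bsub>C\<^esub> \<one>\<^bsub>C\<^esub>))) (I, J)
        = (T (k + 1) \<otimes>\<^bsub>C\<^esub> (T k \<otimes>\<^bsub>C\<^esub> (T (k + 1) \<otimes>\<^bsub>C\<^esub> \<one>\<^bsub>C\<^esub>))) (I, J)"
      using assms q R_op_braid[of q k I] by (subst (1 2) T_T_T_entry) (auto simp: length_tidx)
  qed auto
  then show ?thesis by simp
qed

lemma Rcheck_at_complex_commute:
  assumes "1 \<le> k" "k + 1 < l" "l < m"
  shows "T k \<otimes>\<^bsub>C\<^esub> T l = T l \<otimes>\<^bsub>C\<^esub> T k"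
proof -
  have "T k \<otimes>\<^bsub>C\<^esub> (T l \<otimes>\<^bsub>C\<^esub> \<one>\<^bsub>C\<^esub>) = T l \<otimes>\<^bsub>C\<^esub> (T k \<otimes>\<^bsub>C\<^esub> \<one>\<^bsub>C\<^esub>)"
  proof (rule mat_eqI)
    fix I J assume IJ: "I \<in> tidx n m" "J \<in> tidx n m"
    then show "(T k \<otimes>\<^bsub>C\<^esub> (T l \<otimes>\<^bsub>C\<^esub> \<one>\<^bsub>C\<^esub>)) (I, J) = (T l \<otimes>\<^bsub>C\<^esub> (T k \<otimes>\<^bsub>C\<^esub> \<one>\<^bsub>C\<^esub>)) (I, J)"
      using assms R_op_commute[of k l I] by (subst (1 2) T_T_entry) (auto simp: length_tidx)
  qed auto
  then show ?thesis by simp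
qed

end

context complex_algebra
begin

lemma tens_alg_complex_algebra: "complex_algebra (tens_alg A n m)"
  by (intro complex_algebra_mat_alg) simp

lemma Rcheck_at_relations:
  assumes "q \<noteq> 0" "1 \<le> k" "k < m"
  shows "Rcheck_at A n q m k \<otimes>\<^bsub>tens_alg A n m\<^esub> Rcheck_at A n q m k
      = (q - inverse q) \<odot>\<^bsub>tens_alg A n m\<^esub> Rcheck_at A n q m k \<oplus>\<^bsub>tens_alg A n m\<^esub> \<one>\<^bsub>tens_alg A n m\<^esub>"
    and "k + 1 < m \<Longrightarrow>
      Rcheck_at A n q m k \<otimes>\<^bsub>tens_alg A n m\<^esub> (Rcheck_at A n q m (k + 1) \<otimes>\<^bsub>tens_alg A n m\<^esub> Rcheck_at A n q m k)
      = Rcheck_at A n q m (k + 1) \<otimes>\<^bsub>tens_alg A n m\<^esub> (Rcheck_at A n q m k \<otimes>\<^bsub>tens_alg A n m\<^esub> Rcheck_at A n q m (k + 1))"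
    and "k + 1 < l \<Longrightarrow> l < m \<Longrightarrow>
      Rcheck_at A n q m k \<otimes>\<^bsub>tens_alg A n m\<^esub> Rcheck_at A n q m l
      = Rcheck_at A n q m l \<otimes>\<^bsub>tens_alg A n m\<^esub> Rcheck_at A n q m k"
proof -
  interpret S: complex_algebra_hom "tens_alg complex_alg n m" "tens_alg A n m" "scal_mat A (tidx n m)"
    by (rule scal_mat_hom) simp
  note rel = Rcheck_at_complex_quadratic[OF assms, of n] Rcheck_at_complex_braid[OF assms(1,2), of m n]
    Rcheck_at_complex_commute[OF assms(1,2), of l m n]
  show "Rcheck_at A n q m k \<otimes>\<^bsub>tens_alg A n m\<^esub> Rcheck_at A n q m k
      = (q - inverse q) \<odot>\<^bsub>tens_alg A n m\<^esub> Rcheck_at A n q m k \<oplus>\<^bsub>tens_alg A n m\<^esub> \<one>\<^bsub>tens_alg A n m\<^esub>"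
    using arg_cong[OF rel(1), of "scal_mat A (tidx n m)"]
    by (simp only: Rcheck_at_eq_scal_mat[of A] S.hom_mult S.hom_add S.hom_smult S.hom_one Rcheck_at_complex_closed
        S.A.m_closed S.A.smult_closed S.A.one_closed)
  show "Rcheck_at A n q m k \<otimes>\<^bsub>tens_alg A n m\<^esub> (Rcheck_at A n q m (k + 1) \<otimes>\<^bsub>tens_alg A n m\<^esub> Rcheck_at A n q m k)
      = Rcheck_at A n q m (k + 1) \<otimes>\<^bsub>tens_alg A n m\<^esub> (Rcheck_at A n q m k \<otimes>\<^bsub>tens_alg A n m\<^esub> Rcheck_at A n q m (k + 1))"
    if "k + 1 < m"
    using arg_cong[OF rel(2)[OF that], of "scal_mat A (tidx n m)"]
    by (simp only: Rcheck_at_eq_scal_mat[of A] S.hom_mult Rcheck_at_complex_closed S.A.m_closed)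
  show "Rcheck_at A n q m k \<otimes>\<^bsub>tens_alg A n m\<^esub> Rcheck_at A n q m l
      = Rcheck_at A n q m l \<otimes>\<^bsub>tens_alg A n m\<^esub> Rcheck_at A n q m k" if "k + 1 < l" "l < m"
    using arg_cong[OF rel(3)[OF that], of "scal_mat A (tidx n m)"]
    by (simp only: Rcheck_at_eq_scal_mat[of A] S.hom_mult Rcheck_at_complex_closed S.A.m_closed)
qed

text \<open>The quadratic relation says \<open>T (T - (q - 1/q)) = 1\<close>. The explicit form
  matters because \<open>inv\<close> is relative to a monoid and is not visibly compatible with a
  change of algebra.\<close>

lemma Rcheck_inv_at_eq:
  assumes q: "q \<noteq> 0" and k: "1 \<le> k" "k < m"
  shows "Rcheck_inv_at A n q m k
    = Rcheck_at A n q m k \<oplus>\<^bsub>tens_alg A n m\<^esub> (inverse q - q) \<odot>\<^bsub>tens_alg A n m\<^esub> \<one>\<^bsub>tens_alg A n m\<^esub>"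
    and "Rcheck_at A n q m k \<otimes>\<^bsub>tens_alg A n m\<^esub> Rcheck_inv_at A n q m k = \<one>\<^bsub>tens_alg A n m\<^esub>"
    and "Rcheck_inv_at A n q m k \<otimes>\<^bsub>tens_alg A n m\<^esub> Rcheck_at A n q m k = \<one>\<^bsub>tens_alg A n m\<^esub>"
    and "Rcheck_inv_at A n q m k \<in> carrier (tens_alg A n m)"
proof -
  interpret B: complex_algebra "tens_alg A n m"
    by (rule tens_alg_complex_algebra)
  let ?B = "tens_alg A n m" and ?T = "Rcheck_at A n q m k"
  let ?T' = "?T \<oplus>\<^bsub>?B\<^esub> (inverse q - q) \<odot>\<^bsub>?B\<^esub> \<one>\<^bsub>?B\<^esub>"
  have cancel: "(q - inverse q) \<odot>\<^bsub>?B\<^esub> ?T \<oplus>\<^bsub>?B\<^esub> \<one>\<^bsub>?B\<^esub> \<oplus>\<^bsub>?B\<^esub> (inverse q - q) \<odot>\<^bsub>?B\<^esub> ?T = \<one>\<^bsub>?B\<^esub>"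
    using B.smult_l_distr[of ?T "q - inverse q" "inverse q - q"]
    by (simp add: B.add.m_assoc B.add.m_comm[of "\<one>\<^bsub>?B\<^esub>"]) (simp add: B.add.m_assoc[symmetric] del: B.add.m_assoc)
  have inv: "?T \<otimes>\<^bsub>?B\<^esub> ?T' = \<one>\<^bsub>?B\<^esub>" "?T' \<otimes>\<^bsub>?B\<^esub> ?T = \<one>\<^bsub>?B\<^esub>"
    using Rcheck_at_relations(1)[OF assms, of n] cancel
    by (simp_all add: B.r_distr B.l_distr B.smult_mult_left B.smult_mult_right)
  then show eq: "Rcheck_inv_at A n q m k = ?T'"
    unfolding Rcheck_inv_at_def by (intro B.inv_char[symmetric, THEN sym]) auto
  show "?T \<otimes>\<^bsub>?B\<^esub> Rcheck_inv_at A n q m k = \<one>\<^bsub>?B\<^esub>" "Rcheck_inv_at A n q m k \<otimes>\<^bsub>?B\<^esub> ?T = \<one>\<^bsub>?B\<^esub>"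
    "Rcheck_inv_at A n q m k \<in> carrier ?B"
    unfolding eq using inv by auto
qed

lemma place1_closed:
  assumes "X \<in> carrier (mat_alg A {1..n})" "1 \<le> k" "k \<le> m"
  shows "place1 A n m k X \<in> carrier (tens_alg A n m)"
  using assms nth_tidx[of _ n m "k - 1"] unfolding mat_carrier
  by (auto simp: place1_def PiE_mem Pi_def)

text \<open>The two operators act on disjoint tensor factors. In entries: \<open>place1\<close> is
  diagonal in every position but 0, so swapping positions \<open>k - 1\<close> and \<open>k\<close>,
  both at least 1, in the row or in the column has the same effect. The coefficients taken from row
  and column need to agree only where the entry is nonzero.\<close>

lemma Rcheck_at_place1_commute:
  assumes X: "X \<in> carrier (mat_alg A {1..n})" and k: "2 \<le> k" "k < m"
  shows "Rcheck_at A n q m k \<otimes>\<^bsub>tens_alg A n m\<^esub> place1 A n m 1 X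
    = place1 A n m 1 X \<otimes>\<^bsub>tens_alg A n m\<^esub> Rcheck_at A n q m k"
proof (rule mat_eqI)
  have place: "place1 A n m 1 X \<in> carrier (tens_alg A n m)"
    using X k by (intro place1_closed) auto
  then show "Rcheck_at A n q m k \<otimes>\<^bsub>tens_alg A n m\<^esub> place1 A n m 1 X \<in> carrier (tens_alg A n m)"
    "place1 A n m 1 X \<otimes>\<^bsub>tens_alg A n m\<^esub> Rcheck_at A n q m k \<in> carrier (tens_alg A n m)"
    by auto
  fix I J assume IJ: "I \<in> tidx n m" "J \<in> tidx n m"
  have len: "length I = m" "length J = m"
    using IJ by (auto simp: length_tidx)
  define agree where "agree I J \<longleftrightarrow> (\<forall>l<m. l \<noteq> 0 \<longrightarrow> I ! l = J ! l)" for I J :: "nat list"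
  have entry: "place1 A n m 1 X (I', J') = (if agree I' J' then X (I' ! 0, J' ! 0) else \<zero>)"
    if "I' \<in> tidx n m" "J' \<in> tidx n m" for I' J'
    using that by (auto simp: place1_def agree_def)
  have swap_agree: "agree (swap_adj k I') J'" if "agree I' (swap_adj k J')" "length I' = m" "length J' = m" for I' J'
    unfolding agree_def
  proof (intro allI impI)
    fix l assume l: "l < m" "l \<noteq> 0"
    define l' where "l' = (if l = k then k - 1 else if l = k - 1 then k else l)"
    have "l' < m" "l' \<noteq> 0"
      using l k by (auto simp: l'_def)
    then have "I' ! l' = swap_adj k J' ! l'"
      using that by (auto simp: agree_def)
    moreover have "swap_adj k I' ! l = I' ! l'" "swap_adj k J' ! l' = J' ! l"
      using l k that by (auto simp: nth_swap_adj l'_def)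
    ultimately show "swap_adj k I' ! l = J' ! l"
      by simp
  qed
  have agree_swap: "agree (swap_adj k I) J \<longleftrightarrow> agree I (swap_adj k J)"
    using swap_agree[of I J] swap_agree[of J I] len by (auto simp: agree_def)
  have head: "swap_adj k I ! 0 = I ! 0" "swap_adj k J ! 0 = J ! 0"
    using k len by (auto simp: nth_swap_adj)
  have coeffs: "R_stay q k I = R_stay q k J" if "agree I J"
    using that k by (simp add: agree_def R_stay_def)
  have coeffs': "R_swap q k I = R_swap q k J" if "agree (swap_adj k I) J"
  proof -
    have km: "k - 1 < m" "k - 1 \<noteq> k" "k - 1 \<noteq> 0" "k \<noteq> 0"
      using k by auto
    note a = that[unfolded agree_def, rule_format]
    have "J ! (k - 1) = I ! k"
      using a[OF km(1,3)] km k len by (simp add: nth_swap_adj)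
    moreover have "J ! k = I ! (k - 1)"
      using a[OF k(2) km(4)] km k len by (simp add: nth_swap_adj)
    ultimately show ?thesis
      by (simp add: R_swap_def eq_commute)
  qed
  have k': "k < m" "1 \<le> k" using k by auto
  show "(Rcheck_at A n q m k \<otimes>\<^bsub>tens_alg A n m\<^esub> place1 A n m 1 X) (I, J)
    = (place1 A n m 1 X \<otimes>\<^bsub>tens_alg A n m\<^esub> Rcheck_at A n q m k) (I, J)"
    unfolding Rcheck_at_mult_entry[OF place IJ k'(2,1)]
      mult_Rcheck_at_entry[OF place IJ k'(2,1)]
      entry[OF IJ] entry[OF swap_adj_tidx[OF IJ(1) k(2)] IJ(2)] entry[OF IJ(1) swap_adj_tidx[OF IJ(2) k(2)]]
    by (simp add: head agree_swap[symmetric] coeffs coeffs')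
qed

end

section \<open>Amplification\<close>

text \<open>\<open>(u, v)\<close> splits the index set as a product; \<open>ampl\<close> is tensoring with the identity on the second factor.\<close>

definition ampl :: "'a calg \<Rightarrow> 't set \<Rightarrow> ('t \<Rightarrow> 's) \<Rightarrow> ('t \<Rightarrow> 'v) \<Rightarrow> ('s \<times> 's \<Rightarrow> 'a) \<Rightarrow> 't \<times> 't \<Rightarrow> 'a" where
  "ampl A T u v X = (\<lambda>(I, J)\<in>T \<times> T. if v I = v J then X (u I, u J) else \<zero>\<^bsub>A\<^esub>)"

text \<open>\<open>v\<close> labels the blocks and \<open>u\<close> identifies each block with
  \<open>S\<close>. In a product only the indices \<open>K\<close> in the block of \<open>I\<close>
  contribute, and reindexing by \<open>u\<close> turns their sum into the sum over
  \<open>S\<close>.\<close>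

lemma (in complex_algebra) ampl_hom:
  assumes T: "finite T" and S: "finite S" and bij: "\<And>I. I \<in> T \<Longrightarrow> bij_betw u {K \<in> T. v K = v I} S"
  shows "complex_algebra_hom (mat_alg A S) (mat_alg A T) (ampl A T u v)"
proof -
  have u: "u I \<in> S" if "I \<in> T" for I
    using bij_betwE[OF bij[OF that]] that by auto
  have entry: "ampl A T u v X (I, J) = (if v I = v J then X (u I, u J) else \<zero>)" if "I \<in> T" "J \<in> T" for X I J
    using that by (simp add: ampl_def)
  have closed: "ampl A T u v X \<in> carrier (mat_alg A T)" if "X \<in> carrier (mat_alg A S)" for X
    using that u unfolding mat_carrier by (auto simp: ampl_def)
  have mult: "ampl A T u v (X \<otimes>\<^bsub>mat_alg A S\<^esub> Y) = ampl A T u v X \<otimes>\<^bsub>mat_alg A T\<^esub> ampl A T u v Y"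
    if X: "X \<in> carrier (mat_alg A S)" and Y: "Y \<in> carrier (mat_alg A S)" for X Y
  proof (rule mat_eqI)
    fix I J assume IJ: "I \<in> T" "J \<in> T"
    have X': "X (u I, s) \<in> carrier A" if "s \<in> S" for s
      using X u[OF IJ(1)] that by auto
    have Y': "Y (s, u J) \<in> carrier A" if "s \<in> S" for s
      using Y u[OF IJ(2)] that by auto
    have inj: "inj_on u {K \<in> T. v K = v I}" and img: "u ` {K \<in> T. v K = v I} = S"
      using bij[OF IJ(1)] by (auto simp: bij_betw_def)
    have "(ampl A T u v X \<otimes>\<^bsub>mat_alg A T\<^esub> ampl A T u v Y) (I, J)
        = (\<Oplus>K\<in>T. if v K = v I then (if v I = v J then X (u I, u K) \<otimes> Y (u K, u J) else \<zero>) else \<zero>)"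
      unfolding mat_entry(1)[OF IJ] using IJ X' Y' u by (intro finsum_cong') (auto simp: entry)
    also have "\<dots> = (\<Oplus>K\<in>{K \<in> T. v K = v I}. if v I = v J then X (u I, u K) \<otimes> Y (u K, u J) else \<zero>)"
      using X' Y' u T by (intro add.finprod_mono_neutral_cong_right) auto
    also have "\<dots> = (\<Oplus>s\<in>u ` {K \<in> T. v K = v I}. if v I = v J then X (u I, s) \<otimes> Y (s, u J) else \<zero>)"
      using X' Y' u inj by (intro finsum_reindex[symmetric]) auto
    also have "\<dots> = ampl A T u v (X \<otimes>\<^bsub>mat_alg A S\<^esub> Y) (I, J)"
      using IJ u unfolding img by (simp add: entry mat_entry(1))
    finally show "ampl A T u v (X \<otimes>\<^bsub>mat_alg A S\<^esub> Y) (I, J) = (ampl A T u v X \<otimes>\<^bsub>mat_alg A T\<^esub> ampl A T u v Y) (I, J)"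
      by simp
  qed (use X Y closed in auto)
  have one: "ampl A T u v \<one>\<^bsub>mat_alg A S\<^esub> = \<one>\<^bsub>mat_alg A T\<^esub>"
  proof (rule mat_eqI)
    fix I J assume IJ: "I \<in> T" "J \<in> T"
    have "I = J" if "v I = v J" "u I = u J"
      using bij[OF IJ(1)] IJ that by (auto simp: bij_betw_def inj_on_def)
    then show "ampl A T u v \<one>\<^bsub>mat_alg A S\<^esub> (I, J) = \<one>\<^bsub>mat_alg A T\<^esub> (I, J)"
      using IJ u by (auto simp: entry)
  qed (use closed in auto)
  show ?thesis
  proof (intro complex_algebra_hom.intro complex_algebra_hom_axioms.intro calg_homI)
    show "ampl A T u v (X \<oplus>\<^bsub>mat_alg A S\<^esub> Y) = ampl A T u v X \<oplus>\<^bsub>mat_alg A T\<^esub> ampl A T u v Y"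
      if "X \<in> carrier (mat_alg A S)" "Y \<in> carrier (mat_alg A S)" for X Y
      using that closed u by (intro mat_eqI[of _ A T]) (auto simp: entry)
    show "ampl A T u v (c \<odot>\<^bsub>mat_alg A S\<^esub> X) = c \<odot>\<^bsub>mat_alg A T\<^esub> ampl A T u v X"
      if "X \<in> carrier (mat_alg A S)" for c X
      using that closed u by (intro mat_eqI[of _ A T]) (auto simp: entry)
  qed (use mult one closed T S complex_algebra_mat_alg in auto)
qed

lemma bij_betw_hd_tidx:
  assumes "I \<in> tidx n m" "1 \<le> m"
  shows "bij_betw (\<lambda>K. K ! 0) {K \<in> tidx n m. tl K = tl I} {1..n}"
proof (rule bij_betwI[where g = "\<lambda>a. a # tl I"])
  show "(\<lambda>K. K ! 0) \<in> {K \<in> tidx n m. tl K = tl I} \<rightarrow> {1..n}"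
    using assms nth_tidx[of _ n m 0] by auto
  show "(\<lambda>a. a # tl I) \<in> {1..n} \<rightarrow> {K \<in> tidx n m. tl K = tl I}"
    using assms by (cases I) (auto simp: tidx_def)
  show "(K ! 0) # tl I = K" if "K \<in> {K \<in> tidx n m. tl K = tl I}" for K
    using that assms by (cases K) (auto simp: tidx_def)
qed auto

lemma bij_betw_take2_tidx:
  assumes "I \<in> tidx n m" "2 \<le> m"
  shows "bij_betw (take 2) {K \<in> tidx n m. drop 2 K = drop 2 I} (tidx n 2)"
proof (rule bij_betwI[where g = "\<lambda>a. a @ drop 2 I"])
  show "take 2 \<in> {K \<in> tidx n m. drop 2 K = drop 2 I} \<rightarrow> tidx n 2"
    using assms by (auto simp: tidx_def dest: in_set_takeD)
  show "(\<lambda>a. a @ drop 2 I) \<in> tidx n 2 \<rightarrow> {K \<in> tidx n m. drop 2 K = drop 2 I}"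
    using assms set_drop_subset[of 2 I] by (auto simp: tidx_def subset_iff)
  show "take 2 K @ drop 2 I = K" if "K \<in> {K \<in> tidx n m. drop 2 K = drop 2 I}" for K
    using that by (metis (mono_tags, lifting) append_take_drop_id mem_Collect_eq)
  show "take 2 (a @ drop 2 I) = a" if "a \<in> tidx n 2" for a
    using that by (simp add: length_tidx)
qed

lemma agree_drop:
  assumes "length I = m" "length J = m"
  shows "drop r I = drop r J \<longleftrightarrow> (\<forall>l<m. r \<le> l \<longrightarrow> I ! l = J ! l)"
proof
  assume d: "drop r I = drop r J"
  show "\<forall>l<m. r \<le> l \<longrightarrow> I ! l = J ! l"
  proof (intro allI impI)
    fix l assume "l < m" "r \<le> l"
    then show "I ! l = J ! l"
      using arg_cong[OF d, of "\<lambda>xs. xs ! (l - r)"] assms by simp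
  qed
next
  assume "\<forall>l<m. r \<le> l \<longrightarrow> I ! l = J ! l"
  then show "drop r I = drop r J"
    using assms by (intro nth_equalityI) auto
qed

lemma place1_eq_ampl:
  "place1 A n m 1 X = ampl A (tidx n m) (\<lambda>K. K ! 0) tl X"
proof (rule ext, clarify)
  fix I J :: "nat list"
  have "(\<forall>l<m. l \<noteq> 0 \<longrightarrow> I ! l = J ! l) \<longleftrightarrow> tl I = tl J" if "I \<in> tidx n m" "J \<in> tidx n m"
    using agree_drop[of I m J 1] that by (simp add: length_tidx drop_Suc Suc_le_eq)
  then show "place1 A n m 1 X (I, J) = ampl A (tidx n m) (\<lambda>K. K ! 0) tl X (I, J)"
    by (auto simp: place1_def ampl_def)
qed

text \<open>The Weyl relations are imposed on two tensor factors. Seeing \<open>place1\<close> and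
  \<open>Rcheck_at\<close> as amplified from two factors lets those relations be used on
  \<open>m\<close> factors.\<close>

lemma place1_eq_ampl2:
  assumes "2 \<le> m"
  shows "place1 A n m 1 X = ampl A (tidx n m) (take 2) (drop 2) (place1 A n 2 1 X)"
proof (rule ext, clarify)
  fix I J :: "nat list"
  consider "I \<in> tidx n m" "J \<in> tidx n m" | "I \<notin> tidx n m \<or> J \<notin> tidx n m" by blast
  then show "place1 A n m 1 X (I, J) = ampl A (tidx n m) (take 2) (drop 2) (place1 A n 2 1 X) (I, J)"
  proof cases
    case 1
    then have len: "length I = m" "length J = m" "take 2 I \<in> tidx n 2" "take 2 J \<in> tidx n 2"
      using assms by (auto simp: tidx_def dest: in_set_takeD)
    have "(\<forall>l<m. l \<noteq> 0 \<longrightarrow> I ! l = J ! l) \<longleftrightarrow> (\<forall>l<m. 2 \<le> l \<longrightarrow> I ! l = J ! l) \<and> I ! 1 = J ! 1"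
      using assms by (auto simp: numeral_2_eq_2 Suc_le_eq) (metis One_nat_def Suc_lessI neq0_conv)
    then show ?thesis
      using 1 len by (auto simp: place1_def ampl_def agree_drop less_2_cases_iff)
  qed (auto simp: place1_def ampl_def)
qed

lemma (in complex_algebra) Rcheck_at_eq_ampl:
  assumes "2 \<le> m"
  shows "Rcheck_at A n q m 1 = ampl A (tidx n m) (take 2) (drop 2) (Rcheck_at A n q 2 1)"
proof (rule ext, clarify)
  fix I J :: "nat list"
  consider "I \<in> tidx n m" "J \<in> tidx n m" | "I \<notin> tidx n m \<or> J \<notin> tidx n m" by blast
  then show "Rcheck_at A n q m 1 (I, J) = ampl A (tidx n m) (take 2) (drop 2) (Rcheck_at A n q 2 1) (I, J)"
  proof cases
    case 1
    then have len: "length I = m" "length J = m" "take 2 I \<in> tidx n 2" "take 2 J \<in> tidx n 2"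
      using assms by (auto simp: tidx_def dest: in_set_takeD)
    have "(\<forall>l<m. l \<noteq> 1 - 1 \<and> l \<noteq> 1 \<longrightarrow> I ! l = J ! l) \<longleftrightarrow> (\<forall>l<m. 2 \<le> l \<longrightarrow> I ! l = J ! l)"
      by (auto simp: numeral_2_eq_2 Suc_le_eq)
    moreover have "\<forall>l<2. l \<noteq> 1 - 1 \<and> l \<noteq> 1 \<longrightarrow> (take 2 I) ! l = (take 2 J) ! l"
      by (auto simp: less_2_cases_iff)
    ultimately have "place2 n m 1 (Rcheck n q) (I, J)
        = (if drop 2 I = drop 2 J then place2 n 2 1 (Rcheck n q) (take 2 I, take 2 J) else 0)"
      using 1 len by (auto simp: place2_def agree_drop)
    then show ?thesis
      using 1 len by (simp add: Rcheck_at_def scal_mat_def ampl_def)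
  qed (auto simp: Rcheck_at_def scal_mat_def ampl_def)
qed

section \<open>Overlined elements of the Weyl algebra\<close>

text \<open>Products are kept nested to the right, where an equation for
  \<open>a \<otimes> b\<close> matches only at the end of a product; this form applies in the
  middle.\<close>

lemma (in monoid) mult_lift:
  assumes "a \<otimes> b = c" "a \<in> carrier G" "b \<in> carrier G" "x \<in> carrier G"
  shows "a \<otimes> (b \<otimes> x) = c \<otimes> x"
  using assms by (simp add: m_assoc[symmetric])

lemma (in monoid) commute_mult:
  assumes "x \<otimes> a = a \<otimes> x" "x \<otimes> b = b \<otimes> x" "x \<in> carrier G" "a \<in> carrier G" "b \<in> carrier G"
  shows "x \<otimes> (a \<otimes> b) = (a \<otimes> b) \<otimes> x"
  using assms by (metis m_assoc)

text \<open>\<open>N\<close> is the number of tensor factors, so the relations concern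
  \<open>R 1\<close> up to \<open>R (N - 1)\<close>. Membership in the carrier is assumed for every
  \<open>k\<close>, which frees products over lists from range conditions.\<close>

locale hecke_system = complex_algebra B for B :: "'b calg" (structure) +
  fixes R :: "nat \<Rightarrow> 'b" and N :: nat and q :: complex
  assumes R_closed [simp, intro]: "R k \<in> carrier B"
    and quadratic: "1 \<le> k \<Longrightarrow> k < N \<Longrightarrow> R k \<otimes> R k = (q - inverse q) \<odot> R k \<oplus> \<one>"
    and braid: "1 \<le> k \<Longrightarrow> k + 1 < N \<Longrightarrow> R k \<otimes> (R (k + 1) \<otimes> R k) = R (k + 1) \<otimes> (R k \<otimes> R (k + 1))"
    and far_commute: "1 \<le> k \<Longrightarrow> k + 1 < l \<Longrightarrow> l < N \<Longrightarrow> R k \<otimes> R l = R l \<otimes> R k"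
begin

text \<open>The inverse of \<open>R k\<close> for \<open>1 \<le> k < N\<close>, given as a
  polynomial in \<open>R k\<close>: it is total, and whatever commutes with \<open>R k\<close>
  commutes with it at once.\<close>

definition R' :: "nat \<Rightarrow> 'b" where
  "R' k = R k \<oplus> (inverse q - q) \<odot> \<one>"

lemma R'_closed [simp, intro]: "R' k \<in> carrier B"
  by (simp add: R'_def)

lemma R_R':
  assumes "1 \<le> k" "k < N"
  shows "R k \<otimes> R' k = \<one>" "R' k \<otimes> R k = \<one>"
proof -
  have "(q - inverse q) \<odot> R k \<oplus> \<one> \<oplus> (inverse q - q) \<odot> R k = \<one> \<oplus> ((q - inverse q) + (inverse q - q)) \<odot> R k"
    unfolding smult_l_distr[OF R_closed] by (simp add: add.m_ac)
  then have "(q - inverse q) \<odot> R k \<oplus> \<one> \<oplus> (inverse q - q) \<odot> R k = \<one>"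
    by simp
  then show "R k \<otimes> R' k = \<one>" "R' k \<otimes> R k = \<one>"
    using quadratic[OF assms] by (simp_all add: R'_def r_distr l_distr smult_mult_left smult_mult_right)
qed

lemma R_R'_lift:
  assumes "1 \<le> k" "k < N" "x \<in> carrier B"
  shows "R k \<otimes> (R' k \<otimes> x) = x" "R' k \<otimes> (R k \<otimes> x) = x"
  using assms by (simp_all add: mult_lift R_R')

lemma commute_R':
  assumes "R k \<otimes> x = x \<otimes> R k" "x \<in> carrier B"
  shows "R' k \<otimes> x = x \<otimes> R' k"
  using assms by (simp add: R'_def l_distr r_distr smult_mult_left smult_mult_right)

lemma conj_R':
  assumes u: "u \<otimes> u' = \<one>" "u' \<otimes> u = \<one>" and closed: "u \<in> carrier B" "u' \<in> carrier B" "x \<in> carrier B" "y \<in> carrier B"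
    and eq: "x \<otimes> u = u \<otimes> y"
  shows "u' \<otimes> x = y \<otimes> u'"
proof -
  have "u' \<otimes> x = u' \<otimes> (x \<otimes> (u \<otimes> u'))"
    using u closed by simp
  also have "\<dots> = u' \<otimes> (x \<otimes> u) \<otimes> u'"
    using closed by (simp add: m_assoc)
  also have "\<dots> = (u' \<otimes> u) \<otimes> (y \<otimes> u')"
    unfolding eq using closed by (simp add: m_assoc)
  finally show ?thesis
    using u closed by simp
qed

lemma far_commute_sym:
  assumes "1 \<le> k" "1 \<le> l" "k + 1 < l \<or> l + 1 < k" "k < N" "l < N"
  shows "R k \<otimes> R l = R l \<otimes> R k"
  using far_commute[of k l] far_commute[of l k] assms by auto

text \<open>The braid relation says that \<open>u = R (k + 1) \<otimes> R k\<close> intertwines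
  \<open>R k\<close> and \<open>R (k + 1)\<close>; the first claim is the same for the inverse of
  \<open>u\<close>. Multiplying it by \<open>R' (k + 1)\<close> on the left and \<open>R' k\<close>
  on the right gives the second.\<close>

lemma braid_R':
  assumes "1 \<le> k" "k + 1 < N"
  shows "R (k + 1) \<otimes> (R' k \<otimes> R' (k + 1)) = R' k \<otimes> (R' (k + 1) \<otimes> R k)"
    and "R' k \<otimes> (R' (k + 1) \<otimes> R' k) = R' (k + 1) \<otimes> (R' k \<otimes> R' (k + 1))"
proof -
  have k: "1 \<le> k" "k < N" "1 \<le> k + 1" "k + 1 < N" using assms by auto
  let ?u = "R (k + 1) \<otimes> R k" and ?u' = "R' k \<otimes> R' (k + 1)"
  have u: "?u \<otimes> ?u' = \<one>" "?u' \<otimes> ?u = \<one>"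
    using k by (simp_all add: m_assoc R_R'_lift R_R')
  have "R k \<otimes> ?u = ?u \<otimes> R (k + 1)"
    using braid[OF assms] by (simp add: m_assoc)
  from conj_R'[OF u _ _ _ _ this] show *: "R (k + 1) \<otimes> (R' k \<otimes> R' (k + 1)) = R' k \<otimes> (R' (k + 1) \<otimes> R k)"
    by (simp add: m_assoc)
  have "R' (k + 1) \<otimes> ((R (k + 1) \<otimes> (R' k \<otimes> R' (k + 1))) \<otimes> R' k) = R' (k + 1) \<otimes> ((R' k \<otimes> (R' (k + 1) \<otimes> R k)) \<otimes> R' k)"
    unfolding * ..
  then show "R' k \<otimes> (R' (k + 1) \<otimes> R' k) = R' (k + 1) \<otimes> (R' k \<otimes> R' (k + 1))"
    using k by (simp add: m_assoc R_R'_lift R_R')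
qed

definition over :: "'b \<Rightarrow> nat \<Rightarrow> 'b" where
  "over X k = lprod B (map R (rev [1..<k]) @ [X] @ map R' [1..<k])"

lemma over_closed [simp, intro]: "X \<in> carrier B \<Longrightarrow> over X k \<in> carrier B"
  unfolding over_def by (intro lprod_closed) auto

lemma over_1: "X \<in> carrier B \<Longrightarrow> over X (Suc 0) = X"
  by (simp add: over_def)

lemma over_Suc:
  assumes "X \<in> carrier B" "1 \<le> k"
  shows "over X (Suc k) = R k \<otimes> (over X k \<otimes> R' k)"
proof -
  have "over X (Suc k) = lprod B ([R k] @ (map R (rev [1..<k]) @ [X] @ map R' [1..<k]) @ [R' k])"
    using assms by (simp add: over_def)
  also have "\<dots> = R k \<otimes> (over X k \<otimes> R' k)"
    unfolding over_def using assms by (intro lprod_surround) auto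
  finally show ?thesis .
qed

text \<open>Overlining is a conjugation, hence multiplicative and trivial on scalars. The shape is
  that of \<open>M D - z\<close>.\<close>

lemma over_mult_add:
  assumes "X \<in> carrier B" "Y \<in> carrier B" "1 \<le> k" "k \<le> N"
  shows "over (X \<otimes> Y \<oplus> c \<odot> \<one>) k = over X k \<otimes> over Y k \<oplus> c \<odot> \<one>"
  using assms(3,4)
proof (induction k rule: nat_induct_at_least)
  case base
  then show ?case using assms(1,2) by (simp add: over_1)
next
  case (Suc k)
  with assms(1,2) show ?case
    by (simp add: over_Suc l_distr r_distr m_assoc smult_mult_left smult_mult_right R_R' R_R'_lift)
qed

text \<open>The abstract trace of sitting in the first tensor factor: commuting with every
  \<open>R k\<close> that acts on later factors only.\<close>

definition local1 :: "'b \<Rightarrow> bool" where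
  "local1 X \<longleftrightarrow> X \<in> carrier B \<and> (\<forall>k. 2 \<le> k \<longrightarrow> k < N \<longrightarrow> R k \<otimes> X = X \<otimes> R k)"

lemma local1_closed [simp]: "local1 X \<Longrightarrow> X \<in> carrier B"
  by (simp add: local1_def)

text \<open>\<open>over X k\<close> involves \<open>X\<close> and the \<open>R j\<close> with
  \<open>j < k\<close> only, and all of them commute with \<open>R i\<close> when
  \<open>k < i\<close>.\<close>

lemma over_commute_above:
  assumes X: "local1 X" and i: "i < N" and "1 \<le> k" "k < i"
  shows "R i \<otimes> over X k = over X k \<otimes> R i"
  using assms(3,4)
proof (induction k rule: nat_induct_at_least)
  case base
  then show ?case using X i by (auto simp: over_1 local1_def)
next
  case (Suc k)
  have "R i \<otimes> R k = R k \<otimes> R i"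
    using far_commute_sym[of i k] Suc i by auto
  moreover from this have "R i \<otimes> R' k = R' k \<otimes> R i"
    using commute_R'[of k "R i"] by simp
  ultimately show ?case
    using Suc X by (auto simp: over_Suc intro!: commute_mult)
qed

text \<open>The critical case is \<open>k = i + 2\<close>. The braid relation carries
  \<open>R i\<close> through \<open>R (i + 1) \<otimes> R i\<close>, where it becomes
  \<open>R (i + 1)\<close>; this commutes with \<open>over X i\<close>, and the braid relation for
  the inverses on the other side turns it back into \<open>R i\<close>. Further conjugations use
  generators far from \<open>i\<close>.\<close>

lemma over_commute_below:
  assumes X: "local1 X" and i: "1 \<le> i" and "i + 2 \<le> k" "k \<le> N"
  shows "R i \<otimes> over X k = over X k \<otimes> R i"
  using assms(3,4)
proof (induction k rule: nat_induct_at_least)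
  case base
  let ?Y = "over X i"
  have cl: "?Y \<in> carrier B" using X by auto
  have Y: "R (i + 1) \<otimes> ?Y = ?Y \<otimes> R (i + 1)"
    using X i base by (intro over_commute_above) auto
  have k: "1 \<le> i" "i + 1 < N" using i base by auto
  have over: "over X (i + 2) = R (i + 1) \<otimes> (R i \<otimes> (?Y \<otimes> (R' i \<otimes> R' (i + 1))))"
    using X i by (simp add: over_Suc m_assoc)
  have "R i \<otimes> over X (i + 2) = (R i \<otimes> (R (i + 1) \<otimes> R i)) \<otimes> (?Y \<otimes> (R' i \<otimes> R' (i + 1)))"
    unfolding over using cl by (simp add: m_assoc)
  also have "\<dots> = R (i + 1) \<otimes> (R i \<otimes> ((R (i + 1) \<otimes> ?Y) \<otimes> (R' i \<otimes> R' (i + 1))))"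
    unfolding braid[OF k] using cl by (simp add: m_assoc)
  also have "\<dots> = R (i + 1) \<otimes> (R i \<otimes> (?Y \<otimes> (R (i + 1) \<otimes> (R' i \<otimes> R' (i + 1)))))"
    unfolding Y using cl by (simp add: m_assoc)
  also have "\<dots> = over X (i + 2) \<otimes> R i"
    unfolding braid_R'(1)[OF k] over using cl by (simp add: m_assoc)
  finally show ?case .
next
  case (Suc k)
  have "R i \<otimes> R k = R k \<otimes> R i"
    using far_commute_sym[of i k] Suc i by auto
  moreover from this have "R i \<otimes> R' k = R' k \<otimes> R i"
    using commute_R'[of k "R i"] by simp
  ultimately show ?case
    using Suc X by (auto simp: over_Suc intro!: commute_mult)
qed

definition jm :: "nat \<Rightarrow> 'b" where
  "jm k = lprod B (map R (rev [1..<k] @ [1..<k]))"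

text \<open>The word of a Jucys-Murphy element is a palindrome, so inverting each letter inverts the
  product.\<close>

definition jm' :: "nat \<Rightarrow> 'b" where
  "jm' k = lprod B (map R' (rev [1..<k] @ [1..<k]))"

lemma jm_closed [simp, intro]: "jm k \<in> carrier B" "jm' k \<in> carrier B"
  unfolding jm_def jm'_def by (auto intro!: lprod_closed)

lemma jm_1: "jm (Suc 0) = \<one>" "jm' (Suc 0) = \<one>"
  by (simp_all add: jm_def jm'_def)

lemma jm_Suc:
  assumes "1 \<le> k"
  shows "jm (Suc k) = R k \<otimes> (jm k \<otimes> R k)" "jm' (Suc k) = R' k \<otimes> (jm' k \<otimes> R' k)"
proof -
  have "jm (Suc k) = lprod B ([R k] @ map R (rev [1..<k] @ [1..<k]) @ [R k])"
    using assms by (simp add: jm_def)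
  also have "\<dots> = R k \<otimes> (jm k \<otimes> R k)"
    unfolding jm_def using assms by (intro lprod_surround) auto
  finally show "jm (Suc k) = R k \<otimes> (jm k \<otimes> R k)" .
  have "jm' (Suc k) = lprod B ([R' k] @ map R' (rev [1..<k] @ [1..<k]) @ [R' k])"
    using assms by (simp add: jm'_def)
  also have "\<dots> = R' k \<otimes> (jm' k \<otimes> R' k)"
    unfolding jm'_def using assms by (intro lprod_surround) auto
  finally show "jm' (Suc k) = R' k \<otimes> (jm' k \<otimes> R' k)" .
qed

lemma jm'_jm:
  assumes "1 \<le> k" "k \<le> N"
  shows "jm' k \<otimes> jm k = \<one>"
  using assms
proof (induction k rule: nat_induct_at_least)
  case (Suc k)
  have "jm' (Suc k) \<otimes> jm (Suc k) = R' k \<otimes> (jm' k \<otimes> jm k \<otimes> R k)"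
    using Suc.hyps Suc.prems by (simp add: jm_Suc m_assoc R_R'_lift)
  also have "\<dots> = \<one>"
    using Suc by (simp add: R_R')
  finally show ?case .
qed (simp add: jm_1)

text \<open>\<open>jm k\<close> is a word in the \<open>R i\<close> with \<open>i < k\<close>, so
  \<open>i + 2 \<le> j\<close> and each letter commutes with \<open>over X j\<close>.\<close>

lemma jm_commute_over:
  assumes X: "local1 X" and "k < j" "j \<le> N" "1 \<le> k"
  shows "jm k \<otimes> over X j = over X j \<otimes> jm k"
  using assms(4,2)
proof (induction k rule: nat_induct_at_least)
  case base
  then show ?case using X by (simp add: jm_1)
next
  case (Suc k)
  have "over X j \<otimes> R k = R k \<otimes> over X j"
    using over_commute_below[OF X, of k j] Suc assms(3) by auto
  moreover have "over X j \<otimes> jm k = jm k \<otimes> over X j"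
    using Suc by simp
  ultimately have "over X j \<otimes> (R k \<otimes> (jm k \<otimes> R k)) = R k \<otimes> (jm k \<otimes> R k) \<otimes> over X j"
    using X by (intro commute_mult) auto
  then show ?case
    using Suc by (simp add: jm_Suc)
qed

end

text \<open>The relations \<open>DD\<close> and \<open>DM\<close> are guarded by
  \<open>2 \<le> N\<close> because they involve \<open>R 1\<close>, which acts on two tensor
  factors. With a single factor no relation is available.\<close>

locale weyl_system = hecke_system B R N q
  for B :: "'b calg" (structure) and R :: "nat \<Rightarrow> 'b" and N :: nat and q :: complex +
  fixes M D :: 'b and z :: complex
  assumes z: "z * (q - inverse q) = 1" and M: "local1 M" and D: "local1 D"
    and DD: "2 \<le> N \<Longrightarrow> R' 1 \<otimes> (D \<otimes> (R' 1 \<otimes> D)) = D \<otimes> (R' 1 \<otimes> (D \<otimes> R' 1))"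
    and DM: "2 \<le> N \<Longrightarrow> D \<otimes> (R 1 \<otimes> (M \<otimes> R 1)) = R 1 \<otimes> (M \<otimes> (R' 1 \<otimes> D)) \<oplus> R 1"
begin

lemma MD_closed [simp, intro]: "M \<in> carrier B" "D \<in> carrier B"
  using M D by auto

definition L :: 'b where
  "L = M \<otimes> D \<oplus> (- z) \<odot> \<one>"

lemma L_closed [simp, intro]: "L \<in> carrier B"
  by (simp add: L_def)

lemma local1_L: "local1 L"
  unfolding local1_def
proof (intro conjI allI impI)
  fix k assume "2 \<le> k" "k < N"
  then have "R k \<otimes> M = M \<otimes> R k" "R k \<otimes> D = D \<otimes> R k"
    using M D by (auto simp: local1_def)
  then have "R k \<otimes> (M \<otimes> D) = (M \<otimes> D) \<otimes> R k"
    by (intro commute_mult) auto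
  then show "R k \<otimes> L = L \<otimes> R k"
    by (simp add: L_def l_distr r_distr smult_mult_left smult_mult_right)
qed simp

lemma over_L:
  assumes "1 \<le> k" "k \<le> N"
  shows "over L k = over M k \<otimes> over D k \<oplus> (- z) \<odot> \<one>"
  unfolding L_def using assms by (intro over_mult_add) auto

lemma D_L_base:
  assumes "2 \<le> N"
  shows "D \<otimes> (R 1 \<otimes> (L \<otimes> R 1)) = R 1 \<otimes> (L \<otimes> (R' 1 \<otimes> D))"
proof -
  have r: "1 \<le> (1::nat)" "1 < N" using assms by auto
  note RR = R_R'[OF r] R_R'_lift[OF r]
  \<comment> \<open>\<open>DM\<close> is solved for \<open>D R M\<close> by cancelling the last
    \<open>R\<close>, so that \<open>D\<close> can be appended to \<open>M\<close> inside
    \<open>L\<close>.\<close>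
  have "D \<otimes> (R 1 \<otimes> M) = (D \<otimes> (R 1 \<otimes> (M \<otimes> R 1))) \<otimes> R' 1"
    by (simp add: m_assoc RR[unfolded One_nat_def])
  also have "\<dots> = R 1 \<otimes> (M \<otimes> (R' 1 \<otimes> (D \<otimes> R' 1))) \<oplus> \<one>"
    unfolding DM[OF assms] by (simp add: l_distr m_assoc RR[unfolded One_nat_def])
  finally have DRM: "D \<otimes> (R 1 \<otimes> M) = R 1 \<otimes> (M \<otimes> (R' 1 \<otimes> (D \<otimes> R' 1))) \<oplus> \<one>" .
  \<comment> \<open>\<open>DD\<close> times \<open>R 1\<close> on the right: the string of two
    \<open>D\<close> left by the previous identity is brought back to \<open>D R' D\<close>.\<close>
  have DR'D: "R' 1 \<otimes> (D \<otimes> (R' 1 \<otimes> (D \<otimes> R 1))) = D \<otimes> (R' 1 \<otimes> D)"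
    using arg_cong[OF DD[OF assms], of "\<lambda>x. x \<otimes> R 1"] by (simp add: m_assoc RR[unfolded One_nat_def])
  have "D \<otimes> (R 1 \<otimes> ((M \<otimes> D) \<otimes> R 1)) = (D \<otimes> (R 1 \<otimes> M)) \<otimes> (D \<otimes> R 1)"
    by (simp add: m_assoc)
  also have "\<dots> = R 1 \<otimes> (M \<otimes> (R' 1 \<otimes> (D \<otimes> (R' 1 \<otimes> (D \<otimes> R 1))))) \<oplus> D \<otimes> R 1"
    unfolding DRM by (simp add: l_distr m_assoc)
  also have "\<dots> = R 1 \<otimes> (M \<otimes> (D \<otimes> (R' 1 \<otimes> D))) \<oplus> D \<otimes> R 1"
    unfolding DR'D ..
  finally have 1: "D \<otimes> (R 1 \<otimes> ((M \<otimes> D) \<otimes> R 1)) = R 1 \<otimes> (M \<otimes> (D \<otimes> (R' 1 \<otimes> D))) \<oplus> D \<otimes> R 1" .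
  \<comment> \<open>The value of \<open>z\<close> enters here: the coefficient of \<open>D R\<close>
    becomes -1, which cancels the surplus \<open>D R\<close> in equation \<open>1\<close>.\<close>
  have "(- z) \<odot> (D \<otimes> (R 1 \<otimes> R 1)) = (- (z * (q - inverse q))) \<odot> (D \<otimes> R 1) \<oplus> (- z) \<odot> D"
    unfolding quadratic[OF r] by (simp add: r_distr smult_r_distr smult_smult smult_mult_right)
  then have 2: "(- z) \<odot> (D \<otimes> (R 1 \<otimes> R 1)) = \<ominus> (D \<otimes> R 1) \<oplus> (- z) \<odot> D"
    unfolding z by (simp add: smult_minus_1)
  have "D \<otimes> (R 1 \<otimes> (L \<otimes> R 1)) = D \<otimes> (R 1 \<otimes> ((M \<otimes> D) \<otimes> R 1)) \<oplus> (- z) \<odot> (D \<otimes> (R 1 \<otimes> R 1))"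
    by (simp add: L_def l_distr r_distr smult_mult_left smult_mult_right)
  also have "\<dots> = R 1 \<otimes> (M \<otimes> (D \<otimes> (R' 1 \<otimes> D))) \<oplus> (- z) \<odot> D"
    unfolding 1 2 by (simp add: a_assoc r_neg2)
  \<comment> \<open>The remaining \<open>- z D\<close> equals \<open>R (- z) R' D\<close>, which is
    the scalar part of \<open>L\<close> in the target expression.\<close>
  also have "\<dots> = R 1 \<otimes> (L \<otimes> (R' 1 \<otimes> D))"
    by (simp add: L_def l_distr r_distr smult_mult_left smult_mult_right m_assoc RR[unfolded One_nat_def])
  finally show ?thesis .
qed

text \<open>Passing from \<open>k\<close> to \<open>k + 1\<close> is conjugation:
  \<open>over D k\<close> commutes with \<open>R (k + 1)\<close>, and \<open>over L (k + 2)\<close>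
  with \<open>R k\<close>. The induction hypothesis can therefore be used inside, and only a word in
  the generators is left to simplify.\<close>

lemma D_L_adjacent:
  assumes "1 \<le> k" "k < N"
  shows "over D k \<otimes> over L (Suc k) = over L (Suc k) \<otimes> (over D k \<otimes> (R' k \<otimes> R' k))"
  using assms
proof (induction k rule: nat_induct_at_least)
  case base
  then have r: "1 \<le> (1::nat)" "1 < N" and N: "2 \<le> N" by auto
  note RR = R_R'[OF r, unfolded One_nat_def] R_R'_lift[OF r, unfolded One_nat_def]
  have "D \<otimes> (R 1 \<otimes> (L \<otimes> R' 1)) = (D \<otimes> (R 1 \<otimes> (L \<otimes> R 1))) \<otimes> (R' 1 \<otimes> R' 1)"
    by (simp add: m_assoc RR)
  also have "\<dots> = (R 1 \<otimes> (L \<otimes> R' 1)) \<otimes> (D \<otimes> (R' 1 \<otimes> R' 1))"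
    unfolding D_L_base[OF N] by (simp add: m_assoc)
  finally show ?case
    using base by (simp add: over_Suc over_1)
next
  case (Suc k)
  let ?D = "over D k" and ?L = "over L (Suc k)" and ?L2 = "over L (Suc (Suc k))"
  have k: "1 \<le> k" "k < N" "1 \<le> k + 1" "k + 1 < N" using Suc by auto
  have L2: "?L2 = R (Suc k) \<otimes> (?L \<otimes> R' (Suc k))"
    using over_Suc[of L "Suc k"] by simp
  have RD: "R (Suc k) \<otimes> ?D = ?D \<otimes> R (Suc k)"
    using D Suc by (intro over_commute_above) auto
  have RL: "R k \<otimes> ?L2 = ?L2 \<otimes> R k"
    using local1_L Suc by (intro over_commute_below) auto
  have R'L: "R' k \<otimes> ?L2 = ?L2 \<otimes> R' k"
    using RL by (intro commute_R') auto
  have RL2: "R (Suc k) \<otimes> ?L = ?L2 \<otimes> R (Suc k)"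
    unfolding L2 using k by (simp add: m_assoc R_R')
  have IH: "?D \<otimes> ?L = ?L \<otimes> (?D \<otimes> (R' k \<otimes> R' k))"
    using Suc by simp
  have "?D \<otimes> ?L2 = (?D \<otimes> R (Suc k)) \<otimes> (?L \<otimes> R' (Suc k))"
    unfolding L2 by (simp add: m_assoc)
  also have "\<dots> = R (Suc k) \<otimes> ((?D \<otimes> ?L) \<otimes> R' (Suc k))"
    unfolding RD[symmetric] by (simp add: m_assoc)
  also have "\<dots> = (R (Suc k) \<otimes> ?L) \<otimes> (?D \<otimes> (R' k \<otimes> (R' k \<otimes> R' (Suc k))))"
    unfolding IH by (simp add: m_assoc)
  also have "\<dots> = ?L2 \<otimes> ((R (Suc k) \<otimes> ?D) \<otimes> (R' k \<otimes> (R' k \<otimes> R' (Suc k))))"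
    unfolding RL2 by (simp add: m_assoc)
  also have "\<dots> = ?L2 \<otimes> (?D \<otimes> (R (Suc k) \<otimes> (R' k \<otimes> (R' k \<otimes> R' (Suc k)))))"
    unfolding RD by (simp add: m_assoc)
  finally have DL2: "?D \<otimes> ?L2 = \<dots>" .
  \<comment> \<open>A pure braid group identity: the inverse square of \<open>R k\<close> conjugated
    by \<open>R (k + 1)\<close> equals the inverse square of \<open>R (k + 1)\<close> conjugated by
    the inverse of \<open>R k\<close>.\<close>
  have "R (Suc k) \<otimes> (R' k \<otimes> (R' k \<otimes> (R' (Suc k) \<otimes> R' k)))
      = (R (Suc k) \<otimes> (R' k \<otimes> R' (Suc k))) \<otimes> (R' k \<otimes> R' (Suc k))"
    using braid_R'(2)[OF k(1,4)] by (simp add: m_assoc)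
  also have "\<dots> = R' k \<otimes> (R' (Suc k) \<otimes> R' (Suc k))"
    using braid_R'(1)[OF k(1,4)] k by (simp add: m_assoc R_R'_lift)
  finally have RRR: "R (Suc k) \<otimes> (R' k \<otimes> (R' k \<otimes> (R' (Suc k) \<otimes> R' k))) = R' k \<otimes> (R' (Suc k) \<otimes> R' (Suc k))" .
  have "over D (Suc k) \<otimes> ?L2 = R k \<otimes> (?D \<otimes> (R' k \<otimes> ?L2))"
    using Suc by (simp add: over_Suc[of D] m_assoc)
  also have "\<dots> = R k \<otimes> ((?D \<otimes> ?L2) \<otimes> R' k)"
    unfolding R'L by (simp add: m_assoc)
  also have "\<dots> = (R k \<otimes> ?L2) \<otimes> (?D \<otimes> (R (Suc k) \<otimes> (R' k \<otimes> (R' k \<otimes> (R' (Suc k) \<otimes> R' k)))))"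
    unfolding DL2 by (simp add: m_assoc)
  also have "\<dots> = ?L2 \<otimes> (R k \<otimes> (?D \<otimes> (R' k \<otimes> (R' (Suc k) \<otimes> R' (Suc k)))))"
    unfolding RRR RL by (simp add: m_assoc)
  also have "\<dots> = ?L2 \<otimes> (over D (Suc k) \<otimes> (R' (Suc k) \<otimes> R' (Suc k)))"
    using Suc by (simp add: over_Suc[of D] m_assoc)
  finally show ?case .
qed

text \<open>The product descends from \<open>k - 1\<close> to 1, without the index \<open>k\<close>;
  the full product on \<open>m\<close> factors is thus \<open>Dprod (Suc m)\<close>.\<close>

definition Dprod :: "nat \<Rightarrow> 'b" where
  "Dprod k = lprod B (map (over D) (rev [1..<k]))"

lemma Dprod_closed [simp, intro]: "Dprod k \<in> carrier B"
  unfolding Dprod_def by (intro lprod_closed) auto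

lemma Dprod_1: "Dprod (Suc 0) = \<one>"
  by (simp add: Dprod_def)

lemma Dprod_Suc: "1 \<le> k \<Longrightarrow> Dprod (Suc k) = over D k \<otimes> Dprod k"
  by (simp add: Dprod_def)

lemma Dprod_commute:
  assumes "i < N" "1 \<le> k" "k \<le> i"
  shows "R i \<otimes> Dprod k = Dprod k \<otimes> R i"
  using assms(2,3)
proof (induction k rule: nat_induct_at_least)
  case (Suc k)
  then have "R i \<otimes> over D k = over D k \<otimes> R i"
    using D assms(1) by (intro over_commute_above) auto
  then have "R i \<otimes> (over D k \<otimes> Dprod k) = over D k \<otimes> Dprod k \<otimes> R i"
    using Suc by (intro commute_mult) auto
  then show ?case
    using Suc by (simp add: Dprod_Suc)
qed (simp add: Dprod_1)

text \<open>With \<open>L_(k+1) = R L_k R'\<close>, the hypothesis moves \<open>L_k\<close> past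
  \<open>Dprod k\<close> at the cost of \<open>jm' k\<close>. The two outer letters of
  \<open>jm' (k + 1)\<close> are the \<open>R'\<close> in this conjugation and one of the two
  inverses from \<open>D_L_adjacent\<close>.\<close>

lemma Dprod_L:
  assumes "1 \<le> k" "k \<le> N"
  shows "Dprod k \<otimes> over L k = over L k \<otimes> (Dprod k \<otimes> jm' k)"
  using assms
proof (induction k rule: nat_induct_at_least)
  case base
  then show ?case by (simp add: Dprod_1 jm_1)
next
  case (Suc k)
  let ?D = "over D k" and ?P = "Dprod k" and ?L = "over L k" and ?L1 = "over L (Suc k)"
  have k: "1 \<le> k" "k < N" using Suc by auto
  have RP: "R k \<otimes> ?P = ?P \<otimes> R k"
    using Suc by (intro Dprod_commute) auto
  have R'P: "R' k \<otimes> ?P = ?P \<otimes> R' k"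
    using RP by (intro commute_R') auto
  have L1: "?L1 = R k \<otimes> (?L \<otimes> R' k)"
    using k by (simp add: over_Suc)
  \<comment> \<open>\<open>R k\<close> on the right of \<open>L_(k+1)\<close> cancels one of the two
    inverses from \<open>D_L_adjacent\<close>; the other one survives.\<close>
  have "?D \<otimes> (R k \<otimes> ?L) = (?D \<otimes> ?L1) \<otimes> R k"
    unfolding L1 using k by (simp add: m_assoc R_R')
  also have "\<dots> = ?L1 \<otimes> (?D \<otimes> R' k)"
    unfolding D_L_adjacent[OF k] using k by (simp add: m_assoc R_R')
  finally have DRL: "?D \<otimes> (R k \<otimes> ?L) = ?L1 \<otimes> (?D \<otimes> R' k)" .
  have "Dprod (Suc k) \<otimes> ?L1 = ?D \<otimes> ((?P \<otimes> R k) \<otimes> (?L \<otimes> R' k))"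
    unfolding L1 using k by (simp add: Dprod_Suc m_assoc)
  also have "\<dots> = ?D \<otimes> (R k \<otimes> ((?P \<otimes> ?L) \<otimes> R' k))"
    unfolding RP[symmetric] by (simp add: m_assoc)
  also have "?P \<otimes> ?L = ?L \<otimes> (?P \<otimes> jm' k)"
    using Suc by simp
  also have "?D \<otimes> (R k \<otimes> ((?L \<otimes> (?P \<otimes> jm' k)) \<otimes> R' k)) = (?D \<otimes> (R k \<otimes> ?L)) \<otimes> (?P \<otimes> (jm' k \<otimes> R' k))"
    by (simp add: m_assoc)
  also have "\<dots> = ?L1 \<otimes> (?D \<otimes> ((R' k \<otimes> ?P) \<otimes> (jm' k \<otimes> R' k)))"
    unfolding DRL by (simp add: m_assoc)
  also have "\<dots> = ?L1 \<otimes> (Dprod (Suc k) \<otimes> jm' (Suc k))"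
    unfolding R'P using k by (simp add: Dprod_Suc jm_Suc m_assoc)
  finally show ?case .
qed

text \<open>Induction on the number of factors with \<open>G\<close> arbitrary: the last factor is
  absorbed into \<open>G\<close>, and the result is again a joint eigenvector of the earlier
  Jucys-Murphy elements. Hence only the left eigenvalue equations are assumed of
  \<open>G\<close>.\<close>

theorem product_formula:
  fixes c :: "nat \<Rightarrow> int"
  assumes q: "q \<noteq> 0" and "k \<le> N" and "G \<in> carrier B"
    and "\<And>j. j \<in> {1..k} \<Longrightarrow> jm j \<otimes> G = (q powi (2 * c j)) \<odot> G"
  shows "lprod B (map (\<lambda>j. over L j \<oplus> (z * q powi (- 2 * c j)) \<odot> \<one>) [1..<Suc k]) \<otimes> G
    = (\<Prod>j\<in>{1..k}. q powi (- 2 * c j)) \<odot> (lprod B (map (over M) [1..<Suc k]) \<otimes> (Dprod (Suc k) \<otimes> G))"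
  using assms(2-)
proof (induction k arbitrary: G)
  case 0
  then show ?case by (simp add: Dprod_1)
next
  case (Suc k)
  define s where "s = q powi (- 2 * c (Suc k))"
  define F where "F j = over L j \<oplus> (z * q powi (- 2 * c j)) \<odot> \<one>" for j
  define Mp where "Mp = lprod B (map (over M) [1..<Suc k])"
  define a where "a = (\<Prod>j\<in>{1..k}. q powi (- 2 * c j))"
  have F_closed [simp, intro]: "F j \<in> carrier B" for j
    by (simp add: F_def)
  have Mp_closed [simp, intro]: "Mp \<in> carrier B"
    unfolding Mp_def by (intro lprod_closed) auto
  note G = Suc.prems(2)
  let ?k = "Suc k"
  have k: "1 \<le> ?k" "?k \<le> N" using Suc by auto
  have FG: "jm j \<otimes> (F ?k \<otimes> G) = (q powi (2 * c j)) \<odot> (F ?k \<otimes> G)" if j: "j \<in> {1..k}" for j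
  proof -
    have "jm j \<otimes> over L ?k = over L ?k \<otimes> jm j"
      using j k local1_L by (intro jm_commute_over) auto
    then have "jm j \<otimes> F ?k = F ?k \<otimes> jm j"
      by (simp add: F_def l_distr r_distr smult_mult_left smult_mult_right)
    then have "jm j \<otimes> (F ?k \<otimes> G) = F ?k \<otimes> (jm j \<otimes> G)"
      using G by (simp add: m_assoc[symmetric])
    then show ?thesis
      using Suc.prems(3)[of j] j G by (simp add: smult_mult_right)
  qed
  \<comment> \<open>The eigenvalue of the inverse element is read off by inserting
    \<open>jm' \<otimes> jm = 1\<close> in front of \<open>G\<close>.\<close>
  have "G = (jm' ?k \<otimes> jm ?k) \<otimes> G"
    using jm'_jm[OF k] G by simp
  also have "\<dots> = (q powi (2 * c ?k)) \<odot> (jm' ?k \<otimes> G)"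
    using Suc.prems(3)[of ?k] G by (simp add: m_assoc smult_mult_right)
  finally have "s \<odot> G = (s * q powi (2 * c ?k)) \<odot> (jm' ?k \<otimes> G)"
    using G by (metis jm_closed(2) m_closed smult_smult)
  also have "s * q powi (2 * c ?k) = 1"
    using q by (simp add: s_def power_int_minus)
  finally have jm'G: "jm' ?k \<otimes> G = s \<odot> G"
    using G by simp
  have "Dprod ?k \<otimes> (F ?k \<otimes> G) = (Dprod ?k \<otimes> over L ?k) \<otimes> G \<oplus> (z * s) \<odot> (Dprod ?k \<otimes> G)"
    using G by (simp add: F_def l_distr r_distr smult_mult_left smult_mult_right m_assoc s_def)
  also have "\<dots> = over L ?k \<otimes> (Dprod ?k \<otimes> (jm' ?k \<otimes> G)) \<oplus> (z * s) \<odot> (Dprod ?k \<otimes> G)"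
    unfolding Dprod_L[OF k] using G by (simp add: m_assoc)
  also have "\<dots> = s \<odot> (over L ?k \<otimes> (Dprod ?k \<otimes> G) \<oplus> z \<odot> (Dprod ?k \<otimes> G))"
    unfolding jm'G using G by (simp add: smult_mult_right smult_r_distr smult_smult mult.commute)
  \<comment> \<open>The scalar \<open>- z\<close> inside \<open>over L\<close> and the added
    \<open>z\<close> cancel, leaving \<open>M_k D_k\<close>; its \<open>D_k\<close> extends
    \<open>Dprod\<close>.\<close>
  also have "over L ?k \<otimes> (Dprod ?k \<otimes> G) \<oplus> z \<odot> (Dprod ?k \<otimes> G)
      = over M ?k \<otimes> (over D ?k \<otimes> (Dprod ?k \<otimes> G)) \<oplus> ((- z) + z) \<odot> (Dprod ?k \<otimes> G)"
    unfolding over_L[OF k] smult_l_distr[OF m_closed[OF Dprod_closed G]]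
    using G by (simp add: l_distr smult_mult_left m_assoc a_assoc)
  also have "\<dots> = over M ?k \<otimes> (Dprod (Suc ?k) \<otimes> G)"
    using G by (simp add: Dprod_Suc m_assoc)
  finally have DFG: "Dprod ?k \<otimes> (F ?k \<otimes> G) = s \<odot> (over M ?k \<otimes> (Dprod (Suc ?k) \<otimes> G))" .
  have "lprod B (map F [1..<Suc ?k]) \<otimes> G = lprod B (map F [1..<?k]) \<otimes> (F ?k \<otimes> G)"
    using G by (simp add: lprod_append m_assoc image_subset_iff)
  also have "\<dots> = a \<odot> (Mp \<otimes> (Dprod ?k \<otimes> (F ?k \<otimes> G)))"
    unfolding F_def[abs_def] Mp_def a_def
    using Suc.IH[of "F ?k \<otimes> G"] Suc.prems(1) G FG unfolding F_def by simp
  also have "\<dots> = (a * s) \<odot> ((Mp \<otimes> over M ?k) \<otimes> (Dprod (Suc ?k) \<otimes> G))"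
    unfolding DFG using G by (simp add: smult_mult_right smult_smult m_assoc)
  also have "Mp \<otimes> over M ?k = lprod B (map (over M) [1..<Suc ?k])"
    unfolding Mp_def by (simp add: lprod_append image_subset_iff)
  also have "a * s = (\<Prod>j\<in>{1..?k}. q powi (- 2 * c j))"
    by (simp add: a_def s_def)
  finally show ?case
    by (simp only: F_def[abs_def])
qed

end

section \<open>Naturality of overlines and the q-trace\<close>

lemma (in complex_algebra) place1_hom:
  assumes "1 \<le> m"
  shows "complex_algebra_hom (mat_alg A {1..n}) (tens_alg A n m) (place1 A n m 1)"
proof -
  have "complex_algebra_hom (mat_alg A {1..n}) (tens_alg A n m) (ampl A (tidx n m) (\<lambda>K. K ! 0) tl)"
    using assms by (intro ampl_hom bij_betw_hd_tidx) auto
  moreover have "place1 A n m 1 = ampl A (tidx n m) (\<lambda>K. K ! 0) tl"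
    by (rule ext) (rule place1_eq_ampl)
  ultimately show ?thesis by simp
qed

lemma (in complex_algebra) ampl2_hom:
  assumes "2 \<le> m"
  shows "complex_algebra_hom (tens_alg A n 2) (tens_alg A n m) (ampl A (tidx n m) (take 2) (drop 2))"
  using assms by (intro ampl_hom bij_betw_take2_tidx) auto

context complex_algebra_hom
begin

lemma hom_Rcheck_inv_at:
  assumes "q \<noteq> 0" "1 \<le> k" "k < m"
  shows "mat_map h (tidx n m) (Rcheck_inv_at A n q m k) = Rcheck_inv_at B n q m k"
proof -
  interpret M: complex_algebra_hom "tens_alg A n m" "tens_alg B n m" "mat_map h (tidx n m)"
    by (rule mat_map_hom) simp
  show ?thesis
    using assms by (simp add: A.Rcheck_inv_at_eq(1) B.Rcheck_inv_at_eq(1) M.hom_add M.hom_smult hom_Rcheck_at)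
qed

lemma hom_place1:
  assumes "1 \<le> k" "k \<le> m"
  shows "mat_map h (tidx n m) (place1 A n m k X) = place1 B n m k (mat_map h {1..n} X)"
proof (rule ext, clarify)
  fix I J :: "nat list"
  have "I \<in> tidx n m \<Longrightarrow> I ! (k - 1) \<in> {1..n}" for I
    using nth_tidx[of I n m "k - 1"] assms by simp
  then show "mat_map h (tidx n m) (place1 A n m k X) (I, J) = place1 B n m k (mat_map h {1..n} X) (I, J)"
    by (auto simp: mat_map_def place1_def)
qed

end

lemma (in complex_algebra) overline_closed:
  assumes "X \<in> carrier (mat_alg A {1..n})" "q \<noteq> 0" "1 \<le> k" "k \<le> m"
  shows "overline A n q m X k \<in> carrier (tens_alg A n m)"
proof -
  interpret B: complex_algebra "tens_alg A n m"
    by (rule tens_alg_complex_algebra)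
  show ?thesis
    unfolding overline_def using assms place1_closed[OF assms(1), of 1 m] Rcheck_inv_at_eq(4)[OF assms(2), of _ m n]
    by (intro B.lprod_closed) auto
qed

lemma (in complex_algebra_hom) hom_overline:
  assumes X: "X \<in> carrier (mat_alg A {1..n})" and "q \<noteq> 0" "1 \<le> k" "k \<le> m"
  shows "mat_map h (tidx n m) (overline A n q m X k) = overline B n q m (mat_map h {1..n} X) k"
proof -
  interpret M: complex_algebra_hom "tens_alg A n m" "tens_alg B n m" "mat_map h (tidx n m)"
    by (rule mat_map_hom) simp
  have "mat_map h (tidx n m) (overline A n q m X k) = lprod (tens_alg B n m) (map (mat_map h (tidx n m))
     (map (Rcheck_at A n q m) (rev [1..<k]) @ [place1 A n m 1 X] @ map (Rcheck_inv_at A n q m) [1..<k]))"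
    unfolding overline_def
    using assms A.place1_closed[OF assms(1), of 1 m] A.Rcheck_inv_at_eq(4)[OF assms(2), of _ m n]
    by (intro M.hom_lprod) auto
  also have "map (mat_map h (tidx n m))
     (map (Rcheck_at A n q m) (rev [1..<k]) @ [place1 A n m 1 X] @ map (Rcheck_inv_at A n q m) [1..<k])
     = map (Rcheck_at B n q m) (rev [1..<k]) @ [place1 B n m 1 (mat_map h {1..n} X)] @ map (Rcheck_inv_at B n q m) [1..<k]"
    using assms hom_place1[of 1 m n X] by (auto simp: hom_Rcheck_at hom_Rcheck_inv_at)
  finally show ?thesis
    by (simp add: overline_def)
qed

lemma (in complex_algebra) qtrace_weight_closed:
  "set (map (\<lambda>k. place1 A n m k (scal_mat A {1..n} (Dmat n q))) [1..<m + 1]) \<subseteq> carrier (tens_alg A n m)"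
  by (auto intro!: place1_closed)

lemma (in complex_algebra) qtrace_smult:
  assumes Y: "Y \<in> carrier (tens_alg A n m)"
  shows "qtrace A n q m (c \<odot>\<^bsub>tens_alg A n m\<^esub> Y) = c \<odot> qtrace A n q m Y"
proof -
  interpret B: complex_algebra "tens_alg A n m"
    by (rule tens_alg_complex_algebra)
  define W where "W = lprod (tens_alg A n m) (map (\<lambda>k. place1 A n m k (scal_mat A {1..n} (Dmat n q))) [1..<m + 1])"
  have "W \<in> carrier (tens_alg A n m)"
    unfolding W_def by (intro B.lprod_closed qtrace_weight_closed)
  then show ?thesis
    using Y unfolding qtrace_def mtrace_def W_def[symmetric]
    by (subst finsum_smult) (auto simp: B.smult_mult_right intro!: finsum_cong')
qed

lemma (in complex_algebra_hom) hom_qtrace: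
  assumes Y: "Y \<in> carrier (tens_alg A n m)"
  shows "h (qtrace A n q m Y) = qtrace B n q m (mat_map h (tidx n m) Y)"
proof -
  interpret M: complex_algebra_hom "tens_alg A n m" "tens_alg B n m" "mat_map h (tidx n m)"
    by (rule mat_map_hom) simp
  define xs where "xs = map (\<lambda>k. place1 A n m k (scal_mat A {1..n} (Dmat n q))) [1..<m + 1]"
  define ys where "ys = map (\<lambda>k. place1 B n m k (scal_mat B {1..n} (Dmat n q))) [1..<m + 1]"
  have xs: "set xs \<subseteq> carrier (tens_alg A n m)"
    unfolding xs_def by (rule A.qtrace_weight_closed)
  have "map (mat_map h (tidx n m)) xs = ys"
    by (auto simp: xs_def ys_def hom_place1 mat_map_scal_mat)
  then have eq: "mat_map h (tidx n m) (lprod (tens_alg A n m) xs \<otimes>\<^bsub>tens_alg A n m\<^esub> Y)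
      = lprod (tens_alg B n m) ys \<otimes>\<^bsub>tens_alg B n m\<^esub> mat_map h (tidx n m) Y"
    using xs Y by (simp add: M.hom_mult M.hom_lprod)
  have closed: "lprod (tens_alg A n m) xs \<otimes>\<^bsub>tens_alg A n m\<^esub> Y \<in> carrier (tens_alg A n m)"
    using xs Y by auto
  show ?thesis
    unfolding qtrace_def mtrace_def xs_def[symmetric] ys_def[symmetric] eq[symmetric]
    using mat_entry_closed[OF closed] by (subst hom_finsum) (auto intro!: B.finsum_cong')
qed

text \<open>Abstracting from the algebra, the matrix and the shifts allows the same expression to be
  formed in \<open>Uo\<close>, \<open>Uq\<close> and \<open>Weyl\<close> and compared along
  homomorphisms.\<close>

definition immanant_expr ::
  "'a calg \<Rightarrow> nat \<Rightarrow> complex \<Rightarrow> nat \<Rightarrow> (nat \<times> nat \<Rightarrow> 'a) \<Rightarrow> (nat \<Rightarrow> complex) \<Rightarrow> (nat list \<times> nat list \<Rightarrow> complex) \<Rightarrow> 'a" where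
  "immanant_expr A n q m X s E = qtrace A n q m
     (lprod (tens_alg A n m)
       (map (\<lambda>k. overline A n q m X k \<oplus>\<^bsub>tens_alg A n m\<^esub> s k \<odot>\<^bsub>tens_alg A n m\<^esub> \<one>\<^bsub>tens_alg A n m\<^esub>) [1..<m + 1])
      \<otimes>\<^bsub>tens_alg A n m\<^esub> scal_mat A (tidx n m) E)"

lemma (in complex_algebra_hom) hom_immanant_expr:
  assumes X: "X \<in> carrier (mat_alg A {1..n})" and q: "q \<noteq> 0"
  shows "h (immanant_expr A n q m X s E) = immanant_expr B n q m (mat_map h {1..n} X) s E"
proof -
  interpret M: complex_algebra_hom "tens_alg A n m" "tens_alg B n m" "mat_map h (tidx n m)"
    by (rule mat_map_hom) simp
  let ?F = "\<lambda>k. overline A n q m X k \<oplus>\<^bsub>tens_alg A n m\<^esub> s k \<odot>\<^bsub>tens_alg A n m\<^esub> \<one>\<^bsub>tens_alg A n m\<^esub>"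
  have F: "set (map ?F [1..<m + 1]) \<subseteq> carrier (tens_alg A n m)"
    using A.overline_closed[OF X q] by auto
  then have closed: "lprod (tens_alg A n m) (map ?F [1..<m + 1]) \<in> carrier (tens_alg A n m)"
    by (rule M.A.lprod_closed)
  have map: "map (mat_map h (tidx n m)) (map ?F [1..<m + 1])
      = map (\<lambda>k. overline B n q m (mat_map h {1..n} X) k \<oplus>\<^bsub>tens_alg B n m\<^esub> s k \<odot>\<^bsub>tens_alg B n m\<^esub> \<one>\<^bsub>tens_alg B n m\<^esub>) [1..<m + 1]"
    using A.overline_closed[OF X q] by (auto simp: M.hom_add M.hom_smult hom_overline[OF X q])
  have "mat_map h (tidx n m) (lprod (tens_alg A n m) (map ?F [1..<m + 1]))
      = lprod (tens_alg B n m) (map (\<lambda>k. overline B n q m (mat_map h {1..n} X) k \<oplus>\<^bsub>tens_alg B n m\<^esub> s k \<odot>\<^bsub>tens_alg B n m\<^esub> \<one>\<^bsub>tens_alg B n m\<^esub>) [1..<m + 1])"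
    unfolding M.hom_lprod[OF F] map ..
  then show ?thesis
    unfolding immanant_expr_def using closed by (subst hom_qtrace) (auto simp: M.hom_mult mat_map_scal_mat)
qed

section \<open>R-matrices over an algebra as an instance of the abstract relations\<close>

context complex_algebra
begin

lemma hecke_system_Rcheck_at:
  assumes "q \<noteq> 0"
  shows "hecke_system (tens_alg A n m) (Rcheck_at A n q m) m q"
  using assms Rcheck_at_relations
  by (intro hecke_system.intro hecke_system_axioms.intro tens_alg_complex_algebra) auto

lemma local1_place1:
  assumes "q \<noteq> 0" "X \<in> carrier (mat_alg A {1..n})" "1 \<le> m"
  shows "hecke_system.local1 (tens_alg A n m) (Rcheck_at A n q m) m (place1 A n m 1 X)"
  using assms place1_closed[OF assms(2), of 1 m] Rcheck_at_place1_commute[OF assms(2)]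
  by (simp add: hecke_system.local1_def[OF hecke_system_Rcheck_at])

lemma R'_eq_Rcheck_inv_at:
  assumes "q \<noteq> 0" "1 \<le> k" "k < m"
  shows "hecke_system.R' (tens_alg A n m) (Rcheck_at A n q m) q k = Rcheck_inv_at A n q m k"
  using assms by (simp add: hecke_system.R'_def[OF hecke_system_Rcheck_at[of q n m]] Rcheck_inv_at_eq(1))

lemma over_eq_overline:
  assumes "q \<noteq> 0" "k \<le> m"
  shows "hecke_system.over (tens_alg A n m) (Rcheck_at A n q m) q (place1 A n m 1 X) k = overline A n q m X k"
proof -
  have "map (hecke_system.R' (tens_alg A n m) (Rcheck_at A n q m) q) [1..<k] = map (Rcheck_inv_at A n q m) [1..<k]"
    using assms by (auto simp: R'_eq_Rcheck_inv_at)
  then show ?thesis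
    by (simp only: overline_def hecke_system.over_def[OF hecke_system_Rcheck_at[OF assms(1), of n m]])
qed

end

section \<open>Triangular matrices\<close>

text \<open>The geometric series. The witness \<open>s\<close> is the partial sum of the powers of
  \<open>x\<close> below \<open>k\<close>, starting from 0 and built by
  \<open>\<one> \<oplus> x \<otimes> s\<close>.\<close>

lemma (in ring) one_minus_nilpotent_Units:
  fixes k :: nat
  assumes x: "x \<in> carrier R" and nil: "x [^] k = \<zero>"
  shows "\<one> \<ominus> x \<in> Units R"
proof -
  have "\<exists>s \<in> carrier R. (\<one> \<ominus> x) \<otimes> s = \<one> \<ominus> x [^] k \<and> s \<otimes> (\<one> \<ominus> x) = \<one> \<ominus> x [^] k" for k :: nat
  proof (induction k)
    case 0
    then show ?case using x by (intro bexI[of _ \<zero>]) (auto simp: r_neg minus_eq)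
  next
    case (Suc k)
    then obtain s where s: "s \<in> carrier R" "(\<one> \<ominus> x) \<otimes> s = \<one> \<ominus> x [^] k" "s \<otimes> (\<one> \<ominus> x) = \<one> \<ominus> x [^] k"
      by blast
    have "(\<one> \<ominus> x) \<otimes> (\<one> \<oplus> x \<otimes> s) = \<one> \<ominus> x \<oplus> x \<otimes> ((\<one> \<ominus> x) \<otimes> s)"
      using x s(1) by (simp add: minus_eq l_distr r_distr l_minus r_minus m_assoc)
    also have "\<dots> = \<one> \<ominus> x [^] Suc k"
      unfolding s(2) nat_pow_Suc2[OF x] using x by (simp add: minus_eq r_distr r_minus a_assoc r_neg1)
    finally have 1: "(\<one> \<ominus> x) \<otimes> (\<one> \<oplus> x \<otimes> s) = \<one> \<ominus> x [^] Suc k" .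
    have "(\<one> \<oplus> x \<otimes> s) \<otimes> (\<one> \<ominus> x) = \<one> \<ominus> x \<oplus> x \<otimes> (s \<otimes> (\<one> \<ominus> x))"
      using x s(1) by (simp add: l_distr m_assoc minus_closed)
    also have "\<dots> = \<one> \<ominus> x [^] Suc k"
      unfolding s(3) nat_pow_Suc2[OF x] using x by (simp add: minus_eq r_distr r_minus a_assoc r_neg1)
    finally show ?case
      using 1 x s(1) by (intro bexI[of _ "\<one> \<oplus> x \<otimes> s"]) auto
  qed
  from this[of k] obtain s where "s \<in> carrier R" "(\<one> \<ominus> x) \<otimes> s = \<one>" "s \<otimes> (\<one> \<ominus> x) = \<one>"
    unfolding nil by (auto simp: minus_eq)
  then show ?thesis
    using x unfolding Units_def by auto
qed

text \<open>\<open>Lmat\<close> contains the inverse of \<open>Lminus\<close>, about which nothing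
  is known until \<open>Lminus\<close> is a unit. The entries do not commute, so determinants are no
  help; instead \<open>X\<close> is its diagonal part times \<open>1 - Z\<close> with
  \<open>Z\<close> strictly lower triangular, hence nilpotent.\<close>

lemma (in complex_algebra) lower_triangular_Units:
  fixes S :: "nat set"
  assumes S: "finite S" and X: "X \<in> carrier (mat_alg A S)"
    and lower: "\<And>i j. i \<in> S \<Longrightarrow> j \<in> S \<Longrightarrow> i < j \<Longrightarrow> X (i, j) = \<zero>"
    and diag: "\<And>i. i \<in> S \<Longrightarrow> X (i, i) \<in> Units A"
  shows "X \<in> Units (mat_alg A S)"
proof -
  let ?M = "mat_alg A S"
  interpret M: complex_algebra ?M by (rule complex_algebra_mat_alg[OF S])
  define dg where "dg d = (\<lambda>(i, j)\<in>S \<times> S. if i = j then d i else \<zero>)" for d :: "nat \<Rightarrow> 'a"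
  have dg_closed: "dg d \<in> carrier ?M" if "\<And>i. i \<in> S \<Longrightarrow> d i \<in> carrier A" for d
    unfolding mat_carrier using that by (auto simp: dg_def)
  have dg_mult: "(dg d \<otimes>\<^bsub>?M\<^esub> Y) (i, j) = d i \<otimes> Y (i, j)"
    if "\<And>i. i \<in> S \<Longrightarrow> d i \<in> carrier A" "Y \<in> carrier ?M" "i \<in> S" "j \<in> S" for d Y i j
  proof -
    have "(dg d \<otimes>\<^bsub>?M\<^esub> Y) (i, j) = (\<lambda>k. dg d (i, k) \<otimes> Y (k, j)) i"
      unfolding mat_entry(1)[OF that(3,4)] using that dg_closed[OF that(1)] S
      by (intro finsum_delta) (auto simp: dg_def)
    then show ?thesis using that by (simp add: dg_def)
  qed
  define d where "d i = X (i, i)" for i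
  define d' where "d' i = inv X (i, i)" for i
  have d: "d i \<in> carrier A" "d' i \<in> carrier A" "d i \<otimes> d' i = \<one>" "d' i \<otimes> d i = \<one>" if "i \<in> S" for i
    using diag[OF that] by (auto simp: d_def d'_def)
  have dgc: "dg d \<in> carrier ?M" "dg d' \<in> carrier ?M"
    by (rule dg_closed, rule d, assumption)+
  have dd': "dg d \<otimes>\<^bsub>?M\<^esub> dg d' = \<one>\<^bsub>?M\<^esub>" "dg d' \<otimes>\<^bsub>?M\<^esub> dg d = \<one>\<^bsub>?M\<^esub>"
  proof -
    have entry: "dg c (i, j) = (if i = j then c i else \<zero>)" if "i \<in> S" "j \<in> S" for c i j
      using that by (simp add: dg_def)
    show "dg d \<otimes>\<^bsub>?M\<^esub> dg d' = \<one>\<^bsub>?M\<^esub>"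
      using dgc by (intro mat_eqI[of _ A S]) (auto simp: dg_mult[OF d(1)] entry d)
    show "dg d' \<otimes>\<^bsub>?M\<^esub> dg d = \<one>\<^bsub>?M\<^esub>"
      using dgc by (intro mat_eqI[of _ A S]) (auto simp: dg_mult[OF d(2)] entry d)
  qed
  define Z where "Z = \<one>\<^bsub>?M\<^esub> \<ominus>\<^bsub>?M\<^esub> dg d' \<otimes>\<^bsub>?M\<^esub> X"
  have Z: "Z \<in> carrier ?M"
    unfolding Z_def using dgc X by (intro M.minus_closed) auto
  have Z0: "Z (i, j) = \<zero>" if "i \<in> S" "j \<in> S" "i < Suc j" for i j
  proof -
    have "Z (i, j) = (if i = j then \<one> else \<zero>) \<oplus> (-1) \<odot> (d' i \<otimes> X (i, j))"
      unfolding Z_def using that dgc X d by (simp add: M.minus_eq_smult dg_mult)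
    then show ?thesis
      using that d(4)[OF that(1)] d(2)[OF that(1)] lower by (auto simp: d_def smult_minus_1 r_neg)
  qed
  \<comment> \<open>A nonzero entry of \<open>Z\<close> needs \<open>i \<ge> j + 1\<close>, so one
    of the \<open>k\<close>-th power needs \<open>i \<ge> j + k\<close>. For \<open>k = K\<close>,
    above every index in \<open>S\<close>, nothing remains.\<close>
  have nil: "(Z [^]\<^bsub>?M\<^esub> k) (i, j) = \<zero>" if "i \<in> S" "j \<in> S" "i < j + k" for i j k
    using that
  proof (induction k arbitrary: i j)
    case (Suc k)
    have Zk: "Z [^]\<^bsub>?M\<^esub> k \<in> carrier ?M"
      using Z by (rule M.nat_pow_closed)
    have "Z (i, l) \<otimes> (Z [^]\<^bsub>?M\<^esub> k) (l, j) = \<zero>" if "l \<in> S" for l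
    proof (cases "i < Suc l")
      case True
      then show ?thesis using Z0[of i l] Suc that mat_entry_closed[OF Zk, of l j] by auto
    next
      case False
      then have "(Z [^]\<^bsub>?M\<^esub> k) (l, j) = \<zero>"
        using Suc that by (intro Suc.IH) auto
      then show ?thesis using Suc that mat_entry_closed[OF Z, of i l] by auto
    qed
    then show ?case
      unfolding M.nat_pow_Suc2[OF Z] mat_entry(1)[OF Suc.prems(1,2)] by (intro add.finprod_one_eqI) auto
  qed auto
  obtain K where K: "S \<subseteq> {..<K}"
    using S finite_nat_iff_bounded by blast
  have "Z [^]\<^bsub>?M\<^esub> K = \<zero>\<^bsub>?M\<^esub>"
    using Z K by (intro mat_eqI[of _ A S]) (auto intro!: nil trans_less_add2)
  then have unit: "\<one>\<^bsub>?M\<^esub> \<ominus>\<^bsub>?M\<^esub> Z \<in> Units ?M"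
    using Z by (intro M.one_minus_nilpotent_Units)
  have eq: "\<one>\<^bsub>?M\<^esub> \<ominus>\<^bsub>?M\<^esub> Z = dg d' \<otimes>\<^bsub>?M\<^esub> X"
    unfolding Z_def using dgc X by (simp add: M.minus_eq M.minus_add M.r_neg2)
  have "dg d \<in> Units ?M"
    using dd' dgc by (auto simp: Units_def)
  then have "dg d \<otimes>\<^bsub>?M\<^esub> (dg d' \<otimes>\<^bsub>?M\<^esub> X) \<in> Units ?M"
    using unit unfolding eq by (rule M.Units_m_closed)
  then show ?thesis
    using dd' dgc X by (simp add: M.m_assoc[symmetric])
qed

declare One_nat_def [simp del]

section \<open>The Hecke algebra\<close>

lemma hecke_rels_carrier: "hecke_rels q m \<subseteq> carrier (free_alg {1..<m})"
proof -
  interpret F: complex_algebra "free_alg {1..<m}" by (rule complex_algebra_free_alg)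
  show ?thesis
    unfolding hecke_rels_def Let_def by (auto intro!: F.minus_closed F.m_closed F.add.m_closed)
qed

context
  fixes n m :: nat and q :: complex
  assumes q: "q \<noteq> 0"
begin

private abbreviation "ev \<equiv> free_eval (tens_alg complex_alg n m) (Rcheck_at complex_alg n q m)"

private lemma C: "complex_algebra (tens_alg complex_alg n m)"
  by (rule complex_algebra.tens_alg_complex_algebra[OF complex_algebra_complex_alg])

interpretation ev: complex_algebra_hom "free_alg {1..<m}" "tens_alg complex_alg n m" ev
  by (rule complex_algebra.free_eval_hom[OF C]) (use Rcheck_at_complex_closed in auto)

interpretation H: complex_algebra_hom "free_alg {1..<m}" "Hecke q m"
  "\<lambda>f. Idl\<^bsub>free_alg {1..<m}\<^esub> (hecke_rels q m) +>\<^bsub>free_alg {1..<m}\<^esub> f"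
  unfolding Hecke_def by (rule presented_hom[OF hecke_rels_carrier])

private lemma ev_gen: "i \<in> {1..<m} \<Longrightarrow> ev (free_gen i) = Rcheck_at complex_alg n q m i"
  unfolding free_gen_eq_free_word
  by (subst complex_algebra.free_eval_word[OF C, where X = "{1..<m}"]) (use Rcheck_at_complex_closed in auto)

private lemma ev_rel:
  assumes "r \<in> hecke_rels q m"
  shows "ev r = \<zero>\<^bsub>tens_alg complex_alg n m\<^esub>"
proof -
  let ?C = "tens_alg complex_alg n m" and ?T = "Rcheck_at complex_alg n q m" and ?F = "free_alg {1..<m}"
  consider
      i where "r = (free_gen i \<ominus>\<^bsub>?F\<^esub> q \<odot>\<^bsub>?F\<^esub> \<one>\<^bsub>?F\<^esub>) \<otimes>\<^bsub>?F\<^esub> (free_gen i \<oplus>\<^bsub>?F\<^esub> inverse q \<odot>\<^bsub>?F\<^esub> \<one>\<^bsub>?F\<^esub>)" "i \<in> {1..<m}"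
    | i where "r = lprod ?F [free_gen i, free_gen (i + 1), free_gen i]
          \<ominus>\<^bsub>?F\<^esub> lprod ?F [free_gen (i + 1), free_gen i, free_gen (i + 1)]" "i \<in> {1..<m}" "i + 1 \<in> {1..<m}"
    | i j where "r = free_gen i \<otimes>\<^bsub>?F\<^esub> free_gen j \<ominus>\<^bsub>?F\<^esub> free_gen j \<otimes>\<^bsub>?F\<^esub> free_gen i"
        "i \<in> {1..<m}" "j \<in> {1..<m}" "\<bar>int i - int j\<bar> > 1"
    using assms unfolding hecke_rels_def Let_def by blast
  then show ?thesis
  proof cases
    case 1
    have g: "free_gen i \<in> carrier ?F" using 1 by auto
    have "ev r = (?T i \<ominus>\<^bsub>?C\<^esub> q \<odot>\<^bsub>?C\<^esub> \<one>\<^bsub>?C\<^esub>) \<otimes>\<^bsub>?C\<^esub> (?T i \<oplus>\<^bsub>?C\<^esub> inverse q \<odot>\<^bsub>?C\<^esub> \<one>\<^bsub>?C\<^esub>)"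
      unfolding 1(1) using g 1(2) by (simp add: ev.hom_mult ev.hom_add ev.hom_minus ev.hom_smult ev_gen[symmetric])
    also have "\<dots> = ?T i \<otimes>\<^bsub>?C\<^esub> ?T i \<ominus>\<^bsub>?C\<^esub> ((q - inverse q) \<odot>\<^bsub>?C\<^esub> ?T i \<oplus>\<^bsub>?C\<^esub> \<one>\<^bsub>?C\<^esub>)"
    proof -
      have "(?T i \<ominus>\<^bsub>?C\<^esub> q \<odot>\<^bsub>?C\<^esub> \<one>\<^bsub>?C\<^esub>) \<otimes>\<^bsub>?C\<^esub> (?T i \<oplus>\<^bsub>?C\<^esub> inverse q \<odot>\<^bsub>?C\<^esub> \<one>\<^bsub>?C\<^esub>)
        = ?T i \<otimes>\<^bsub>?C\<^esub> ?T i \<oplus>\<^bsub>?C\<^esub> (inverse q \<odot>\<^bsub>?C\<^esub> ?T i \<oplus>\<^bsub>?C\<^esub> (- q) \<odot>\<^bsub>?C\<^esub> ?T i) \<oplus>\<^bsub>?C\<^esub> (- q * inverse q) \<odot>\<^bsub>?C\<^esub> \<one>\<^bsub>?C\<^esub>"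
        using Rcheck_at_complex_closed[of n q m i] q
        by (simp add: ev.B.minus_eq_smult ev.B.smult_smult ev.B.l_distr ev.B.r_distr ev.B.smult_mult_left
            ev.B.smult_mult_right ev.B.smult_r_distr ev.B.add.m_ac)
      also have "inverse q \<odot>\<^bsub>?C\<^esub> ?T i \<oplus>\<^bsub>?C\<^esub> (- q) \<odot>\<^bsub>?C\<^esub> ?T i = (- (q - inverse q)) \<odot>\<^bsub>?C\<^esub> ?T i"
        using Rcheck_at_complex_closed[of n q m i] by (simp add: ev.B.smult_l_distr[symmetric])
      also have "- q * inverse q = -1" using q by simp
      finally show ?thesis
        using Rcheck_at_complex_closed[of n q m i]
        by (simp add: ev.B.minus_eq_smult ev.B.smult_r_distr ev.B.smult_smult ev.B.add.m_assoc)
    qed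
    also have "\<dots> = \<zero>\<^bsub>?C\<^esub>"
      using Rcheck_at_complex_quadratic[OF q, of i m n] 1(2) Rcheck_at_complex_closed[of n q m i] by (simp add: ev.B.minus_eq ev.B.r_neg)
    finally show ?thesis .
  next
    case 2
    then have g: "free_gen i \<in> carrier ?F" "free_gen (i + 1) \<in> carrier ?F" by auto
    have "ev r = ?T i \<otimes>\<^bsub>?C\<^esub> (?T (i + 1) \<otimes>\<^bsub>?C\<^esub> ?T i) \<ominus>\<^bsub>?C\<^esub> ?T (i + 1) \<otimes>\<^bsub>?C\<^esub> (?T i \<otimes>\<^bsub>?C\<^esub> ?T (i + 1))"
      unfolding 2(1) ev_gen[OF 2(2), symmetric] ev_gen[OF 2(3), symmetric]
      using g by (simp add: ev.hom_mult ev.hom_minus)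
    then show ?thesis
      using Rcheck_at_complex_braid[OF q, of i m n] 2 Rcheck_at_complex_closed by (simp add: ev.B.minus_eq ev.B.r_neg)
  next
    case 3
    then have g: "free_gen i \<in> carrier ?F" "free_gen j \<in> carrier ?F" by auto
    have "ev r = ?T i \<otimes>\<^bsub>?C\<^esub> ?T j \<ominus>\<^bsub>?C\<^esub> ?T j \<otimes>\<^bsub>?C\<^esub> ?T i"
      unfolding 3(1) ev_gen[OF 3(2), symmetric] ev_gen[OF 3(3), symmetric]
      using g by (simp add: ev.hom_mult ev.hom_minus)
    moreover have "?T i \<otimes>\<^bsub>?C\<^esub> ?T j = ?T j \<otimes>\<^bsub>?C\<^esub> ?T i"
      using Rcheck_at_complex_commute[OF q, of i j m n] Rcheck_at_complex_commute[OF q, of j i m n] 3 by fastforce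
    ultimately show ?thesis
      using Rcheck_at_complex_closed by (simp add: ev.B.minus_eq ev.B.r_neg)
  qed
qed

text \<open>Members of a coset differ by an element of the ideal, which evaluation kills because the
  R-matrices satisfy the Hecke relations. The image is a singleton, so \<open>the_elem\<close>
  returns its element.\<close>

private lemma hecke_action_coset:
  assumes f: "f \<in> carrier (free_alg {1..<m})"
  shows "hecke_action n q m (Idl\<^bsub>free_alg {1..<m}\<^esub> (hecke_rels q m) +>\<^bsub>free_alg {1..<m}\<^esub> f) = ev f"
proof -
  let ?F = "free_alg {1..<m}" let ?I = "Idl\<^bsub>?F\<^esub> (hecke_rels q m)"
  interpret I: ideal ?I ?F by (rule ev.A.genideal_ideal[OF hecke_rels_carrier])
  have "ev g = ev f" if g: "g \<in> ?I +>\<^bsub>?F\<^esub> f" for g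
  proof -
    obtain i where i: "i \<in> ?I" "g = i \<oplus>\<^bsub>?F\<^esub> f"
      using g by (auto simp: a_r_coset_def')
    have "ev i = \<zero>\<^bsub>tens_alg complex_alg n m\<^esub>"
      by (rule ev.hom_genideal_eq_zero[OF hecke_rels_carrier ev_rel i(1)])
    then show ?thesis
      using i f by (simp add: ev.hom_add)
  qed
  moreover have "f \<in> ?I +>\<^bsub>?F\<^esub> f"
    using f by (rule I.a_rcos_self)
  ultimately have "ev ` (?I +>\<^bsub>?F\<^esub> f) = {ev f}"
    by blast
  then show ?thesis
    by (simp add: hecke_action_def)
qed

text \<open>The eigenvalue equation is lifted to the free algebra, where it holds modulo the ideal.
  Evaluation is constant on cosets and multiplicative, so the lifted equation becomes one between
  matrices.\<close>

lemma hecke_action_jucys_murphy: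
  assumes e: "e \<in> carrier (Hecke q m)" and k: "k \<le> m"
    and eigen: "jucys_murphy q m k \<otimes>\<^bsub>Hecke q m\<^esub> e = c \<odot>\<^bsub>Hecke q m\<^esub> e"
  shows "lprod (tens_alg complex_alg n m) (map (Rcheck_at complex_alg n q m) (rev [1..<k] @ [1..<k]))
      \<otimes>\<^bsub>tens_alg complex_alg n m\<^esub> hecke_action n q m e
    = c \<odot>\<^bsub>tens_alg complex_alg n m\<^esub> hecke_action n q m e"
    and "hecke_action n q m e \<in> carrier (tens_alg complex_alg n m)"
proof -
  let ?F = "free_alg {1..<m}" let ?\<pi> = "\<lambda>f. Idl\<^bsub>?F\<^esub> (hecke_rels q m) +>\<^bsub>?F\<^esub> f"
  obtain f where f: "f \<in> carrier ?F" "e = ?\<pi> f"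
    using e unfolding Hecke_def presented_def by (elim ev.A.quot_alg_carrierE)
  have act: "hecke_action n q m e = ev f"
    using f by (simp add: hecke_action_coset)
  let ?w = "map free_gen (rev [1..<k] @ [1..<k])"
  have w: "set ?w \<subseteq> carrier ?F"
    using k by auto
  have "jucys_murphy q m k = ?\<pi> (lprod ?F ?w)"
    unfolding jucys_murphy_def H.hom_lprod[OF w] by (simp add: hecke_T_def[abs_def] pres_gen_def[abs_def] comp_def)
  then have "?\<pi> (lprod ?F ?w \<otimes>\<^bsub>?F\<^esub> f) = ?\<pi> (c \<odot>\<^bsub>?F\<^esub> f)"
    using eigen f w by (simp add: H.hom_mult H.hom_smult)
  then have "ev (lprod ?F ?w \<otimes>\<^bsub>?F\<^esub> f) = ev (c \<odot>\<^bsub>?F\<^esub> f)"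
    using hecke_action_coset f w by (metis ev.A.lprod_closed ev.A.m_closed ev.A.smult_closed)
  then have "lprod (tens_alg complex_alg n m) (map ev ?w) \<otimes>\<^bsub>tens_alg complex_alg n m\<^esub> ev f
      = c \<odot>\<^bsub>tens_alg complex_alg n m\<^esub> ev f"
    unfolding ev.hom_lprod[OF w, symmetric] ev.hom_mult[OF ev.A.lprod_closed[OF w] f(1)] ev.hom_smult[OF f(1)] .
  also have "map ev ?w = map (Rcheck_at complex_alg n q m) (rev [1..<k] @ [1..<k])"
    using k by (auto simp: ev_gen)
  finally show "lprod (tens_alg complex_alg n m) (map (Rcheck_at complex_alg n q m) (rev [1..<k] @ [1..<k]))
      \<otimes>\<^bsub>tens_alg complex_alg n m\<^esub> hecke_action n q m e
    = c \<odot>\<^bsub>tens_alg complex_alg n m\<^esub> hecke_action n q m e"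
    unfolding act .
  show "hecke_action n q m e \<in> carrier (tens_alg complex_alg n m)"
    unfolding act using f by (rule_tac ev.hom_closed)
qed

end

section \<open>The presented algebras\<close>

lemma (in complex_algebra) mat_rels_carrier:
  assumes "Y \<in> carrier (mat_alg A S)" "Z \<in> carrier (mat_alg A S)"
  shows "mat_rels A S Y Z \<subseteq> carrier A"
  using assms unfolding mat_rels_def by (auto intro!: minus_closed)

lemma (in complex_algebra_hom) mat_map_mat_rels:
  assumes "Y \<in> carrier (mat_alg A S)" "Z \<in> carrier (mat_alg A S)"
    and "\<And>r. r \<in> mat_rels A S Y Z \<Longrightarrow> h r = \<zero>\<^bsub>B\<^esub>"
  shows "mat_map h S Y = mat_map h S Z"
proof (rule mat_eqI[of _ B S])
  fix i j assume ij: "i \<in> S" "j \<in> S"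
  then have "h (Y (i, j) \<ominus>\<^bsub>A\<^esub> Z (i, j)) = \<zero>\<^bsub>B\<^esub>"
    by (intro assms(3)) (auto simp: mat_rels_def)
  then show "mat_map h S Y (i, j) = mat_map h S Z (i, j)"
    using ij assms(1,2) by (simp add: hom_minus)
qed (use assms(1,2) in \<open>auto simp: mat_carrier mat_map_def\<close>)

lemma RLL_rels_carrier:
  assumes "complex_algebra A" "X \<in> carrier (mat_alg A {1..n})" "Y \<in> carrier (mat_alg A {1..n})"
  shows "RLL_rels A n q X Y \<subseteq> carrier A"
proof -
  interpret A: complex_algebra A by fact
  interpret B: complex_algebra "tens_alg A n 2" by (rule A.tens_alg_complex_algebra)
  have "place1 A n 2 1 X \<in> carrier (tens_alg A n 2)" "place1 A n 2 2 Y \<in> carrier (tens_alg A n 2)"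
    using assms by (auto intro!: A.place1_closed)
  then show ?thesis
    unfolding RLL_rels_def Let_def by (intro A.mat_rels_carrier B.lprod_closed) auto
qed

lemma free_gen_uq_closed:
  "1 \<le> i \<Longrightarrow> i \<le> j \<Longrightarrow> j \<le> n \<Longrightarrow> free_gen (LP i j) \<in> carrier (free_alg (uq_gens n))"
  "1 \<le> j \<Longrightarrow> j \<le> i \<Longrightarrow> i \<le> n \<Longrightarrow> free_gen (LM i j) \<in> carrier (free_alg (uq_gens n))"
  by (auto simp: uq_gens_def intro!: free_gen_closed)

lemma uq_rels_carrier: "uq_rels n q \<subseteq> carrier (free_alg (uq_gens n))"
proof -
  interpret F: complex_algebra "free_alg (uq_gens n)" by (rule complex_algebra_free_alg)
  have PM: "uq_LP0 n \<in> carrier (mat_alg (free_alg (uq_gens n)) {1..n})"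
    "uq_LM0 n \<in> carrier (mat_alg (free_alg (uq_gens n)) {1..n})"
    unfolding mat_carrier by (auto simp: uq_LP0_def uq_LM0_def intro!: free_gen_uq_closed F.zero_closed)
  then show ?thesis
    unfolding uq_rels_def Let_def
    using RLL_rels_carrier[OF F.complex_algebra_axioms] mat_entry_closed[OF PM(1)] mat_entry_closed[OF PM(2)]
    by (auto intro!: F.minus_closed F.m_closed)
qed

lemma Uq_hom: "complex_algebra_hom (free_alg (uq_gens n)) (Uq n q)
    (\<lambda>f. Idl\<^bsub>free_alg (uq_gens n)\<^esub> (uq_rels n q) +>\<^bsub>free_alg (uq_gens n)\<^esub> f)"
  unfolding Uq_def by (rule presented_hom[OF uq_rels_carrier])

lemma Lplus_closed: "Lplus n q \<in> carrier (mat_alg (Uq n q) {1..n})"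
  and Lminus_closed: "Lminus n q \<in> carrier (mat_alg (Uq n q) {1..n})"
proof -
  interpret U: complex_algebra_hom "free_alg (uq_gens n)" "Uq n q"
    "\<lambda>f. Idl\<^bsub>free_alg (uq_gens n)\<^esub> (uq_rels n q) +>\<^bsub>free_alg (uq_gens n)\<^esub> f"
    by (rule Uq_hom)
  show "Lplus n q \<in> carrier (mat_alg (Uq n q) {1..n})" "Lminus n q \<in> carrier (mat_alg (Uq n q) {1..n})"
    unfolding mat_carrier
    by (auto simp: Lplus_def Lminus_def pres_gen_def intro!: U.hom_closed free_gen_uq_closed)
qed

text \<open>The relations for the diagonal generators make each diagonal entry of
  \<open>Lminus\<close> invertible, with inverse the corresponding entry of
  \<open>Lplus\<close>.\<close>

lemma Lminus_Units: "Lminus n q \<in> Units (mat_alg (Uq n q) {1..n})"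
proof -
  let ?F = "free_alg (uq_gens n)" and ?\<pi> = "\<lambda>f. Idl\<^bsub>free_alg (uq_gens n)\<^esub> (uq_rels n q) +>\<^bsub>free_alg (uq_gens n)\<^esub> f"
  interpret U: complex_algebra_hom ?F "Uq n q" ?\<pi>
    by (rule Uq_hom)
  show ?thesis
  proof (rule U.B.lower_triangular_Units[OF _ Lminus_closed])
    show "Lminus n q (i, j) = \<zero>\<^bsub>Uq n q\<^esub>" if "i \<in> {1..n}" "j \<in> {1..n}" "i < j" for i j
      using that by (simp add: Lminus_def)
    fix i assume i: "i \<in> {1..n}"
    have gens: "free_gen (LP i i) \<in> carrier ?F" "free_gen (LM i i) \<in> carrier ?F"
      using i by (auto intro!: free_gen_uq_closed)
    have entries: "uq_LP0 n (i, i) = free_gen (LP i i)" "uq_LM0 n (i, i) = free_gen (LM i i)"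
      "Lminus n q (i, i) = ?\<pi> (free_gen (LM i i))"
      using i by (simp_all add: uq_LP0_def uq_LM0_def Lminus_def pres_gen_def)
    have "free_gen (LP i i) \<otimes>\<^bsub>?F\<^esub> free_gen (LM i i) \<ominus>\<^bsub>?F\<^esub> \<one>\<^bsub>?F\<^esub> \<in> uq_rels n q"
      "free_gen (LM i i) \<otimes>\<^bsub>?F\<^esub> free_gen (LP i i) \<ominus>\<^bsub>?F\<^esub> \<one>\<^bsub>?F\<^esub> \<in> uq_rels n q"
      using i unfolding uq_rels_def Let_def entries[symmetric] by blast+
    then have "?\<pi> (free_gen (LP i i) \<otimes>\<^bsub>?F\<^esub> free_gen (LM i i) \<ominus>\<^bsub>?F\<^esub> \<one>\<^bsub>?F\<^esub>) = \<zero>\<^bsub>Uq n q\<^esub>"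
      "?\<pi> (free_gen (LM i i) \<otimes>\<^bsub>?F\<^esub> free_gen (LP i i) \<ominus>\<^bsub>?F\<^esub> \<one>\<^bsub>?F\<^esub>) = \<zero>\<^bsub>Uq n q\<^esub>"
      unfolding Uq_def by (auto intro!: presented_rel[OF uq_rels_carrier])
    then have "?\<pi> (free_gen (LP i i)) \<otimes>\<^bsub>Uq n q\<^esub> ?\<pi> (free_gen (LM i i)) = \<one>\<^bsub>Uq n q\<^esub>"
      "?\<pi> (free_gen (LM i i)) \<otimes>\<^bsub>Uq n q\<^esub> ?\<pi> (free_gen (LP i i)) = \<one>\<^bsub>Uq n q\<^esub>"
      using gens by (simp_all add: U.hom_minus U.hom_mult)
    then show "Lminus n q (i, i) \<in> Units (Uq n q)"
      unfolding entries Units_def using gens U.hom_closed by blast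
  qed simp
qed

lemma Lmat_closed: "Lmat n q \<in> carrier (mat_alg (Uq n q) {1..n})"
proof -
  interpret U: complex_algebra_hom "free_alg (uq_gens n)" "Uq n q"
    "\<lambda>f. Idl\<^bsub>free_alg (uq_gens n)\<^esub> (uq_rels n q) +>\<^bsub>free_alg (uq_gens n)\<^esub> f"
    by (rule Uq_hom)
  interpret M: complex_algebra "mat_alg (Uq n q) {1..n}"
    by (rule U.B.complex_algebra_mat_alg) simp
  show ?thesis
    unfolding Lmat_def by (intro M.m_closed Lplus_closed M.Units_inv_closed Lminus_Units)
qed

text \<open>A generated subalgebra keeps the operations and only shrinks the carrier, so its
  inclusion is the identity map. It is closed under scalars because each
  \<open>c \<odot> \<one>\<close> is among the generators.\<close>

lemma (in complex_algebra) subalg_gen_hom: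
  assumes H: "H \<subseteq> carrier A"
  shows "complex_algebra_hom (subalg_gen A H) A (\<lambda>x. x)"
proof -
  let ?G = "range (\<lambda>c. c \<odot> \<one>) \<union> H"
  have G: "?G \<subseteq> carrier A"
    using H by auto
  note incl = generate_ring_in_carrier[OF G]
  have "ring (subalg_gen A H)"
    unfolding subalg_gen_def by (rule generate_ring_is_ring[OF G])
  moreover have "c \<odot> x \<in> generate_ring A ?G" if "x \<in> generate_ring A ?G" for c x
  proof -
    have "(c \<odot> \<one>) \<otimes> x \<in> generate_ring A ?G"
      using that by (auto intro: generate_ring.intros)
    then show ?thesis
      using incl[OF that] by (simp add: smult_one_mult)
  qed
  ultimately have sub: "complex_algebra (subalg_gen A H)"
    using incl by (intro complex_algebra.intro complex_algebra_axioms.intro)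
      (auto simp: subalg_gen_def smult_l_distr smult_r_distr smult_smult smult_mult_left smult_mult_right)
  show ?thesis
    using incl by (intro complex_algebra_hom.intro complex_algebra_hom_axioms.intro sub
        complex_algebra_axioms calg_homI) (auto simp: subalg_gen_def)
qed

section \<open>The braided Weyl algebra\<close>

lemma weyl_gen_closed:
  "(\<lambda>(i, j)\<in>{1..n} \<times> {1..n}. free_gen (WM i j)) \<in> carrier (mat_alg (free_alg (weyl_gens n)) {1..n})"
  "(\<lambda>(i, j)\<in>{1..n} \<times> {1..n}. free_gen (WD i j)) \<in> carrier (mat_alg (free_alg (weyl_gens n)) {1..n})"
  unfolding mat_carrier by (auto simp: weyl_gens_def intro!: free_gen_closed)

context
  fixes n :: nat and q :: complex
  assumes q: "q \<noteq> 0"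
begin

private definition "F = free_alg (weyl_gens n)"
private definition "B2 = tens_alg F n 2"
private definition "R = Rcheck_at F n q 2 1"
private definition "R' = Rcheck_inv_at F n q 2 1"
private definition "M1 = place1 F n 2 1 (\<lambda>(i, j)\<in>{1..n} \<times> {1..n}. free_gen (WM i j))"
private definition "D1 = place1 F n 2 1 (\<lambda>(i, j)\<in>{1..n} \<times> {1..n}. free_gen (WD i j))"

private lemma F: "complex_algebra F"
  unfolding F_def by (rule complex_algebra_free_alg)

private lemma B2: "complex_algebra B2"
  unfolding B2_def by (rule complex_algebra.tens_alg_complex_algebra[OF F])

private lemma closed: "R \<in> carrier B2" "R' \<in> carrier B2" "M1 \<in> carrier B2" "D1 \<in> carrier B2"
  unfolding B2_def R_def R'_def M1_def D1_def
  using complex_algebra.Rcheck_at_closed[OF F] complex_algebra.Rcheck_inv_at_eq(4)[OF F q]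
    complex_algebra.place1_closed[OF F] weyl_gen_closed[of n] unfolding F_def by auto

private lemma weyl_rels_eq:
  "weyl_rels n q =
    mat_rels F (tidx n 2) (lprod B2 [R, M1, R, M1]) (lprod B2 [M1, R, M1, R]) \<union>
    mat_rels F (tidx n 2) (lprod B2 [R', D1, R', D1]) (lprod B2 [D1, R', D1, R']) \<union>
    mat_rels F (tidx n 2) (lprod B2 [D1, R, M1, R]) (lprod B2 [R, M1, R', D1] \<oplus>\<^bsub>B2\<^esub> R)"
  unfolding weyl_rels_def Let_def R_def R'_def M1_def D1_def B2_def F_def ..

private lemma sides_closed:
  "lprod B2 [R, M1, R, M1] \<in> carrier B2" "lprod B2 [M1, R, M1, R] \<in> carrier B2"
  "lprod B2 [R', D1, R', D1] \<in> carrier B2" "lprod B2 [D1, R', D1, R'] \<in> carrier B2"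
  "lprod B2 [D1, R, M1, R] \<in> carrier B2" "lprod B2 [R, M1, R', D1] \<oplus>\<^bsub>B2\<^esub> R \<in> carrier B2"
proof -
  interpret B2: complex_algebra B2 by (rule B2)
  show "lprod B2 [R, M1, R, M1] \<in> carrier B2" "lprod B2 [M1, R, M1, R] \<in> carrier B2"
    "lprod B2 [R', D1, R', D1] \<in> carrier B2" "lprod B2 [D1, R', D1, R'] \<in> carrier B2"
    "lprod B2 [D1, R, M1, R] \<in> carrier B2" "lprod B2 [R, M1, R', D1] \<oplus>\<^bsub>B2\<^esub> R \<in> carrier B2"
    using closed by simp_all
qed

lemma weyl_rels_carrier: "weyl_rels n q \<subseteq> carrier (free_alg (weyl_gens n))"
  unfolding weyl_rels_eq F_def[symmetric] using sides_closed unfolding B2_def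
  by (intro Un_least complex_algebra.mat_rels_carrier[OF F])

lemma Weyl_hom: "complex_algebra_hom (free_alg (weyl_gens n)) (Weyl n q)
    (\<lambda>f. Idl\<^bsub>free_alg (weyl_gens n)\<^esub> (weyl_rels n q) +>\<^bsub>free_alg (weyl_gens n)\<^esub> f)"
  unfolding Weyl_def by (rule presented_hom[OF weyl_rels_carrier])

private definition "\<pi> = (\<lambda>f. Idl\<^bsub>free_alg (weyl_gens n)\<^esub> (weyl_rels n q) +>\<^bsub>free_alg (weyl_gens n)\<^esub> f)"

private lemma pi_hom: "complex_algebra_hom F (Weyl n q) \<pi>"
  unfolding F_def \<pi>_def by (rule Weyl_hom)

lemma complex_algebra_Weyl: "complex_algebra (Weyl n q)"
  using Weyl_hom by (simp add: complex_algebra_hom_def)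

private lemma mat_map_pi:
  "Mmat n q = mat_map \<pi> {1..n} (\<lambda>(i, j)\<in>{1..n} \<times> {1..n}. free_gen (WM i j))"
  "Dermat n q = mat_map \<pi> {1..n} (\<lambda>(i, j)\<in>{1..n} \<times> {1..n}. free_gen (WD i j))"
  by (auto simp: Mmat_def Dermat_def mat_map_def pres_gen_def \<pi>_def fun_eq_iff)

lemma Mmat_closed: "Mmat n q \<in> carrier (mat_alg (Weyl n q) {1..n})"
  and Dermat_closed: "Dermat n q \<in> carrier (mat_alg (Weyl n q) {1..n})"
proof -
  interpret m: complex_algebra_hom "mat_alg F {1..n}" "mat_alg (Weyl n q) {1..n}" "mat_map \<pi> {1..n}"
    by (rule complex_algebra_hom.mat_map_hom[OF pi_hom]) simp
  show "Mmat n q \<in> carrier (mat_alg (Weyl n q) {1..n})" "Dermat n q \<in> carrier (mat_alg (Weyl n q) {1..n})"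
    unfolding mat_map_pi using weyl_gen_closed by (auto simp: F_def intro!: m.hom_closed)
qed

text \<open>The quotient map applied entrywise, followed by tensoring with the identity on the last
  \<open>m - 2\<close> factors, is one homomorphism \<open>h\<close>. It sends the matrices in the
  defining relations to those on \<open>m\<close> factors.\<close>

lemma weyl_relations:
  fixes m :: nat
  assumes m: "2 \<le> m"
  defines "B \<equiv> tens_alg (Weyl n q) n m"
    and "S \<equiv> Rcheck_at (Weyl n q) n q m 1" and "S' \<equiv> Rcheck_inv_at (Weyl n q) n q m 1"
    and "M \<equiv> place1 (Weyl n q) n m 1 (Mmat n q)" and "D \<equiv> place1 (Weyl n q) n m 1 (Dermat n q)"
  shows "S' \<otimes>\<^bsub>B\<^esub> (D \<otimes>\<^bsub>B\<^esub> (S' \<otimes>\<^bsub>B\<^esub> D)) = D \<otimes>\<^bsub>B\<^esub> (S' \<otimes>\<^bsub>B\<^esub> (D \<otimes>\<^bsub>B\<^esub> S'))"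
    and "D \<otimes>\<^bsub>B\<^esub> (S \<otimes>\<^bsub>B\<^esub> (M \<otimes>\<^bsub>B\<^esub> S)) = S \<otimes>\<^bsub>B\<^esub> (M \<otimes>\<^bsub>B\<^esub> (S' \<otimes>\<^bsub>B\<^esub> D)) \<oplus>\<^bsub>B\<^esub> S"
proof -
  let ?W = "Weyl n q"
  interpret pi: complex_algebra_hom F ?W \<pi> by (rule pi_hom)
  interpret p2: complex_algebra_hom B2 "tens_alg ?W n 2" "mat_map \<pi> (tidx n 2)"
    unfolding B2_def by (rule pi.mat_map_hom) simp
  interpret am: complex_algebra_hom "tens_alg ?W n 2" B "ampl ?W (tidx n m) (take 2) (drop 2)"
    unfolding B_def by (rule pi.B.ampl2_hom[OF m])
  define h where "h = (\<lambda>X. ampl ?W (tidx n m) (take 2) (drop 2) (mat_map \<pi> (tidx n 2) X))"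
  interpret h: complex_algebra_hom B2 B h
  proof (intro complex_algebra_hom.intro complex_algebra_hom_axioms.intro calg_homI)
  qed (auto simp: h_def p2.hom_add p2.hom_mult p2.hom_smult am.hom_add am.hom_mult am.hom_smult
      intro: p2.A.complex_algebra_axioms am.B.complex_algebra_axioms)
  have hR: "h R = S"
    unfolding h_def R_def S_def pi.hom_Rcheck_at by (rule pi.B.Rcheck_at_eq_ampl[OF m, symmetric])
  \<comment> \<open>The inverse is carried over through its expression as \<open>R\<close> plus a
    scalar.\<close>
  have hR': "h R' = S'"
  proof -
    have "R' = R \<oplus>\<^bsub>B2\<^esub> (inverse q - q) \<odot>\<^bsub>B2\<^esub> \<one>\<^bsub>B2\<^esub>"
      unfolding R_def R'_def B2_def by (rule pi.A.Rcheck_inv_at_eq(1)[OF q]) auto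
    moreover have "S' = S \<oplus>\<^bsub>B\<^esub> (inverse q - q) \<odot>\<^bsub>B\<^esub> \<one>\<^bsub>B\<^esub>"
      unfolding S_def S'_def B_def using m by (intro pi.B.Rcheck_inv_at_eq(1)[OF q]) auto
    ultimately show ?thesis
      using closed by (simp add: h.hom_add h.hom_smult hR)
  qed
  have hM: "h M1 = M" "h D1 = D"
    unfolding h_def M1_def D1_def M_def D_def
    by (simp_all add: pi.hom_place1 mat_map_pi place1_eq_ampl2[OF m])
  have rel: "\<pi> r = \<zero>\<^bsub>?W\<^esub>" if "r \<in> weyl_rels n q" for r
    unfolding \<pi>_def Weyl_def by (rule presented_rel[OF weyl_rels_carrier that])
  have "mat_map \<pi> (tidx n 2) (lprod B2 [R', D1, R', D1]) = mat_map \<pi> (tidx n 2) (lprod B2 [D1, R', D1, R'])"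
    using sides_closed(3,4) rel unfolding weyl_rels_eq B2_def by (intro pi.mat_map_mat_rels) auto
  then have "h (lprod B2 [R', D1, R', D1]) = h (lprod B2 [D1, R', D1, R'])"
    by (simp only: h_def)
  then show "S' \<otimes>\<^bsub>B\<^esub> (D \<otimes>\<^bsub>B\<^esub> (S' \<otimes>\<^bsub>B\<^esub> D)) = D \<otimes>\<^bsub>B\<^esub> (S' \<otimes>\<^bsub>B\<^esub> (D \<otimes>\<^bsub>B\<^esub> S'))"
    using closed h.hom_closed[OF closed(2)] h.hom_closed[OF closed(4)] by (simp add: h.hom_mult hR' hM)
  have "mat_map \<pi> (tidx n 2) (lprod B2 [D1, R, M1, R]) = mat_map \<pi> (tidx n 2) (lprod B2 [R, M1, R', D1] \<oplus>\<^bsub>B2\<^esub> R)"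
    using sides_closed(5,6) rel unfolding weyl_rels_eq B2_def by (intro pi.mat_map_mat_rels) auto
  then have "h (lprod B2 [D1, R, M1, R]) = h (lprod B2 [R, M1, R', D1] \<oplus>\<^bsub>B2\<^esub> R)"
    by (simp only: h_def)
  then show "D \<otimes>\<^bsub>B\<^esub> (S \<otimes>\<^bsub>B\<^esub> (M \<otimes>\<^bsub>B\<^esub> S)) = S \<otimes>\<^bsub>B\<^esub> (M \<otimes>\<^bsub>B\<^esub> (S' \<otimes>\<^bsub>B\<^esub> D)) \<oplus>\<^bsub>B\<^esub> S"
    using closed h.hom_closed[OF closed(1)] h.hom_closed[OF closed(4)] by (simp add: h.hom_add h.hom_mult hR hR' hM)
qed

lemma weyl_system_Weyl:
  assumes m: "1 \<le> m" and z: "z * (q - inverse q) = 1"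
  shows "weyl_system (tens_alg (Weyl n q) n m) (Rcheck_at (Weyl n q) n q m) m q
    (place1 (Weyl n q) n m 1 (Mmat n q)) (place1 (Weyl n q) n m 1 (Dermat n q)) z"
proof -
  interpret W: complex_algebra "Weyl n q" by (rule complex_algebra_Weyl)
  have R': "hecke_system.R' (tens_alg (Weyl n q) n m) (Rcheck_at (Weyl n q) n q m) q 1 = Rcheck_inv_at (Weyl n q) n q m 1"
    if "2 \<le> m"
    using that by (intro W.R'_eq_Rcheck_inv_at q) auto
  show ?thesis
    by (intro weyl_system.intro weyl_system_axioms.intro W.hecke_system_Rcheck_at W.local1_place1 q z m
        Mmat_closed Dermat_closed) (simp_all only: R' weyl_relations)
qed

end

section \<open>The image of the q-immanant in the braided Weyl algebra\<close>

theorem corollary4p2: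
  fixes n m :: nat and q :: complex and \<mu> :: "(nat \<times> nat) set" and U :: "nat \<times> nat \<Rightarrow> nat"
    and e :: "(nat list \<Rightarrow> complex) set"
    and \<phi> :: "(uq_gen list \<Rightarrow> complex) set \<Rightarrow> (weyl_gen list \<Rightarrow> complex) set"
  assumes "n \<ge> 1" and "q \<noteq> 0" and "\<And>k::nat. k \<ge> 1 \<Longrightarrow> q ^ k \<noteq> 1"
    and "young_diagram \<mu>" and "card \<mu> = m" and "standard_tableau \<mu> U"
    and "tableau_idempotent q \<mu> U e"
    and "\<phi> \<in> calg_hom (Uo n q) (Weyl n q)"
    and "\<And>i j. i \<in> {1..n} \<Longrightarrow> j \<in> {1..n} \<Longrightarrow>
           \<phi> (Kmat n q (i, j)) = (Mmat n q \<otimes>\<^bsub>mat_alg (Weyl n q) {1..n}\<^esub> Dermat n q) (i, j)"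
  shows "\<phi> (q_immanant n q \<mu> U e) =
    (\<Prod>\<alpha>\<in>\<mu>. q powi (- 2 * content \<alpha>)) \<odot>\<^bsub>Weyl n q\<^esub>
      qtrace (Weyl n q) n q m
        (lprod (tens_alg (Weyl n q) n m)
          (map (overline (Weyl n q) n q m (Mmat n q)) [1..<m + 1] @
           map (overline (Weyl n q) n q m (Dermat n q)) (rev [1..<m + 1]) @
           [scal_mat (Weyl n q) (tidx n m) (hecke_action n q m e)]))"
proof -
  let ?W = "Weyl n q" and ?S = "{1..n}" and ?T = "tidx n m" and ?E = "hecke_action n q m e"
  note q = assms(2)
  define z where "z = inverse (q - inverse q)"
  define c where "c = tab_content \<mu> U"
  define s where "s k = z * q powi (- 2 * c k)" for k
  \<comment> \<open>Otherwise \<open>q^2 = 1\<close>, against \<open>q\<close> not being a root of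
    unity.\<close>
  have "q - inverse q \<noteq> 0"
    using assms(3)[of 2] q by (auto simp: field_simps power2_eq_square)
  then have z: "z * (q - inverse q) = 1"
    by (simp add: z_def)

  interpret Uq: complex_algebra "Uq n q"
    using Uq_hom by (simp add: complex_algebra_hom_def)
  interpret W: complex_algebra ?W by (rule complex_algebra_Weyl[OF q])
  have L_subset: "Lmat n q ` (?S \<times> ?S) \<subseteq> carrier (Uq n q)"
    using Lmat_closed[of n q] by auto
  interpret incl: complex_algebra_hom "Uo n q" "Uq n q" "\<lambda>x. x"
    unfolding Uo_def by (rule Uq.subalg_gen_hom[OF L_subset])
  interpret phi: complex_algebra_hom "Uo n q" ?W \<phi>
    by (intro complex_algebra_hom.intro complex_algebra_hom_axioms.intro assms(8)
        incl.A.complex_algebra_axioms W.complex_algebra_axioms)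
  have L: "Lmat n q \<in> carrier (mat_alg (Uo n q) ?S)"
    using Lmat_closed[of n q] unfolding mat_carrier Uo_def subalg_gen_def
    by (auto simp: PiE_iff intro!: generate_ring.incl)
  \<comment> \<open>The immanant is formed in \<open>Uq\<close> but \<open>\<phi>\<close> lives on \<open>Uo\<close>. Sums and inverses depend on the carrier, so the
    expression is transported to \<open>Uo\<close> along the inclusion.\<close>
  have "mat_map (\<lambda>x. x) ?S (Lmat n q) = Lmat n q"
    using L by (intro mat_eqI[of _ "Uo n q" ?S]) (auto simp: mat_carrier mat_map_def)
  then have "q_immanant n q \<mu> U e = immanant_expr (Uo n q) n q m (Lmat n q) s ?E"
    using incl.hom_immanant_expr[OF L q, of m s ?E]
    by (simp add: q_immanant_def q_immanant_poly_def Let_def assms(5) immanant_expr_def s_def[abs_def] z_def c_def)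
  then have phi_imm: "\<phi> (q_immanant n q \<mu> U e) = immanant_expr ?W n q m (mat_map \<phi> ?S (Lmat n q)) s ?E"
    using phi.hom_immanant_expr[OF L q] by simp

  interpret MW: complex_algebra "mat_alg ?W ?S"
    by (rule W.complex_algebra_mat_alg) simp
  note MD = Mmat_closed[OF q, of n] Dermat_closed[OF q, of n]
  have phi_L: "mat_map \<phi> ?S (Lmat n q) = Mmat n q \<otimes>\<^bsub>mat_alg ?W ?S\<^esub> Dermat n q \<oplus>\<^bsub>mat_alg ?W ?S\<^esub> (- z) \<odot>\<^bsub>mat_alg ?W ?S\<^esub> \<one>\<^bsub>mat_alg ?W ?S\<^esub>"
  proof (rule mat_eqI)
    fix i j assume ij: "i \<in> ?S" "j \<in> ?S"
    \<comment> \<open>Writing the entry of the identity matrix as a scalar treats diagonal and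
      off-diagonal entries together.\<close>
    define \<delta> where "\<delta> = (if i = j then 1 else 0 :: complex)"
    have ops: "(\<oplus>\<^bsub>Uq n q\<^esub>) = (\<oplus>\<^bsub>Uo n q\<^esub>)" "(\<odot>\<^bsub>Uq n q\<^esub>) = (\<odot>\<^bsub>Uo n q\<^esub>)" "\<one>\<^bsub>Uq n q\<^esub> = \<one>\<^bsub>Uo n q\<^esub>"
      "\<zero>\<^bsub>Uq n q\<^esub> = \<zero>\<^bsub>Uo n q\<^esub>"
      by (simp_all add: Uo_def subalg_gen_def)
    have lc: "Lmat n q (i, j) \<in> carrier (Uo n q)"
      using L ij by auto
    have "Kmat n q (i, j) = Lmat n q (i, j) \<oplus>\<^bsub>Uo n q\<^esub> (z * \<delta>) \<odot>\<^bsub>Uo n q\<^esub> \<one>\<^bsub>Uo n q\<^esub>"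
    proof -
      have "Kmat n q (i, j) = Lmat n q (i, j) \<oplus>\<^bsub>Uo n q\<^esub> z \<odot>\<^bsub>Uo n q\<^esub> (if i = j then \<one>\<^bsub>Uo n q\<^esub> else \<zero>\<^bsub>Uo n q\<^esub>)"
        unfolding Kmat_def Let_def mat_entry(2)[OF ij] mat_entry(5)[OF ij] mat_entry(3)[OF ij] ops z_def
        by (simp only: inverse_eq_divide)
      also have "z \<odot>\<^bsub>Uo n q\<^esub> (if i = j then \<one>\<^bsub>Uo n q\<^esub> else \<zero>\<^bsub>Uo n q\<^esub>) = (z * \<delta>) \<odot>\<^bsub>Uo n q\<^esub> \<one>\<^bsub>Uo n q\<^esub>"
        by (cases "i = j") (simp_all only: \<delta>_def simp_thms if_True if_False mult_1_right mult_zero_right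
            incl.A.smult_zero incl.A.smult_0[OF incl.A.one_closed])
      finally show ?thesis .
    qed
    then have "(Mmat n q \<otimes>\<^bsub>mat_alg ?W ?S\<^esub> Dermat n q) (i, j) = \<phi> (Lmat n q (i, j)) \<oplus>\<^bsub>?W\<^esub> (z * \<delta>) \<odot>\<^bsub>?W\<^esub> \<one>\<^bsub>?W\<^esub>"
      using assms(9)[OF ij] lc
      by (simp only: phi.hom_add phi.hom_smult phi.hom_one incl.A.smult_closed incl.A.one_closed)
    moreover have "((- z) \<odot>\<^bsub>mat_alg ?W ?S\<^esub> \<one>\<^bsub>mat_alg ?W ?S\<^esub>) (i, j) = (- (z * \<delta>)) \<odot>\<^bsub>?W\<^esub> \<one>\<^bsub>?W\<^esub>"
      using ij by (simp add: \<delta>_def)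
    ultimately have "(Mmat n q \<otimes>\<^bsub>mat_alg ?W ?S\<^esub> Dermat n q \<oplus>\<^bsub>mat_alg ?W ?S\<^esub> (- z) \<odot>\<^bsub>mat_alg ?W ?S\<^esub> \<one>\<^bsub>mat_alg ?W ?S\<^esub>) (i, j)
        = \<phi> (Lmat n q (i, j)) \<oplus>\<^bsub>?W\<^esub> ((z * \<delta>) + (- (z * \<delta>))) \<odot>\<^bsub>?W\<^esub> \<one>\<^bsub>?W\<^esub>"
      using ij lc unfolding W.smult_l_distr[OF W.one_closed] mat_entry(2)[OF ij] by (simp add: W.a_assoc)
    then show "mat_map \<phi> ?S (Lmat n q) (i, j)
        = (Mmat n q \<otimes>\<^bsub>mat_alg ?W ?S\<^esub> Dermat n q \<oplus>\<^bsub>mat_alg ?W ?S\<^esub> (- z) \<odot>\<^bsub>mat_alg ?W ?S\<^esub> \<one>\<^bsub>mat_alg ?W ?S\<^esub>) (i, j)"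
      using ij lc by simp
  next
    show "mat_map \<phi> ?S (Lmat n q) \<in> carrier (mat_alg ?W ?S)"
      by (rule complex_algebra_hom.hom_closed[OF phi.mat_map_hom L]) simp
  qed (use MD in auto)

  have bij: "bij_betw U \<mu> {1..m}"
    using assms(5,6) by (simp add: standard_tableau_def)
  \<comment> \<open>The bijection \<open>U\<close> from boxes to \<open>1, ..., m\<close> turns the
    product over boxes into one over entries of the tableau.\<close>
  have a: "(\<Prod>\<alpha>\<in>\<mu>. q powi (- 2 * content \<alpha>)) = (\<Prod>j\<in>{1..m}. q powi (- 2 * c j))"
    using bij by (subst prod.reindex_bij_betw[OF bij, symmetric])
      (auto simp: c_def tab_content_def bij_betw_def intro!: prod.cong)

  let ?B = "tens_alg ?W n m" and ?G = "scal_mat ?W ?T ?E"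
  interpret B: complex_algebra ?B by (rule W.tens_alg_complex_algebra)
  interpret S: complex_algebra_hom "tens_alg complex_alg n m" ?B "scal_mat ?W ?T"
    by (rule W.scal_mat_hom) simp
  have e: "e \<in> carrier (Hecke q m)" "\<And>k. k \<in> {1..m} \<Longrightarrow>
      jucys_murphy q m k \<otimes>\<^bsub>Hecke q m\<^esub> e = q powi (2 * c k) \<odot>\<^bsub>Hecke q m\<^esub> e"
    using assms(5,7) by (auto simp: tableau_idempotent_def Let_def c_def)
  have G: "?G \<in> carrier ?B" by simp
  \<comment> \<open>The equation holds for complex matrices and is carried to the Weyl algebra by
    \<open>scal_mat\<close>.\<close>
  have eigen: "lprod ?B (map (Rcheck_at ?W n q m) (rev [1..<k] @ [1..<k])) \<otimes>\<^bsub>?B\<^esub> ?G = q powi (2 * c k) \<odot>\<^bsub>?B\<^esub> ?G"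
    if k: "k \<in> {1..m}" for k
  proof -
    have km: "k \<le> m" using k by simp
    let ?C = "tens_alg complex_alg n m" and ?w = "map (Rcheck_at complex_alg n q m) (rev [1..<k] @ [1..<k])"
    have w: "set ?w \<subseteq> carrier ?C"
      by auto
    note act = hecke_action_jucys_murphy[OF q e(1) km e(2)[OF k], of n]
    have "lprod ?B (map (Rcheck_at ?W n q m) (rev [1..<k] @ [1..<k])) = scal_mat ?W ?T (lprod ?C ?w)"
      unfolding S.hom_lprod[OF w] by (simp add: Rcheck_at_eq_scal_mat[of ?W, symmetric] comp_def)
    then have "lprod ?B (map (Rcheck_at ?W n q m) (rev [1..<k] @ [1..<k])) \<otimes>\<^bsub>?B\<^esub> ?G = scal_mat ?W ?T (lprod ?C ?w \<otimes>\<^bsub>?C\<^esub> ?E)"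
      using w act(2) by (simp only: S.hom_mult S.A.lprod_closed)
    also have "\<dots> = q powi (2 * c k) \<odot>\<^bsub>?B\<^esub> ?G"
      unfolding act(1) by (rule S.hom_smult[OF act(2)])
    finally show ?thesis .
  qed

  let ?M = "map (overline ?W n q m (Mmat n q)) [1..<m + 1]" and ?D = "map (overline ?W n q m (Dermat n q)) (rev [1..<m + 1])"
  let ?X = "mat_map \<phi> ?S (Lmat n q)"
  have MDc: "set ?M \<subseteq> carrier ?B" "set ?D \<subseteq> carrier ?B"
    using W.overline_closed[OF MD(1) q] W.overline_closed[OF MD(2) q] by auto
  have core: "lprod ?B (map (\<lambda>k. overline ?W n q m ?X k \<oplus>\<^bsub>?B\<^esub> s k \<odot>\<^bsub>?B\<^esub> \<one>\<^bsub>?B\<^esub>) [1..<m + 1]) \<otimes>\<^bsub>?B\<^esub> ?G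
      = (\<Prod>j\<in>{1..m}. q powi (- 2 * c j)) \<odot>\<^bsub>?B\<^esub> lprod ?B (?M @ ?D @ [?G])"
  \<comment> \<open>Without tensor factors there is no first one in which to place \<open>M\<close>
    and \<open>D\<close>; both sides then reduce to the image of the idempotent.\<close>
  proof (cases "m = 0")
    case True
    then have "[1..<m + 1] = []" "{1..m} = {}"
      by auto
    then show ?thesis
      by (simp only: list.map rev.simps append.simps prod.empty B.lprod_Nil B.lprod_Cons B.l_one B.r_one
          B.smult_1 G)
  next
    case False
    then have m: "1 \<le> m" by simp
    interpret P: weyl_system ?B "Rcheck_at ?W n q m" m q "place1 ?W n m 1 (Mmat n q)" "place1 ?W n m 1 (Dermat n q)" z
      by (rule weyl_system_Weyl[OF q m z])
    interpret p1: complex_algebra_hom "mat_alg ?W ?S" ?B "place1 ?W n m 1"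
      by (rule W.place1_hom[OF m])
    \<comment> \<open>Placement in the first factor is a homomorphism, so the image of
      \<open>Lmat\<close> becomes the abstract \<open>M D - z\<close>.\<close>
    have PL: "place1 ?W n m 1 ?X = P.L"
      unfolding phi_L P.L_def using MD by (simp add: p1.hom_add p1.hom_mult p1.hom_smult)
    have ov: "map (\<lambda>k. overline ?W n q m ?X k \<oplus>\<^bsub>?B\<^esub> s k \<odot>\<^bsub>?B\<^esub> \<one>\<^bsub>?B\<^esub>) [1..<m + 1]
        = map (\<lambda>k. P.over P.L k \<oplus>\<^bsub>?B\<^esub> (z * q powi (- 2 * c k)) \<odot>\<^bsub>?B\<^esub> \<one>\<^bsub>?B\<^esub>) [1..<m + 1]"
      "?M = map (P.over (place1 ?W n m 1 (Mmat n q))) [1..<m + 1]"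
      "?D = map (P.over (place1 ?W n m 1 (Dermat n q))) (rev [1..<m + 1])"
      by (auto simp: W.over_eq_overline[OF q] PL[symmetric] s_def)
    have "lprod ?B (?M @ ?D @ [?G]) = lprod ?B ?M \<otimes>\<^bsub>?B\<^esub> (lprod ?B ?D \<otimes>\<^bsub>?B\<^esub> ?G)"
      by (rule B.lprod_append_snoc[OF MDc G])
    also have "lprod ?B ?D = P.Dprod (Suc m)"
      unfolding ov P.Dprod_def Suc_eq_plus1 ..
    finally show ?thesis
      using P.product_formula[OF q order_refl G, of c] eigen unfolding ov P.jm_def Suc_eq_plus1 by simp
  qed
  have "\<phi> (q_immanant n q \<mu> U e) = qtrace ?W n q m ((\<Prod>j\<in>{1..m}. q powi (- 2 * c j)) \<odot>\<^bsub>?B\<^esub> lprod ?B (?M @ ?D @ [?G]))"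
    unfolding phi_imm immanant_expr_def core ..
  also have "\<dots> = (\<Prod>j\<in>{1..m}. q powi (- 2 * c j)) \<odot>\<^bsub>?W\<^esub> qtrace ?W n q m (lprod ?B (?M @ ?D @ [?G]))"
    using MDc G by (intro W.qtrace_smult B.lprod_closed) auto
  finally show ?thesis
    unfolding a .
qed

end
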